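(* Let $0\le\gamma\le 1$ and let $\widehat\Delta_N$ be the restricted spectral gap defined in the context. For all $N\ge 3$, $$\widehat\Delta_N \ \ge\ \left(1-\frac{A_N}{N^2}\right)\widehat\Delta_{N-1},\qquad\text{where}\quad A_N=\frac{p(N)+\gamma\, q(N)}{r(N)}$$ with $$p(N)=5N^7+31N^6+15N^5+131N^4+256N^3-102N^2,$$ $$q(N)=5N^7-5N^6-87N^5-211N^4-164N^3+78N^2,$$ $$r(N)=(N^2+4N-12)(N-1)^3(N+1)(N-2).$$ Moreover, for every integer $N_0\ge 3$ such that $A_N/N^2<1$ for all $N\ge N_0$ (which is true for all sufficiently large $N_0$), one has for all $N\ge N_0$ $$\widehat\Delta_N\ \ge\ N_0^{\gamma-1}\left(\prod_{j=3}^{N_0}\left[1-\frac{4j+1}{(j-1)^2(j+1)}\right]\right)\prod_{k=N_0}^{N}\left(1-\frac{A_k}{k^2}\right),$$ and in particular $\liminf_{N\to\infty}\widehat\Delta_N>0$, with a computable lower bound.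
   Context: Fix $\gamma\in[0,1]$. For $N\ge 2$ let $S^{N-1}(\sqrt N)=\{v\in\mathbb R^N:\sum_{j=1}^N v_j^2=N\}$ with the uniform probability measure $\sigma$; inner product $\langle\cdot,\cdot\rangle$ and norm $\|\cdot\|_2$ are those of $L^2(S^{N-1}(\sqrt N),\sigma)$. For $i<j$ and an angle $\theta$ let $R_{i,j,\theta}v$ be the vector with $i$-th coordinate $v_i\cos\theta+v_j\sin\theta$, $j$-th coordinate $-v_i\sin\theta+v_j\cos\theta$, and all other coordinates equal to those of $v$. Put $[f]^{(i,j)}(v)=\frac1{2\pi}\int_{-\pi}^{\pi}f(R_{i,j,\theta}v)\,d\theta$ and $$\mathcal E_N(f,f)=N\binom N2^{-1}\sum_{i<j}\int_{S^{N-1}(\sqrt N)}(v_i^2+v_j^2)^\gamma\,(f-[f]^{(i,j)})^2\,d\sigma .$$ Let $\mathcal A_N$ be the subspace of $L^2(S^{N-1}(\sqrt N),\sigma)$ of functions of the form $f(v)=\sum_{j=1}^N\varphi(v_j)$ for a function $\varphi$ of one variable. Then $$\widehat\Delta_N=\inf\{\mathcal E_N(f,f):\ \|f\|_2=1,\ \langle f,1\rangle=0,\ f\in\mathcal A_N\}.$$ *)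

theory Defs
  imports "HOL-Analysis.Analysis"
begin

text \<open>A vector of \<open>R^N\<close> is a function \<open>nat \<Rightarrow> real\<close> that is \<open>undefined\<close> outside \<open>{1..N}\<close>,
  that is, a point of \<open>Pi\<^sub>M {1..N} (\<lambda>_. borel)\<close>. The dimension is then a number over which one
  can quantify.\<close>

definition kac_sphere :: "nat \<Rightarrow> (nat \<Rightarrow> real) set" where
  "kac_sphere N = {v \<in> {1..N} \<rightarrow>\<^sub>E UNIV. (\<Sum>j=1..N. (v j)\<^sup>2) = real N}"

definition sphere_proj :: "nat \<Rightarrow> (nat \<Rightarrow> real) \<Rightarrow> (nat \<Rightarrow> real)" where
  "sphere_proj N x = (\<lambda>j\<in>{1..N}. sqrt (real N) * x j / L2_set x {1..N})"

text \<open>The uniform probability measure on the sphere is the normalised cone measure: the image of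
  the uniform distribution on the unit ball under radial projection. The projection sends the
  origin, a null set, to the origin, and \<open>restrict_space\<close> turns the image measure into a measure
  whose space is the sphere itself.\<close>

definition sphere_measure :: "nat \<Rightarrow> (nat \<Rightarrow> real) measure" where
  "sphere_measure N =
     restrict_space
       (distr
         (uniform_measure (Pi\<^sub>M {1..N} (\<lambda>_. lborel))
            {x \<in> {1..N} \<rightarrow>\<^sub>E UNIV. L2_set x {1..N} \<le> 1})
         (Pi\<^sub>M {1..N} (\<lambda>_. borel)) (sphere_proj N))
       (kac_sphere N)"

text \<open>Elements of \<open>L\<^sup>2\<close> are represented by functions rather than by classes modulo null sets.
  Values outside the sphere are irrelevant.\<close>

definition L2_sphere :: "nat \<Rightarrow> ((nat \<Rightarrow> real) \<Rightarrow> real) set" where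
  "L2_sphere N =
     {f \<in> borel_measurable (sphere_measure N). integrable (sphere_measure N) (\<lambda>v. (f v)\<^sup>2)}"

definition L2_inner :: "nat \<Rightarrow> ((nat \<Rightarrow> real) \<Rightarrow> real) \<Rightarrow> ((nat \<Rightarrow> real) \<Rightarrow> real) \<Rightarrow> real" where
  "L2_inner N f g = (\<integral>v. f v * g v \<partial>sphere_measure N)"

definition L2_norm :: "nat \<Rightarrow> ((nat \<Rightarrow> real) \<Rightarrow> real) \<Rightarrow> real" where
  "L2_norm N f = sqrt (L2_inner N f f)"

definition pair_rot :: "nat \<Rightarrow> nat \<Rightarrow> real \<Rightarrow> (nat \<Rightarrow> real) \<Rightarrow> (nat \<Rightarrow> real)" where
  "pair_rot i j \<theta> v =
     v(i := v i * cos \<theta> + v j * sin \<theta>, j := - v i * sin \<theta> + v j * cos \<theta>)"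

definition pair_avg :: "nat \<Rightarrow> nat \<Rightarrow> ((nat \<Rightarrow> real) \<Rightarrow> real) \<Rightarrow> (nat \<Rightarrow> real) \<Rightarrow> real" where
  "pair_avg i j f v = 1 / (2 * pi) * (LBINT \<theta>:{-pi..pi}. f (pair_rot i j \<theta> v))"

text \<open>In Isabelle \<open>0 powr 0 = 0\<close>. This affects the weight below only for \<open>\<gamma> = 0\<close> and on the set
  \<open>v i = v j = 0\<close>, which is empty for \<open>N = 2\<close> and a null set for \<open>N \<ge> 3\<close>.\<close>

definition kac_dirichlet :: "real \<Rightarrow> nat \<Rightarrow> ((nat \<Rightarrow> real) \<Rightarrow> real) \<Rightarrow> real" where
  "kac_dirichlet \<gamma> N f =
     real N * inverse (real (N choose 2)) *
     (\<Sum>(i, j) \<in> {(i, j). 1 \<le> i \<and> i < j \<and> j \<le> N}.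
        \<integral>v. ((v i)\<^sup>2 + (v j)\<^sup>2) powr \<gamma> * (f v - pair_avg i j f v)\<^sup>2 \<partial>sphere_measure N)"

definition sum_space :: "nat \<Rightarrow> ((nat \<Rightarrow> real) \<Rightarrow> real) set" where
  "sum_space N =
     {f \<in> L2_sphere N. \<exists>\<phi> \<in> borel_measurable borel.
        AE v in sphere_measure N. f v = (\<Sum>j=1..N. \<phi> (v j))}"

text \<open>For \<open>N \<ge> 2\<close> the infimum is over a nonempty set of nonnegative numbers, so that \<open>Inf\<close> on the
  reals is the usual infimum.\<close>

definition restricted_gap :: "real \<Rightarrow> nat \<Rightarrow> real" where
  "restricted_gap \<gamma> N =
     Inf {kac_dirichlet \<gamma> N f | f.
       L2_norm N f = 1 \<and> L2_inner N f (\<lambda>_. 1) = 0 \<and> f \<in> sum_space N}"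

definition coeff_p :: "real \<Rightarrow> real" where
  "coeff_p x = 5 * x^7 + 31 * x^6 + 15 * x^5 + 131 * x^4 + 256 * x^3 - 102 * x^2"

definition coeff_q :: "real \<Rightarrow> real" where
  "coeff_q x = 5 * x^7 - 5 * x^6 - 87 * x^5 - 211 * x^4 - 164 * x^3 + 78 * x^2"

definition coeff_r :: "real \<Rightarrow> real" where
  "coeff_r x = (x^2 + 4 * x - 12) * (x - 1)^3 * (x + 1) * (x - 2)"

definition coeff_A :: "real \<Rightarrow> nat \<Rightarrow> real" where
  "coeff_A \<gamma> N = (coeff_p (real N) + \<gamma> * coeff_q (real N)) / coeff_r (real N)"

end

theory Submission
  imports Defs "HOL-Probability.Probability_Measure"
begin

text \<open>For \<open>f = \<Sum>j. \<phi> (v j)\<close> all pairs \<open>(i,j)\<close> contribute equally to the Dirichlet form, and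
  conditioning on the last coordinate \<open>x\<close> bounds the form in dimension \<open>N\<close> below by the gap in
  dimension \<open>N - 1\<close> times \<open>N/(N-1)\<close> times the integral of \<open>W powr \<gamma>\<close> against the conditional
  variance of \<open>f\<close>, where \<open>W = (N - x\<^sup>2)/(N - 1)\<close>. With \<open>u = 1 - W\<close> one has
  \<open>W powr \<gamma> \<ge> \<gamma> (1 - u) + (1 - \<gamma>) (1 - u\<^sup>2)\<close>, so that only the cases \<open>\<gamma> = 1\<close> and \<open>\<gamma> = 0\<close> and the
  integral of \<open>u\<^sup>2\<close> against the conditional variance are needed. These are controlled by the spectrum
  of the correlation operator of two coordinates: it maps \<open>x\<^sup>m\<close> to a polynomial of degree at most \<open>m\<close>,
  hence is triangular on polynomials, and its eigenvalues beyond degree two are at most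
  \<open>3/(N\<^sup>2 - 1)\<close> in modulus. The eigenvalue of \<open>x\<^sup>2 - 1\<close> is negative, and \<open>\<Sum>j. (v j)\<^sup>2 - 1\<close> vanishes on
  the sphere, so this function can be subtracted from \<open>\<phi>\<close>. The recursion started at \<open>N = 2\<close> with
  \<open>\<gamma> = 1\<close> gives the constant in the product bound.\<close>

section \<open>Polar coordinates and the uniform measure on the sphere\<close>

text \<open>Conditioning gains the factor N/(N-1) and loses the variance of the slice means, which
  is also of relative order 1/N. The two must cancel up to O(1/N^2), since otherwise the product of
  the step factors would not converge. This dictates the minorant of \<open>W powr \<gamma>\<close>:
  it touches the power to first order at W = 1, and the linear term in u integrates to zero against
  f^2, because for symmetric f each squared coordinate has f^2-average one. Only the slice means and
  u^2 cost anything. The cost of u^2 must be measured by f and not by \<phi>, although f can vanish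
  when \<phi> does not; hence the reduction modulo x^2 - 1. That estimate uses the correlation bound
  in dimension N - 1 as well and so requires N >= 4. At N = 3 the factor 1 - A_N/N^2 is negative and
  the inequality is trivial. For \<gamma> = 1 there is no quadratic term, so that recursion starts
  from the circle. The rational function A_N is a majorant of the losses obtained, with equality
  neither at \<gamma> = 0 nor at \<gamma> = 1.\<close>

declare One_nat_def [simp del]

abbreviation PB :: "nat \<Rightarrow> (nat \<Rightarrow> real) measure" where
  "PB n \<equiv> Pi\<^sub>M {1..n} (\<lambda>_. borel)"

abbreviation PL :: "nat \<Rightarrow> (nat \<Rightarrow> real) measure" where
  "PL n \<equiv> Pi\<^sub>M {1..n} (\<lambda>_. lborel)"

abbreviation nrm :: "nat \<Rightarrow> (nat \<Rightarrow> real) \<Rightarrow> real" where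
  "nrm n x \<equiv> L2_set x {1..n}"

text \<open>The measure \<open>sphere_measure n\<close> before its restriction to the sphere, so that it lives on the
  full product space.\<close>

definition usph :: "nat \<Rightarrow> (nat \<Rightarrow> real) measure" where
  "usph n = distr
         (uniform_measure (PL n) {x \<in> {1..n} \<rightarrow>\<^sub>E UNIV. nrm n x \<le> 1})
         (PB n) (sphere_proj n)"

interpretation lborel_prod: product_sigma_finite "\<lambda>_::nat. lborel :: real measure"
  by standard

lemma sphere_measure_usph: "sphere_measure n = restrict_space (usph n) (kac_sphere n)"
  by (simp add: sphere_measure_def usph_def)

lemma sets_PL [measurable_cong, simp]: "sets (PL n) = sets (PB n)"
  by (intro sets_PiM_cong) auto

lemma space_PB: "space (PB n) = {1..n} \<rightarrow>\<^sub>E UNIV"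
  by (subst space_PiM) simp

lemma space_PL: "space (PL n) = {1..n} \<rightarrow>\<^sub>E UNIV"
  by (simp add: space_PiM)

lemma sets_usph [measurable_cong, simp]: "sets (usph n) = sets (PB n)"
  by (simp add: usph_def)

lemma space_usph [simp]: "space (usph n) = {1..n} \<rightarrow>\<^sub>E UNIV"
  by (simp add: usph_def space_PB)

lemma measurable_nrm [measurable]: "nrm n \<in> borel_measurable (PB n)"
  unfolding L2_set_def by measurable

lemma measurable_sphere_proj [measurable]: "sphere_proj n \<in> measurable (PB n) (PB n)"
  unfolding sphere_proj_def by measurable

lemma nrm_scale: "c \<ge> 0 \<Longrightarrow> nrm n (\<lambda>j\<in>{1..n}. c * x j) = c * nrm n x"
  by (subst L2_set_right_distrib) (auto intro!: L2_set_cong)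

lemma sphere_proj_scale: "c > 0 \<Longrightarrow> sphere_proj n (\<lambda>j\<in>{1..n}. c * x j) = sphere_proj n x"
  using nrm_scale[of c x n] by (auto simp: sphere_proj_def fun_eq_iff)

lemma emeasure_lborel_scale:
  fixes A :: "real set"
  assumes "c > 0" "A \<in> sets borel"
  shows "ennreal c * emeasure lborel {t. c * t \<in> A} = emeasure lborel A"
proof -
  have [measurable]: "A \<in> sets borel" by fact
  have "{t. c * t \<in> A} \<in> sets borel" by measurable
  moreover have "emeasure lborel A = (\<integral>\<^sup>+x. indicator A x \<partial>lborel)"
    using assms by simp
  moreover have "\<dots> = ennreal \<bar>c\<bar> * (\<integral>\<^sup>+x. indicator A (0 + c * x) \<partial>lborel)"
    using assms by (intro nn_integral_real_affine) auto
  moreover have "(\<integral>\<^sup>+x. indicator A (0 + c * x) \<partial>lborel) = (\<integral>\<^sup>+x. indicator {t. c * t \<in> A} x \<partial>lborel)"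
    by (intro nn_integral_cong) (auto simp: indicator_def)
  ultimately show ?thesis using assms by simp
qed

text \<open>Boxes determine the product measure, and on a box each of the n sides contributes one
  factor c.\<close>

lemma PL_scale:
  assumes "c > 0"
  shows "scale_measure (ennreal (c ^ n)) (distr (PL n) (PL n) (\<lambda>x. \<lambda>j\<in>{1..n}. c * x j)) = PL n"
proof (rule lborel_prod.PiM_eqI)
  fix A :: "nat \<Rightarrow> real set" assume A: "\<And>i. i \<in> {1..n} \<Longrightarrow> A i \<in> sets lborel"
  have eq: "(\<lambda>x. \<lambda>j\<in>{1..n}. c * x j) -` (\<Pi>\<^sub>E i\<in>{1..n}. A i) \<inter> space (PL n)
      = (\<Pi>\<^sub>E i\<in>{1..n}. {t. c * t \<in> A i})"
    by (auto simp: space_PL PiE_def Pi_def extensional_def)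
  have mA: "{t. c * t \<in> A i} \<in> sets lborel" if "i \<in> {1..n}" for i
  proof -
    have [measurable]: "A i \<in> sets borel" using A[OF that] by simp
    show ?thesis by measurable
  qed
  have "emeasure (distr (PL n) (PL n) (\<lambda>x. \<lambda>j\<in>{1..n}. c * x j)) (\<Pi>\<^sub>E i\<in>{1..n}. A i)
     = emeasure (PL n) (\<Pi>\<^sub>E i\<in>{1..n}. {t. c * t \<in> A i})"
    by (subst emeasure_distr) (use A in \<open>auto simp flip: eq intro!: sets_PiM_I_finite\<close>)
  also have "\<dots> = (\<Prod>i\<in>{1..n}. emeasure lborel {t. c * t \<in> A i})"
    using mA by (subst lborel_prod.emeasure_PiM) auto
  finally have "emeasure (scale_measure (ennreal (c ^ n)) (distr (PL n) (PL n) (\<lambda>x. \<lambda>j\<in>{1..n}. c * x j))) (\<Pi>\<^sub>E i\<in>{1..n}. A i)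
    = (\<Prod>i\<in>{1..n}. ennreal c * emeasure lborel {t. c * t \<in> A i})"
    using assms by (simp add: prod.distrib ennreal_power)
  also have "\<dots> = (\<Prod>i\<in>{1..n}. emeasure lborel (A i))"
    using A assms by (intro prod.cong) (auto intro!: emeasure_lborel_scale)
  finally show "emeasure (scale_measure (ennreal (c ^ n)) (distr (PL n) (PL n) (\<lambda>x. \<lambda>j\<in>{1..n}. c * x j))) (\<Pi>\<^sub>E i\<in>{1..n}. A i)
    = (\<Prod>i\<in>{1..n}. emeasure lborel (A i))" .
qed auto

lemma PL_ball:
  assumes "r > 0"
  shows "emeasure (PL n) {x \<in> {1..n} \<rightarrow>\<^sub>E UNIV. nrm n x \<le> r} = ennreal (unit_ball_vol (real n) * r ^ n)"
proof -
  have "{f. sqrt (\<Sum>i\<in>{1..n}. (f i)\<^sup>2) \<le> r} \<inter> space (PL n) = {x \<in> {1..n} \<rightarrow>\<^sub>E UNIV. nrm n x \<le> r}"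
    by (auto simp: space_PL L2_set_def)
  then show ?thesis
    using emeasure_cball_aux[of "{1..n}" r] assms by simp
qed

text \<open>A cone of directions cut off at radius r is the dilate by r of the same cone cut off at
  radius one. This homogeneity makes norm and direction independent in
  \<open>distr_polar\<close>.\<close>

lemma PL_sector_scale:
  assumes "r > 0" and [measurable]: "B \<in> sets (PB n)"
  shows "emeasure (PL n) {x \<in> {1..n} \<rightarrow>\<^sub>E UNIV. nrm n x \<le> r \<and> sphere_proj n x \<in> B}
     = ennreal (r ^ n) * emeasure (PL n) {x \<in> {1..n} \<rightarrow>\<^sub>E UNIV. nrm n x \<le> 1 \<and> sphere_proj n x \<in> B}"
proof -
  define f where "f x = (\<lambda>j\<in>{1..n}. r * x j)" for x :: "nat \<Rightarrow> real"
  let ?S = "\<lambda>r. {x \<in> space (PL n). nrm n x \<le> r \<and> sphere_proj n x \<in> B}"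
  have [measurable]: "f \<in> measurable (PL n) (PL n)"
    unfolding f_def by measurable
  have [measurable]: "?S r \<in> sets (PB n)" for r
    unfolding space_PL space_PB[symmetric] by measurable
  have "emeasure (PL n) (?S r) = ennreal (r ^ n) * emeasure (distr (PL n) (PL n) f) (?S r)"
    unfolding f_def by (subst (1) PL_scale[OF assms(1), of n, symmetric]) (simp only: f_def[abs_def] emeasure_scale_measure)
  also have "emeasure (distr (PL n) (PL n) f) (?S r) = emeasure (PL n) (f -` ?S r \<inter> space (PL n))"
    by (subst emeasure_distr) auto
  also have "f -` ?S r \<inter> space (PL n) = ?S 1"
    using assms(1) by (auto simp: f_def nrm_scale sphere_proj_scale space_PL)
  finally show ?thesis by (simp add: space_PL)
qed

lemma PL_origin:
  assumes "n \<ge> 1"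
  shows "emeasure (PL n) {x \<in> {1..n} \<rightarrow>\<^sub>E UNIV. nrm n x \<le> 0} = 0"
proof -
  have "{x \<in> {1..n} \<rightarrow>\<^sub>E UNIV. nrm n x \<le> 0} \<subseteq> (\<Pi>\<^sub>E i\<in>{1..n}. {0})"
  proof
    fix x assume x: "x \<in> {x \<in> {1..n} \<rightarrow>\<^sub>E UNIV. nrm n x \<le> 0}"
    then have "nrm n x = 0" by (simp add: L2_set_nonneg order_antisym)
    then have "\<forall>i\<in>{1..n}. x i = 0" by (subst (asm) L2_set_eq_0_iff) auto
    then show "x \<in> (\<Pi>\<^sub>E i\<in>{1..n}. {0})" using x by (auto simp: PiE_iff fun_eq_iff extensional_def)
  qed
  then have "emeasure (PL n) {x \<in> {1..n} \<rightarrow>\<^sub>E UNIV. nrm n x \<le> 0} \<le> emeasure (PL n) (\<Pi>\<^sub>E i\<in>{1..n}. {0})"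
    by (rule emeasure_mono) (rule sets_PiM_I_finite, simp_all)
  also have "\<dots> = 0"
    using assms by (subst lborel_prod.emeasure_PiM) (auto simp: zero_power)
  finally show ?thesis by simp
qed

lemma AE_PL_nrm_pos: "n \<ge> 1 \<Longrightarrow> AE x in PL n. nrm n x > 0"
proof (rule AE_I[where N="{x \<in> {1..n} \<rightarrow>\<^sub>E UNIV. nrm n x \<le> 0}"])
  show "{x \<in> {1..n} \<rightarrow>\<^sub>E UNIV. nrm n x \<le> 0} \<in> sets (PL n)"
    unfolding space_PB[symmetric] by measurable
qed (auto simp: PL_origin space_PL not_less)

abbreviation unit_ball_PL :: "nat \<Rightarrow> (nat \<Rightarrow> real) set" where
  "unit_ball_PL n \<equiv> {x \<in> {1..n} \<rightarrow>\<^sub>E UNIV. nrm n x \<le> 1}"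

lemma sets_unit_ball_PL [measurable]: "unit_ball_PL n \<in> sets (PB n)"
  unfolding space_PB[symmetric] by measurable

lemma emeasure_unit_ball_PL: "emeasure (PL n) (unit_ball_PL n) = ennreal (unit_ball_vol (real n))"
  using PL_ball[of 1 n] by simp

lemma unit_ball_vol_nat_pos: "unit_ball_vol (real n) > 0"
  by (simp add: unit_ball_vol_pos)

lemma prob_space_usph: "prob_space (usph n)"
  unfolding usph_def
proof (rule prob_space.prob_space_distr)
  show "prob_space (uniform_measure (PL n) (unit_ball_PL n))"
    using less_imp_neq[OF unit_ball_vol_nat_pos[of n], symmetric]
    by (intro prob_space_uniform_measure) (simp_all add: emeasure_unit_ball_PL)
qed simp

lemma nn_integral_usph:
  assumes [measurable]: "F \<in> borel_measurable (PB n)"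
  shows "(\<integral>\<^sup>+v. F v \<partial>usph n) = (\<integral>\<^sup>+x. F (sphere_proj n x) * indicator (unit_ball_PL n) x \<partial>PL n) / ennreal (unit_ball_vol (real n))"
proof -
  have "(\<integral>\<^sup>+v. F v \<partial>usph n) = (\<integral>\<^sup>+x. F (sphere_proj n x) \<partial>uniform_measure (PL n) (unit_ball_PL n))"
    unfolding usph_def by (subst nn_integral_distr) simp_all
  also have "\<dots> = (\<integral>\<^sup>+x. F (sphere_proj n x) * indicator (unit_ball_PL n) x \<partial>PL n) / ennreal (unit_ball_vol (real n))"
    by (subst nn_integral_uniform_measure) (simp_all add: emeasure_unit_ball_PL)
  finally show ?thesis .
qed

lemma emeasure_usph:
  assumes [measurable]: "B \<in> sets (PB n)"
  shows "emeasure (usph n) B = emeasure (PL n) {x \<in> {1..n} \<rightarrow>\<^sub>E UNIV. nrm n x \<le> 1 \<and> sphere_proj n x \<in> B} / ennreal (unit_ball_vol (real n))"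
proof -
  have m: "{x \<in> space (PB n). nrm n x \<le> 1 \<and> sphere_proj n x \<in> B} \<in> sets (PB n)"
    by measurable
  have "emeasure (usph n) B = (\<integral>\<^sup>+v. indicator B v \<partial>usph n)"
    by simp
  also have "\<dots> = (\<integral>\<^sup>+x. indicator B (sphere_proj n x) * indicator (unit_ball_PL n) x \<partial>PL n) / ennreal (unit_ball_vol (real n))"
    by (rule nn_integral_usph) measurable
  also have "(\<integral>\<^sup>+x. indicator B (sphere_proj n x) * indicator (unit_ball_PL n) x \<partial>PL n)
     = (\<integral>\<^sup>+x. indicator {x \<in> space (PB n). nrm n x \<le> 1 \<and> sphere_proj n x \<in> B} x \<partial>PL n)"
    by (intro nn_integral_cong) (auto simp: indicator_def space_PB)
  finally show ?thesis using m by (simp add: space_PB)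
qed

text \<open>Polar coordinates without a surface measure: norm and direction are independent under
  Lebesgue measure. For a fixed set B of directions both sides are measures in the radial variable,
  so it suffices to compare them on half-lines, where \<open>PL_sector_scale\<close>
  applies.\<close>

lemma distr_polar:
  assumes n: "n \<ge> 1"
  shows "distr (PL n) borel (nrm n) \<Otimes>\<^sub>M usph n
       = distr (PL n) (borel \<Otimes>\<^sub>M PB n) (\<lambda>x. (nrm n x, sphere_proj n x))"
proof (rule pair_measure_eqI)
  interpret c: prob_space "usph n" by (rule prob_space_usph)
  show "sigma_finite_measure (usph n)" by unfold_locales
  let ?V = "unit_ball_vol (real n)"
  let ?R = "distr (PL n) borel (nrm n)"
  have V: "?V > 0" by (rule unit_ball_vol_nat_pos)
  have R: "emeasure ?R {..r} = (if r > 0 then ennreal (?V * r ^ n) else 0)" for r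
  proof -
    have *: "emeasure ?R {..r} = emeasure (PL n) {x \<in> {1..n} \<rightarrow>\<^sub>E UNIV. nrm n x \<le> r}"
      by (subst emeasure_distr) (auto simp: space_PL vimage_def Int_def conj_commute)
    have "emeasure (PL n) {x \<in> {1..n} \<rightarrow>\<^sub>E UNIV. nrm n x \<le> r} \<le> emeasure (PL n) {x \<in> {1..n} \<rightarrow>\<^sub>E UNIV. nrm n x \<le> 0}" if "r \<le> 0"
      using that unfolding space_PB[symmetric] by (intro emeasure_mono) (auto, measurable)
    with PL_origin[OF n] PL_ball[of r n] * show ?thesis by auto
  qed
  show "sigma_finite_measure ?R"
  proof
    show "\<exists>A. countable A \<and> A \<subseteq> sets ?R \<and> \<Union>A = space ?R \<and> (\<forall>a\<in>A. emeasure ?R a \<noteq> \<infinity>)"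
    proof (intro exI conjI)
      show "countable (range (\<lambda>k. {..real k}))" by simp
      show "\<Union>(range (\<lambda>k. {..real k})) = space ?R"
        by (auto simp: real_arch_simple)
    qed (auto simp: R)
  qed
  show "sets (?R \<Otimes>\<^sub>M usph n) = sets (distr (PL n) (borel \<Otimes>\<^sub>M PB n) (\<lambda>x. (nrm n x, sphere_proj n x)))"
    by (simp cong: sets_pair_measure_cong)
  fix A B assume A: "A \<in> sets ?R" and B: "B \<in> sets (usph n)"
  have [measurable]: "A \<in> sets borel" "B \<in> sets (PB n)" using A B by auto
  let ?f = "\<lambda>x. indicator B (sphere_proj n x) :: ennreal"
  let ?Q = "distr (density (PL n) ?f) borel (nrm n)"
  have Q: "emeasure ?Q X = emeasure (PL n) {x \<in> {1..n} \<rightarrow>\<^sub>E UNIV. nrm n x \<in> X \<and> sphere_proj n x \<in> B}"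
    if [measurable]: "X \<in> sets borel" for X
  proof -
    have m: "nrm n -` X \<inter> space (PL n) \<in> sets (PB n)"
      using measurable_sets[OF measurable_nrm that, of n] by (simp add: space_PL space_PB)
    have "emeasure ?Q X = (\<integral>\<^sup>+x. ?f x * indicator (nrm n -` X \<inter> space (PL n)) x \<partial>PL n)"
      using m by (subst emeasure_distr, simp, simp, subst emeasure_density) simp_all
    also have "\<dots> = (\<integral>\<^sup>+x. indicator {x \<in> space (PB n). nrm n x \<in> X \<and> sphere_proj n x \<in> B} x \<partial>PL n)"
      by (intro nn_integral_cong) (auto simp: indicator_def space_PB space_PL)
    also have "\<dots> = emeasure (PL n) {x \<in> space (PB n). nrm n x \<in> X \<and> sphere_proj n x \<in> B}"
      by (subst nn_integral_indicator) auto
    finally show ?thesis by (simp add: space_PB)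
  qed
  have gen: "emeasure (scale_measure (emeasure (usph n) B) ?R) {..r} = emeasure ?Q {..r}" for r
  proof (cases "r > 0")
    case True
    define e where "e = emeasure (PL n) {x \<in> {1..n} \<rightarrow>\<^sub>E UNIV. nrm n x \<le> 1 \<and> sphere_proj n x \<in> B}"
    have "emeasure (usph n) B * ennreal (?V * r ^ n) = (e / ennreal ?V) * (ennreal ?V * ennreal (r ^ n))"
      using V by (simp add: emeasure_usph e_def ennreal_mult')
    also have "\<dots> = e * ennreal (r ^ n)"
      using less_imp_neq[OF V, symmetric] V
      by (metis ennreal_divide_times ennreal_eq_0_iff ennreal_mult_divide_eq ennreal_neq_top mult.assoc not_le
          mult.commute)
    also have "\<dots> = emeasure ?Q {..r}"
      using PL_sector_scale[OF True \<open>B \<in> sets (PB n)\<close>] by (simp add: Q e_def mult.commute)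
    finally show ?thesis using True by (simp add: R)
  next
    \<comment> \<open>For r <= 0 only the origin, a null set, has norm at most r.\<close>
    case False
    have "emeasure ?Q {..r} \<le> emeasure ?R {..r}"
    proof -
      have "emeasure ?R {..r} = emeasure (PL n) {x \<in> space (PB n). nrm n x \<in> {..r}}"
        by (subst emeasure_distr) (auto simp: space_PL space_PB vimage_def Int_def conj_commute)
      moreover have "emeasure (PL n) {x \<in> space (PB n). nrm n x \<in> {..r} \<and> sphere_proj n x \<in> B}
          \<le> emeasure (PL n) {x \<in> space (PB n). nrm n x \<in> {..r}}"
        by (rule emeasure_mono) (blast, measurable)
      ultimately show ?thesis using Q[of "{..r}"] by (simp add: space_PB)
    qed
    then show ?thesis using False by (simp add: R)
  qed
  have "scale_measure (emeasure (usph n) B) ?R = ?Q"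
  proof (rule measure_eqI_generator_eq[where E="range atMost" and \<Omega>=UNIV and A="\<lambda>k. {..real k}"])
    show "Int_stable (range atMost :: real set set)"
      by (auto simp: Int_stable_def)
    show "sets (scale_measure (emeasure (usph n) B) ?R) = sigma_sets UNIV (range atMost)"
         "sets ?Q = sigma_sets UNIV (range atMost)"
      by (simp_all add: borel_eq_atMost)
    show "emeasure (scale_measure (emeasure (usph n) B) ?R) {..real i} \<noteq> \<infinity>" for i
      by (simp add: R ennreal_mult_eq_top_iff)
    show "emeasure (scale_measure (emeasure (usph n) B) ?R) X = emeasure ?Q X" if "X \<in> range atMost" for X
      using that gen by blast
  qed (auto simp: real_arch_simple)
  from arg_cong[OF this, of "\<lambda>M. emeasure M A"] have "emeasure (usph n) B * emeasure ?R A = emeasure ?Q A"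
    by (simp only: emeasure_scale_measure)
  also have "\<dots> = emeasure (PL n) ((\<lambda>x. (nrm n x, sphere_proj n x)) -` (A \<times> B) \<inter> space (PL n))"
    unfolding Q[OF \<open>A \<in> sets borel\<close>] by (rule arg_cong[where f="emeasure (PL n)"]) (auto simp: space_PL)
  also have "\<dots> = emeasure (distr (PL n) (borel \<Otimes>\<^sub>M PB n) (\<lambda>x. (nrm n x, sphere_proj n x))) (A \<times> B)"
    by (rule emeasure_distr[symmetric]) auto
  finally show "emeasure ?R A * emeasure (usph n) B = emeasure (distr (PL n) (borel \<Otimes>\<^sub>M PB n) (\<lambda>x. (nrm n x, sphere_proj n x))) (A \<times> B)"
    by (simp add: mult.commute)
qed

lemma nn_integral_polar:
  assumes "n \<ge> 1" and [measurable]: "H \<in> borel_measurable (borel \<Otimes>\<^sub>M PB n)"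
  shows "(\<integral>\<^sup>+x. H (nrm n x, sphere_proj n x) \<partial>PL n) = (\<integral>\<^sup>+x. \<integral>\<^sup>+w. H (nrm n x, w) \<partial>usph n \<partial>PL n)"
proof -
  interpret c: prob_space "usph n" by (rule prob_space_usph)
  have "(\<integral>\<^sup>+x. H (nrm n x, sphere_proj n x) \<partial>PL n)
     = (\<integral>\<^sup>+z. H z \<partial>distr (PL n) (borel \<Otimes>\<^sub>M PB n) (\<lambda>x. (nrm n x, sphere_proj n x)))"
    by (subst nn_integral_distr) auto
  also have "\<dots> = (\<integral>\<^sup>+z. H z \<partial>(distr (PL n) borel (nrm n) \<Otimes>\<^sub>M usph n))"
    by (simp add: distr_polar[OF assms(1)])
  also have "\<dots> = (\<integral>\<^sup>+r. \<integral>\<^sup>+w. H (r, w) \<partial>usph n \<partial>distr (PL n) borel (nrm n))"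
    by (subst c.nn_integral_fst[symmetric]) (simp_all cong: measurable_cong_sets sets_pair_measure_cong)
  also have "\<dots> = (\<integral>\<^sup>+x. \<integral>\<^sup>+w. H (nrm n x, w) \<partial>usph n \<partial>PL n)"
    by (subst nn_integral_distr) auto
  finally show ?thesis .
qed

section \<open>Slices of the sphere\<close>

text \<open>The points of the sphere in dimension \<open>Suc n\<close> with last coordinate x form a
  sphere of radius sqrt(n + 1 - x^2), which is the sphere of radius sqrt n dilated by this factor.
  Its square is the weight W for N = n + 1. Arguments with x^2 > n + 1 form a null set for
  \<open>marg (Suc n)\<close>.\<close>

definition slice_factor :: "nat \<Rightarrow> real \<Rightarrow> real" where
  "slice_factor n x = sqrt ((real (Suc n) - x\<^sup>2) / real n)"

definition glue :: "nat \<Rightarrow> real \<Rightarrow> (nat \<Rightarrow> real) \<Rightarrow> (nat \<Rightarrow> real)" where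
  "glue n x w = (\<lambda>j\<in>{1..n}. slice_factor n x * w j)(Suc n := x)"

lemma slice_factor_measurable [measurable]: "slice_factor n \<in> borel_measurable borel"
  unfolding slice_factor_def by measurable

lemma glue_last [simp]: "glue n x w (Suc n) = x"
  by (simp add: glue_def)

lemma glue_nth: "j \<in> {1..n} \<Longrightarrow> glue n x w j = slice_factor n x * w j"
  by (auto simp: glue_def)

lemma measurable_glue [measurable]: "(\<lambda>(x, w). glue n x w) \<in> measurable (borel \<Otimes>\<^sub>M PB n) (PB (Suc n))"
  unfolding glue_def split_beta
proof (rule measurable_fun_upd[where J="{1..n}"])
  show "{1..Suc n} = {1..n} \<union> {Suc n}" by auto
qed measurable

lemma nrm_extend: "nrm (Suc n) (x(Suc n := t)) = sqrt (t\<^sup>2 + (nrm n x)\<^sup>2)"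
proof -
  have ins: "{1..Suc n} = insert (Suc n) {1..n}" by auto
  have "(\<Sum>i\<in>{1..Suc n}. ((x(Suc n := t)) i)\<^sup>2) = t\<^sup>2 + (\<Sum>i\<in>{1..n}. (x i)\<^sup>2)"
    unfolding ins by (subst sum.insert) (auto intro!: sum.cong)
  then show ?thesis by (simp add: L2_set_def sum_nonneg)
qed

text \<open>Appending a coordinate t separates the variables: the direction of x enters only through
  \<open>sphere_proj n x\<close>, and the new last coordinate depends only on t and the norm of x.
  This is the form to which \<open>nn_integral_polar\<close> applies.\<close>

lemma sphere_proj_extend:
  assumes "n \<ge> 1" "nrm n x > 0"
  shows "sphere_proj (Suc n) (x(Suc n := t))
     = glue n (sqrt (real (Suc n)) * t / sqrt (t\<^sup>2 + (nrm n x)\<^sup>2)) (sphere_proj n x)"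
proof -
  define \<rho> where "\<rho> = nrm n x"
  have \<rho>: "\<rho> > 0" using assms by (simp add: \<rho>_def)
  define q where "q = t\<^sup>2 + \<rho>\<^sup>2"
  have q: "q > 0" using \<rho> by (simp add: q_def add_nonneg_pos)
  have "real (Suc n) - (sqrt (real (Suc n)) * t / sqrt q)\<^sup>2 = real (Suc n) * \<rho>\<^sup>2 / q"
  proof -
    have "real (Suc n) - (sqrt (real (Suc n)) * t / sqrt q)\<^sup>2 = real (Suc n) * (1 - t\<^sup>2 / q)"
      using q by (simp only: power_divide power_mult_distrib real_sqrt_pow2 of_nat_0_le_iff less_imp_le) (simp add: algebra_simps)
    also have "1 - t\<^sup>2 / q = \<rho>\<^sup>2 / q"
    proof -
      have "1 - t\<^sup>2 / q = (q - t\<^sup>2) / q" using q by (simp add: diff_divide_distrib)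
      then show ?thesis by (simp add: q_def)
    qed
    finally show ?thesis by simp
  qed
  then have s: "slice_factor n (sqrt (real (Suc n)) * t / sqrt q) = sqrt (real (Suc n)) * \<rho> / (sqrt q * sqrt (real n))"
    using \<rho> q unfolding slice_factor_def
    by (simp only:) (simp add: real_sqrt_divide real_sqrt_mult)
  have "sphere_proj (Suc n) (x(Suc n := t)) k = glue n (sqrt (real (Suc n)) * t / sqrt q) (sphere_proj n x) k" for k
    using assms \<rho> q unfolding sphere_proj_def nrm_extend \<rho>_def[symmetric] q_def[symmetric] glue_def s
    by (cases "k = Suc n"; cases "k \<in> {1..n}") (auto simp: field_simps)
  then show ?thesis by (auto simp: q_def \<rho>_def)
qed

text \<open>The density of the last coordinate is deliberately left as an integral over the norm of
  the other coordinates and over t; the formula is used again in this raw form by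
  \<open>marg_le_lborel\<close>.\<close>

lemma nn_integral_slices_aux:
  assumes n: "n \<ge> 1" and [measurable]: "F \<in> borel_measurable (PB (Suc n))"
  shows "(\<integral>\<^sup>+v. F v \<partial>usph (Suc n)) =
     (\<integral>\<^sup>+x. \<integral>\<^sup>+w. \<integral>\<^sup>+t. F (glue n (sqrt (real (Suc n)) * t / sqrt (t\<^sup>2 + (nrm n x)\<^sup>2)) w)
         * indicator {t. t\<^sup>2 + (nrm n x)\<^sup>2 \<le> 1} t \<partial>lborel \<partial>usph n \<partial>PL n) / ennreal (unit_ball_vol (real (Suc n)))"
proof -
  let ?y = "\<lambda>r t. sqrt (real (Suc n)) * t / sqrt (t\<^sup>2 + r\<^sup>2)"
  let ?H = "\<lambda>(r, w). \<integral>\<^sup>+t. F (glue n (?y r t) w) * indicator {t. t\<^sup>2 + r\<^sup>2 \<le> 1} t \<partial>lborel"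
  let ?B = "unit_ball_PL (Suc n)"
  have ins: "{1..Suc n} = insert (Suc n) {1..n}" by auto
  have H: "?H \<in> borel_measurable (borel \<Otimes>\<^sub>M PB n)"
    unfolding indicator_def[abs_def] by measurable
  have m: "(\<lambda>x. F (sphere_proj (Suc n) x) * indicator ?B x) \<in> borel_measurable (PL (Suc n))"
    by measurable
  have "(\<integral>\<^sup>+x. F (sphere_proj (Suc n) x) * indicator ?B x \<partial>PL (Suc n))
     = (\<integral>\<^sup>+x. \<integral>\<^sup>+t. F (sphere_proj (Suc n) (x(Suc n := t))) * indicator ?B (x(Suc n := t)) \<partial>lborel \<partial>PL n)"
    using m unfolding ins by (subst lborel_prod.product_nn_integral_insert) auto
  also have "\<dots> = (\<integral>\<^sup>+x. ?H (nrm n x, sphere_proj n x) \<partial>PL n)"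
  proof (rule nn_integral_cong_AE)
    show "AE x in PL n. (\<integral>\<^sup>+t. F (sphere_proj (Suc n) (x(Suc n := t))) * indicator ?B (x(Suc n := t)) \<partial>lborel) = ?H (nrm n x, sphere_proj n x)"
      using AE_PL_nrm_pos[OF n] AE_space
    proof eventually_elim
      case (elim x)
      have "indicator ?B (x(Suc n := t)) = (indicator {t. t\<^sup>2 + (nrm n x)\<^sup>2 \<le> 1} t :: ennreal)" for t
      proof -
        have "x(Suc n := t) \<in> {1..Suc n} \<rightarrow>\<^sub>E UNIV"
          using elim unfolding ins space_PL by (intro PiE_fun_upd) auto
        then show ?thesis by (simp add: indicator_def nrm_extend)
      qed
      then show ?case using elim n by (simp add: sphere_proj_extend)
    qed
  qed
  also have "\<dots> = (\<integral>\<^sup>+x. \<integral>\<^sup>+w. ?H (nrm n x, w) \<partial>usph n \<partial>PL n)"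
    by (rule nn_integral_polar[OF n H])
  finally show ?thesis
    by (subst nn_integral_usph) simp_all
qed

text \<open>Both sides are expanded by \<open>nn_integral_slices_aux\<close>. The integrand on the
  right depends on v through its last coordinate only, so its own integral over w has total mass one
  and disappears; Tonelli in w and t does the rest.\<close>

lemma nn_integral_slices:
  assumes n: "n \<ge> 1" and [measurable]: "F \<in> borel_measurable (PB (Suc n))"
  shows "(\<integral>\<^sup>+v. F v \<partial>usph (Suc n)) = (\<integral>\<^sup>+v. \<integral>\<^sup>+w. F (glue n (v (Suc n)) w) \<partial>usph n \<partial>usph (Suc n))"
proof -
  interpret u: prob_space "usph n" by (rule prob_space_usph)
  interpret lu: pair_sigma_finite lborel "usph n" ..
  have m: "(\<lambda>v. \<integral>\<^sup>+w. F (glue n (v (Suc n)) w) \<partial>usph n) \<in> borel_measurable (PB (Suc n))"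
    by measurable
  have sw: "(\<integral>\<^sup>+w. \<integral>\<^sup>+t. F (glue n (g t) w) * indicator S t \<partial>lborel \<partial>usph n)
      = (\<integral>\<^sup>+t. (\<integral>\<^sup>+w. F (glue n (g t) w) \<partial>usph n) * indicator S t \<partial>lborel)"
    if [measurable]: "S \<in> sets borel" "g \<in> borel_measurable borel" for S and g :: "real \<Rightarrow> real"
    by (subst lu.Fubini') (auto simp: nn_integral_multc)
  have S: "{t. t\<^sup>2 + r\<^sup>2 \<le> 1} \<in> sets borel" for r :: real
    by measurable
  show ?thesis
    unfolding nn_integral_slices_aux[OF n m] nn_integral_slices_aux[OF n assms(2)]
    by (simp add: sw S u.emeasure_space_1[simplified])
qed

text \<open>The number n is both the dimension and the index of the coordinate; by exchangeability
  this is the law of every coordinate (\<open>usph_coordinate_law\<close>).\<close>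

definition marg :: "nat \<Rightarrow> real measure" where
  "marg n = distr (usph n) borel (\<lambda>v. v n)"

lemma sets_marg [measurable_cong, simp]: "sets (marg n) = sets borel"
  by (simp add: marg_def)

lemma space_marg [simp]: "space (marg n) = UNIV"
  by (simp add: marg_def)

lemma prob_space_marg: "n \<ge> 1 \<Longrightarrow> prob_space (marg n)"
  unfolding marg_def by (rule prob_space.prob_space_distr[OF prob_space_usph]) simp

text \<open>The disintegration on which all conditioning rests: the last coordinate and the rescaled
  remainder are independent, so conditional expectations become inner integrals over
  \<open>usph n\<close>.\<close>

lemma usph_Suc:
  assumes n: "n \<ge> 1"
  shows "usph (Suc n) = distr (marg (Suc n) \<Otimes>\<^sub>M usph n) (PB (Suc n)) (\<lambda>(x, w). glue n x w)"
proof (rule measure_eqI)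
  interpret u: prob_space "usph n" by (rule prob_space_usph)
  interpret m: prob_space "marg (Suc n)" by (rule prob_space_marg) simp
  fix A assume "A \<in> sets (usph (Suc n))"
  then have [measurable]: "A \<in> sets (PB (Suc n))" by simp
  have "emeasure (usph (Suc n)) A = (\<integral>\<^sup>+v. indicator A v \<partial>usph (Suc n))" by simp
  also have "\<dots> = (\<integral>\<^sup>+v. \<integral>\<^sup>+w. indicator A (glue n (v (Suc n)) w) \<partial>usph n \<partial>usph (Suc n))"
    by (rule nn_integral_slices[OF n]) measurable
  also have "\<dots> = (\<integral>\<^sup>+x. \<integral>\<^sup>+w. indicator A (glue n x w) \<partial>usph n \<partial>marg (Suc n))"
    unfolding marg_def by (subst nn_integral_distr) auto
  also have "\<dots> = (\<integral>\<^sup>+z. indicator A (glue n (fst z) (snd z)) \<partial>(marg (Suc n) \<Otimes>\<^sub>M usph n))"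
    by (subst u.nn_integral_fst[symmetric]) auto
  also have "\<dots> = (\<integral>\<^sup>+v. indicator A v \<partial>distr (marg (Suc n) \<Otimes>\<^sub>M usph n) (PB (Suc n)) (\<lambda>(x, w). glue n x w))"
    by (subst nn_integral_distr) (auto simp: split_beta)
  finally show "emeasure (usph (Suc n)) A = emeasure (distr (marg (Suc n) \<Otimes>\<^sub>M usph n) (PB (Suc n)) (\<lambda>(x, w). glue n x w)) A"
    by simp
qed simp

lemma AE_usph_sphere: "n \<ge> 1 \<Longrightarrow> AE v in usph n. v \<in> kac_sphere n"
proof -
  assume n: "n \<ge> 1"
  have m: "{v \<in> space (PB n). (\<Sum>j=1..n. (v j)\<^sup>2) = real n} \<in> sets (PB n)"
    by measurable
  have "AE x in PL n. sphere_proj n x \<in> kac_sphere n"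
    using AE_PL_nrm_pos[OF n]
  proof eventually_elim
    case (elim x)
    have "(\<Sum>j=1..n. (sqrt (real n) * x j / nrm n x)\<^sup>2) = real n * (nrm n x)\<^sup>2 / (nrm n x)\<^sup>2"
      by (simp add: power_divide power_mult_distrib L2_set_def sum_nonneg flip: sum_divide_distrib sum_distrib_left)
    then show ?case using elim by (simp add: kac_sphere_def sphere_proj_def)
  qed
  then have "AE x in uniform_measure (PL n) (unit_ball_PL n). sphere_proj n x \<in> kac_sphere n"
    by (intro AE_uniform_measureI) auto
  moreover have "{v \<in> space (PB n). v \<in> kac_sphere n} \<in> sets (PB n)"
    using m by (simp add: kac_sphere_def space_PB)
  ultimately show ?thesis
    unfolding usph_def by (subst AE_distr_iff) (auto)
qed

section \<open>Rotational invariance\<close>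

text \<open>A homogeneous norm-preserving map commutes with the radial projection and preserves the
  unit ball, so invariance of Lebesgue measure descends to the sphere.\<close>

lemma usph_invariant:
  assumes [measurable]: "T \<in> measurable (PB n) (PB n)"
    and PL: "\<And>F. F \<in> borel_measurable (PB n) \<Longrightarrow> (\<integral>\<^sup>+x. F (T x) \<partial>PL n) = (\<integral>\<^sup>+x. F x \<partial>PL n)"
    and nrm: "\<And>x. x \<in> {1..n} \<rightarrow>\<^sub>E UNIV \<Longrightarrow> nrm n (T x) = nrm n x"
    and hom: "\<And>x c. x \<in> {1..n} \<rightarrow>\<^sub>E UNIV \<Longrightarrow> T (\<lambda>j\<in>{1..n}. c * x j) = (\<lambda>j\<in>{1..n}. c * T x j)"
  shows "distr (usph n) (PB n) T = usph n"
proof (rule measure_eqI)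
  fix A assume "A \<in> sets (distr (usph n) (PB n) T)"
  then have [measurable]: "A \<in> sets (PB n)" by simp
  have T: "T x \<in> {1..n} \<rightarrow>\<^sub>E UNIV" if "x \<in> {1..n} \<rightarrow>\<^sub>E UNIV" for x
    using measurable_space[OF assms(1)] that by (simp add: space_PB)
  have proj: "sphere_proj n (T x) = T (sphere_proj n x)" if "x \<in> {1..n} \<rightarrow>\<^sub>E UNIV" for x
    using hom[OF that, of "sqrt (real n) / nrm n x"] that by (simp add: sphere_proj_def nrm)
  have "emeasure (distr (usph n) (PB n) T) A = (\<integral>\<^sup>+v. indicator A v \<partial>distr (usph n) (PB n) T)"
    by simp
  also have "\<dots> = (\<integral>\<^sup>+v. indicator A (T v) \<partial>usph n)"
    by (rule nn_integral_distr) simp_all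
  also have "\<dots> = (\<integral>\<^sup>+x. indicator A (T (sphere_proj n x)) * indicator (unit_ball_PL n) x \<partial>PL n) / ennreal (unit_ball_vol (real n))"
    by (rule nn_integral_usph) measurable
  also have "(\<integral>\<^sup>+x. indicator A (T (sphere_proj n x)) * indicator (unit_ball_PL n) x \<partial>PL n)
     = (\<integral>\<^sup>+x. indicator A (sphere_proj n (T x)) * indicator (unit_ball_PL n) (T x) \<partial>PL n)"
    by (intro nn_integral_cong arg_cong2[where f="(*)"])
       (auto simp: proj space_PL nrm T indicator_def)
  also have "\<dots> = (\<integral>\<^sup>+x. indicator A (sphere_proj n x) * indicator (unit_ball_PL n) x \<partial>PL n)"
    by (rule PL) measurable
  also have "\<dots> / ennreal (unit_ball_vol (real n)) = (\<integral>\<^sup>+v. indicator A v \<partial>usph n)"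
    by (rule nn_integral_usph[symmetric]) measurable
  finally show "emeasure (distr (usph n) (PB n) T) A = emeasure (usph n) A" by simp
qed simp

lemma measurable_upd [measurable (raw)]:
  assumes "i \<in> {1..n}" "f \<in> measurable M (PB n)" "h \<in> borel_measurable M"
  shows "(\<lambda>x. (f x)(i := h x)) \<in> measurable M (PB n)"
  using assms by (intro measurable_fun_upd[where J="{1..n}"]) auto

text \<open>Integrating out coordinate i innermost reduces the claim to a one-dimensional change of
  variable. Shears and reflections are both of this kind.\<close>

lemma PL_coordinate_change:
  assumes i: "i \<in> {1..n}" and [measurable]: "F \<in> borel_measurable (PB n)" "h \<in> borel_measurable (PB n)"
    and inv: "\<And>x G. x \<in> {1..n} \<rightarrow>\<^sub>E UNIV \<Longrightarrow> G \<in> borel_measurable borel \<Longrightarrow>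
       (\<integral>\<^sup>+t. G (h (x(i := t))) \<partial>lborel) = (\<integral>\<^sup>+t. G t \<partial>lborel)"
  shows "(\<integral>\<^sup>+x. F (x(i := h x)) \<partial>PL n) = (\<integral>\<^sup>+x. F x \<partial>PL n)"
proof -
  define I where "I = {1..n} - {i}"
  have I: "{1..n} = insert i I" "finite I" "i \<notin> I" using i by (auto simp: I_def)
  have PB: "PB n = Pi\<^sub>M (insert i I) (\<lambda>_. borel)" and PLI: "PL n = Pi\<^sub>M (insert i I) (\<lambda>_. lborel)" using I by simp_all
  have s: "sets (Pi\<^sub>M (insert i I) (\<lambda>_. lborel)) = sets (Pi\<^sub>M (insert i I) (\<lambda>_. borel :: real measure))"
    using sets_PL[of n] by (simp add: I)
  have m: "F \<in> borel_measurable (PL n)" "(\<lambda>x. F (x(i := h x))) \<in> borel_measurable (PL n)"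
    using i by measurable
  have "(\<integral>\<^sup>+x. F (x(i := h x)) \<partial>PL n)
     = (\<integral>\<^sup>+x. \<integral>\<^sup>+t. F (x(i := h (x(i := t)))) \<partial>lborel \<partial>Pi\<^sub>M I (\<lambda>_. lborel))"
    using m(2) unfolding PLI by (subst lborel_prod.product_nn_integral_insert[OF I(2,3)]) auto
  also have "\<dots> = (\<integral>\<^sup>+x. \<integral>\<^sup>+t. F (x(i := t)) \<partial>lborel \<partial>Pi\<^sub>M I (\<lambda>_. lborel))"
  proof (rule nn_integral_cong)
    fix x assume "x \<in> space (Pi\<^sub>M I (\<lambda>_. lborel :: real measure))"
    then have x: "x(i := s) \<in> {1..n} \<rightarrow>\<^sub>E UNIV" for s
      using I by (auto simp: space_PiM intro!: PiE_fun_upd)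
    \<comment> \<open>Here x has no i-th coordinate yet; the value 0 is a placeholder that makes it
      a point of the n-dimensional space and is overwritten at once.\<close>
    have "(\<lambda>t. F ((x(i := 0))(i := t))) \<in> borel_measurable borel"
    proof -
      have "x(i := 0) \<in> space (PB n)" using x by (simp add: space_PB)
      then have [measurable]: "(\<lambda>t. x(i := 0)) \<in> measurable borel (PB n)" by simp
      show ?thesis using i by measurable
    qed
    from inv[OF x this, of 0] show "(\<integral>\<^sup>+t. F (x(i := h (x(i := t)))) \<partial>lborel) = (\<integral>\<^sup>+t. F (x(i := t)) \<partial>lborel)"
      by simp
  qed
  also have "\<dots> = (\<integral>\<^sup>+x. F x \<partial>PL n)"
    using m(1) unfolding PLI by (subst lborel_prod.product_nn_integral_insert[OF I(2,3)]) auto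
  finally show ?thesis .
qed

lemma PL_shear:
  assumes i: "i \<in> {1..n}" "j \<in> {1..n}" "i \<noteq> j" and F: "F \<in> borel_measurable (PB n)"
  shows "(\<integral>\<^sup>+x. F (x(i := x i + a * x j)) \<partial>PL n) = (\<integral>\<^sup>+x. F x \<partial>PL n)"
proof (rule PL_coordinate_change[OF i(1) F])
  show "(\<lambda>x. x i + a * x j) \<in> borel_measurable (PB n)"
    using i by measurable
  fix x and G :: "real \<Rightarrow> ennreal" assume [measurable]: "G \<in> borel_measurable borel"
  have "(\<integral>\<^sup>+t. G t \<partial>lborel) = (\<integral>\<^sup>+t. G (a * x j + 1 * t) \<partial>lborel)"
    by (subst nn_integral_real_affine[of G 1 "a * x j"]) auto
  then show "(\<integral>\<^sup>+t. G ((x(i := t)) i + a * (x(i := t)) j) \<partial>lborel) = (\<integral>\<^sup>+t. G t \<partial>lborel)"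
    using i(3) by (simp add: add.commute)
qed

lemma PL_reflect:
  assumes i: "i \<in> {1..n}" and F: "F \<in> borel_measurable (PB n)"
  shows "(\<integral>\<^sup>+x. F (x(i := - x i)) \<partial>PL n) = (\<integral>\<^sup>+x. F x \<partial>PL n)"
proof (rule PL_coordinate_change[OF i F])
  show "(\<lambda>x. - x i) \<in> borel_measurable (PB n)"
    using i by measurable
  fix x and G :: "real \<Rightarrow> ennreal" assume [measurable]: "G \<in> borel_measurable borel"
  show "(\<integral>\<^sup>+t. G (- (x(i := t)) i) \<partial>lborel) = (\<integral>\<^sup>+t. G t \<partial>lborel)"
    by (subst nn_integral_real_affine[of G "-1" 0, OF \<open>G \<in> borel_measurable borel\<close>]) auto
qed

lemma pair_rot_measurable [measurable]:
  "i \<in> {1..n} \<Longrightarrow> j \<in> {1..n} \<Longrightarrow> (\<lambda>(v, \<theta>). pair_rot i j \<theta> v) \<in> measurable (PB n \<Otimes>\<^sub>M borel) (PB n)"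
  unfolding pair_rot_def by measurable

lemma pair_rot_measurable1 [measurable]:
  "i \<in> {1..n} \<Longrightarrow> j \<in> {1..n} \<Longrightarrow> pair_rot i j \<theta> \<in> measurable (PB n) (PB n)"
  unfolding pair_rot_def by measurable

lemma nrm_cong_pair:
  assumes "i \<in> {1..n}" "j \<in> {1..n}" "i \<noteq> j"
    and "\<And>k. k \<noteq> i \<Longrightarrow> k \<noteq> j \<Longrightarrow> y k = x k" and "(y i)\<^sup>2 + (y j)\<^sup>2 = (x i)\<^sup>2 + (x j)\<^sup>2"
  shows "nrm n y = nrm n x"
proof -
  have sp: "(\<Sum>k\<in>{1..n}. (z k)\<^sup>2) = ((z i)\<^sup>2 + (z j)\<^sup>2) + (\<Sum>k\<in>{1..n} - {i} - {j}. (z k)\<^sup>2)" for z :: "nat \<Rightarrow> real"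
    using assms(1-3) by (subst sum.remove[of _ i], simp, simp, subst sum.remove[of _ j]) auto
  have "(\<Sum>k\<in>{1..n} - {i} - {j}. (y k)\<^sup>2) = (\<Sum>k\<in>{1..n} - {i} - {j}. (x k)\<^sup>2)"
    by (intro sum.cong) (auto simp: assms(4))
  then show ?thesis by (simp add: L2_set_def sp[of y] sp[of x] assms(5))
qed

lemma pair_rot_sq: "i \<noteq> j \<Longrightarrow> (pair_rot i j \<theta> v i)\<^sup>2 + (pair_rot i j \<theta> v j)\<^sup>2 = (v i)\<^sup>2 + (v j)\<^sup>2"
proof -
  assume "i \<noteq> j"
  have "(a * c + b * s)\<^sup>2 + (- a * s + b * c)\<^sup>2 = (a\<^sup>2 + b\<^sup>2) * (s\<^sup>2 + c\<^sup>2)" for a b c s :: real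
    by algebra
  then show ?thesis using \<open>i \<noteq> j\<close> by (simp add: pair_rot_def)
qed

text \<open>A rotation by an angle with \<open>sin \<theta> \<noteq> 0\<close> is a product of three shears, each of which preserves
  Lebesgue measure by Fubini. The excluded angles form a null set.\<close>

lemma usph_rot:
  assumes i: "i \<in> {1..n}" "j \<in> {1..n}" "i \<noteq> j" and \<theta>: "sin \<theta> \<noteq> 0"
  shows "distr (usph n) (PB n) (pair_rot i j \<theta>) = usph n"
proof (rule usph_invariant)
  show "pair_rot i j \<theta> \<in> measurable (PB n) (PB n)"
    using i by measurable
  fix F :: "(nat \<Rightarrow> real) \<Rightarrow> ennreal" assume [measurable]: "F \<in> borel_measurable (PB n)"
  \<comment> \<open>This is tan(\<theta>/2). The shears have coefficients a, -sin \<theta> and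
    a.\<close>
  define a where "a = (1 - cos \<theta>) / sin \<theta>"
  define A where "A x = x(i := x i + a * x j)" for x :: "nat \<Rightarrow> real"
  define B where "B x = x(j := x j + (- sin \<theta>) * x i)" for x :: "nat \<Rightarrow> real"
  have [measurable]: "A \<in> measurable (PB n) (PB n)" "B \<in> measurable (PB n) (PB n)"
    unfolding A_def B_def using i by measurable
  have as: "a * sin \<theta> = 1 - cos \<theta>" "a * (1 + cos \<theta>) = sin \<theta>"
  proof -
    show "a * sin \<theta> = 1 - cos \<theta>" using \<theta> by (simp add: a_def)
    have "(1 - cos \<theta>) * (1 + cos \<theta>) = sin \<theta> * sin \<theta>"
      using sin_cos_squared_add[of \<theta>] by (simp add: algebra_simps power2_eq_square)
    then show "a * (1 + cos \<theta>) = sin \<theta>" using \<theta> by (simp add: a_def field_simps)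
  qed
  have rot: "pair_rot i j \<theta> x = A (B (A x))" for x
  proof -
    define u w where "u = x i" and "w = x j"
    have 1: "w + (- sin \<theta>) * (u + a * w) = - u * sin \<theta> + w * cos \<theta>"
      using as(1) by (simp add: algebra_simps) (metis mult.left_commute distrib_left mult_1_right add_diff_cancel_left' add.commute diff_add_cancel)
    have 2: "(u + a * w) + a * (- u * sin \<theta> + w * cos \<theta>) = u * cos \<theta> + w * sin \<theta>"
    proof -
      have "(u + a * w) + a * (- u * sin \<theta> + w * cos \<theta>) = u - u * (a * sin \<theta>) + w * (a * (1 + cos \<theta>))"
        by (simp add: algebra_simps)
      then show ?thesis unfolding as by (simp add: algebra_simps)
    qed
    show ?thesis
      using i(3) 1 2 by (auto simp: pair_rot_def A_def B_def fun_eq_iff u_def w_def)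
  qed
  have m: "(\<lambda>x. F (A (B x))) \<in> borel_measurable (PB n)" "(\<lambda>x. F (A x)) \<in> borel_measurable (PB n)"
    by measurable
  have "(\<integral>\<^sup>+x. F (A (B (A x))) \<partial>PL n) = (\<integral>\<^sup>+x. F (A (B x)) \<partial>PL n)"
    using PL_shear[OF i m(1), of a] by (simp add: A_def)
  also have "\<dots> = (\<integral>\<^sup>+x. F (A x) \<partial>PL n)"
    using PL_shear[OF i(2,1) i(3)[symmetric] m(2), of "- sin \<theta>"] by (simp add: B_def)
  also have "\<dots> = (\<integral>\<^sup>+x. F x \<partial>PL n)"
    using PL_shear[OF i, of F a] by (simp add: A_def)
  finally show "(\<integral>\<^sup>+x. F (pair_rot i j \<theta> x) \<partial>PL n) = (\<integral>\<^sup>+x. F x \<partial>PL n)" by (simp add: rot)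
next
  show "nrm n (pair_rot i j \<theta> x) = nrm n x" for x
    using i by (intro nrm_cong_pair[of i n j] pair_rot_sq) (auto simp: pair_rot_def)
next
  show "pair_rot i j \<theta> (\<lambda>k\<in>{1..n}. c * x k) = (\<lambda>k\<in>{1..n}. c * pair_rot i j \<theta> x k)" for x c
    using i by (auto simp: pair_rot_def fun_eq_iff algebra_simps)
qed

lemma reflect_measurable [measurable]: "i \<in> {1..n} \<Longrightarrow> (\<lambda>v. v(i := - v i)) \<in> measurable (PB n) (PB n)"
  by measurable

lemma swap_measurable [measurable]:
  "i \<in> {1..n} \<Longrightarrow> j \<in> {1..n} \<Longrightarrow> (\<lambda>v. v(i := v j, j := v i)) \<in> measurable (PB n) (PB n)"
  by measurable

lemma usph_reflect:
  assumes i: "i \<in> {1..n}"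
  shows "distr (usph n) (PB n) (\<lambda>v. v(i := - v i)) = usph n"
proof (rule usph_invariant)
  show "(\<lambda>v. v(i := - v i)) \<in> measurable (PB n) (PB n)"
    using i by measurable
  show "nrm n (x(i := - x i)) = nrm n x" for x
    unfolding L2_set_def by (intro arg_cong[where f=sqrt] sum.cong) auto
qed (use i in \<open>auto simp: PL_reflect fun_eq_iff\<close>)

text \<open>A transposition of two coordinates is a quarter turn followed by a sign change.\<close>

lemma usph_swap:
  assumes i: "i \<in> {1..n}" "j \<in> {1..n}"
  shows "distr (usph n) (PB n) (\<lambda>v. v(i := v j, j := v i)) = usph n"
proof (cases "i = j")
  case True
  have "distr (usph n) (PB n) (\<lambda>v. v) = usph n"
    by (rule distr_id2) simp
  with True show ?thesis by simp
next
  case False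
  have "usph n = distr (distr (usph n) (PB n) (pair_rot i j (pi/2))) (PB n) (\<lambda>v. v(j := - v j))"
    using i False by (simp add: usph_rot usph_reflect)
  also have "\<dots> = distr (usph n) (PB n) ((\<lambda>v. v(j := - v j)) \<circ> pair_rot i j (pi/2))"
    using i by (intro distr_distr) measurable
  also have "(\<lambda>v. v(j := - v j)) \<circ> pair_rot i j (pi/2) = (\<lambda>v. v(i := v j, j := v i))"
    using False by (auto simp: pair_rot_def fun_eq_iff)
  finally show ?thesis by (rule sym)
qed

text \<open>Two transpositions suffice: one carries i to k, and the next carries the image of j to l
  while fixing k.\<close>

lemma usph_pair_law:
  assumes ij: "i \<in> {1..n}" "j \<in> {1..n}" "i \<noteq> j"
    and kl: "k \<in> {1..n}" "l \<in> {1..n}" "k \<noteq> l"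
  shows "distr (usph n) (borel \<Otimes>\<^sub>M borel) (\<lambda>v. (v i, v j)) = distr (usph n) (borel \<Otimes>\<^sub>M borel) (\<lambda>v. (v k, v l))"
proof -
  define P where "P i j = distr (usph n) (borel \<Otimes>\<^sub>M borel) (\<lambda>v. (v i, v j :: real))" for i j
  have sw: "P i j = P (Transposition.transpose a b i) (Transposition.transpose a b j)"
    if "i \<in> {1..n}" "j \<in> {1..n}" "a \<in> {1..n}" "b \<in> {1..n}" for i j a b
  proof -
    have "P i j = distr (distr (usph n) (PB n) (\<lambda>v. v(a := v b, b := v a))) (borel \<Otimes>\<^sub>M borel) (\<lambda>v. (v i, v j))"
      using that by (simp add: usph_swap P_def)
    also have "\<dots> = distr (usph n) (borel \<Otimes>\<^sub>M borel) ((\<lambda>v. (v i, v j)) \<circ> (\<lambda>v. v(a := v b, b := v a)))"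
      by (rule distr_distr) (use that in \<open>simp_all add: swap_measurable cong: measurable_cong_sets\<close>)
    also have "(\<lambda>v. (v i, v j :: real)) \<circ> (\<lambda>v. v(a := v b, b := v a)) = (\<lambda>v. (v (Transposition.transpose a b i), v (Transposition.transpose a b j)))"
      by (auto simp: fun_eq_iff Transposition.transpose_def)
    finally show ?thesis by (simp add: P_def)
  qed
  define j' where "j' = Transposition.transpose i k j"
  have j': "j' \<in> {1..n}" "j' \<noteq> k" using ij kl by (auto simp: j'_def Transposition.transpose_def)
  have "P i j = P k j'"
    using sw[of i j i k] ij kl by (simp add: j'_def)
  also have "\<dots> = P k l"
    using sw[of k j' j' l] ij kl j' by (simp add: Transposition.transpose_def)
  finally show ?thesis by (simp add: P_def)
qed

section \<open>Square integrable functions and density of polynomials\<close>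

definition L2f :: "'a measure \<Rightarrow> ('a \<Rightarrow> real) set" where
  "L2f M = {f \<in> borel_measurable M. integrable M (\<lambda>x. (f x)\<^sup>2)}"

lemma L2f_measurable [measurable_dest]: "f \<in> L2f M \<Longrightarrow> f \<in> borel_measurable M"
  by (simp add: L2f_def)

lemma L2f_sq: "f \<in> L2f M \<Longrightarrow> integrable M (\<lambda>x. (f x)\<^sup>2)"
  by (simp add: L2f_def)

lemma L2f_mult:
  assumes f: "f \<in> L2f M" and g: "g \<in> L2f M"
  shows "integrable M (\<lambda>x. f x * g x)"
proof (rule Bochner_Integration.integrable_bound)
  show "integrable M (\<lambda>x. (f x)\<^sup>2 + (g x)\<^sup>2)"
    using f g by (simp add: L2f_sq)
  show "(\<lambda>x. f x * g x) \<in> borel_measurable M"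
    using f g by measurable
  have "\<bar>a * b\<bar> \<le> a\<^sup>2 + b\<^sup>2" for a b :: real
  proof -
    have "0 \<le> (\<bar>a\<bar> - \<bar>b\<bar>)\<^sup>2" by simp
    then show ?thesis by (simp add: power2_eq_square algebra_simps abs_mult) (use zero_le_square[of a] zero_le_square[of b] in linarith)
  qed
  then show "AE x in M. norm (f x * g x) \<le> norm ((f x)\<^sup>2 + (g x)\<^sup>2)"
    by auto
qed

lemma L2f_cmult: "f \<in> L2f M \<Longrightarrow> (\<lambda>x. c * f x) \<in> L2f M"
  by (auto simp: L2f_def power_mult_distrib)

lemma L2f_add:
  assumes "f \<in> L2f M" "g \<in> L2f M"
  shows "(\<lambda>x. f x + g x) \<in> L2f M"
  using assms L2f_mult[OF assms] by (auto simp: L2f_def power2_sum mult.assoc)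

lemma L2f_diff:
  assumes "f \<in> L2f M" "g \<in> L2f M"
  shows "(\<lambda>x. f x - g x) \<in> L2f M"
  using L2f_add[OF assms(1) L2f_cmult[OF assms(2), of "-1"]] by simp

lemma L2f_sum:
  "(\<And>i. i \<in> I \<Longrightarrow> f i \<in> L2f M) \<Longrightarrow> (\<lambda>x. \<Sum>i\<in>I. f i x) \<in> L2f M"
proof (induction I rule: infinite_finite_induct)
  case (insert i I)
  then show ?case using L2f_add[of "f i" M "\<lambda>x. \<Sum>i\<in>I. f i x"] by simp
qed (simp_all add: L2f_def)

lemma L2f_bounded:
  assumes "finite_measure M" "f \<in> borel_measurable M" "AE x in M. \<bar>f x\<bar> \<le> C"
  shows "f \<in> L2f M"
proof -
  interpret finite_measure M by fact
  have "integrable M (\<lambda>x. (f x)\<^sup>2)"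
  proof (rule integrable_const_bound[where B="C\<^sup>2"])
    show "AE x in M. norm ((f x)\<^sup>2) \<le> C\<^sup>2"
      using assms(3)
    proof eventually_elim
      case (elim x)
      then show ?case using power_mono[OF elim abs_ge_zero, of 2] by simp
    qed
  qed (use assms(2) in measurable)
  then show ?thesis using assms by (simp add: L2f_def)
qed

lemma L2f_const: "finite_measure M \<Longrightarrow> (\<lambda>x. c) \<in> L2f M"
  by (rule L2f_bounded[where C="\<bar>c\<bar>"]) auto

lemma L2f_integrable: "finite_measure M \<Longrightarrow> f \<in> L2f M \<Longrightarrow> integrable M f"
  using L2f_mult[OF _ L2f_const[of M 1], of f] by simp

lemma L2f_dominated:
  assumes g: "g \<in> L2f M" and f: "f \<in> borel_measurable M" and le: "AE x in M. \<bar>f x\<bar> \<le> \<bar>g x\<bar>"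
  shows "f \<in> L2f M"
proof -
  have "integrable M (\<lambda>x. (f x)\<^sup>2)"
  proof (rule Bochner_Integration.integrable_bound[OF L2f_sq[OF g]])
    show "AE x in M. norm ((f x)\<^sup>2) \<le> norm ((g x)\<^sup>2)"
      using le by eventually_elim (simp add: abs_le_square_iff)
  qed (use f in measurable)
  then show ?thesis using f by (simp add: L2f_def)
qed

text \<open>Cauchy-Schwarz with a free weight t. Choosing t at the point of use avoids square roots
  of norms and the degenerate case of a vanishing norm.\<close>

lemma L2_am_gm:
  assumes f: "f \<in> L2f M" and g: "g \<in> L2f M" and t: "t > 0"
  shows "2 * \<bar>\<integral>x. f x * g x \<partial>M\<bar> \<le> t * (\<integral>x. (f x)\<^sup>2 \<partial>M) + (\<integral>x. (g x)\<^sup>2 \<partial>M) / t"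
proof -
  have "2 * (a * b) \<le> t * a\<^sup>2 + b\<^sup>2 / t" for a b
  proof -
    have "t * a\<^sup>2 + b\<^sup>2 / t - 2 * (a * b) = (t * a - b)\<^sup>2 / t"
      using t by (simp add: power2_eq_square field_simps)
    then show ?thesis using t by (smt (verit) divide_nonneg_pos zero_le_power2)
  qed
  note p = this
  have i: "integrable M (\<lambda>x. t * (f x)\<^sup>2 + (g x)\<^sup>2 / t)" "integrable M (\<lambda>x. 2 * (f x * g x))"
    using f g L2f_mult[OF f g] by (simp_all add: L2f_sq)
  have "(\<integral>x. 2 * (f x * g x) \<partial>M) \<le> (\<integral>x. t * (f x)\<^sup>2 + (g x)\<^sup>2 / t \<partial>M)"
    by (intro integral_mono i p)
  moreover have "(\<integral>x. - (2 * (f x * g x)) \<partial>M) \<le> (\<integral>x. t * (f x)\<^sup>2 + (g x)\<^sup>2 / t \<partial>M)"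
    using p[of "- f _" "g _"] by (intro integral_mono Bochner_Integration.integrable_minus i) auto
  ultimately show ?thesis
    using f g by (simp add: L2f_sq abs_le_iff)
qed

lemma L2_double:
  assumes f: "f \<in> L2f M" and g: "g \<in> L2f M"
  shows "(\<integral>x. (f x + g x)\<^sup>2 \<partial>M) \<le> 2 * (\<integral>x. (f x)\<^sup>2 \<partial>M) + 2 * (\<integral>x. (g x)\<^sup>2 \<partial>M)"
proof -
  have "(a + b)\<^sup>2 \<le> 2 * a\<^sup>2 + 2 * b\<^sup>2" for a b :: real
    using zero_le_power2[of "a - b"] unfolding power2_diff power2_sum by linarith
  then have "(\<integral>x. (f x + g x)\<^sup>2 \<partial>M) \<le> (\<integral>x. 2 * (f x)\<^sup>2 + 2 * (g x)\<^sup>2 \<partial>M)"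
    using f g L2f_add[OF f g] by (intro integral_mono) (auto simp: L2f_sq)
  then show ?thesis using f g by (simp add: L2f_sq)
qed

text \<open>\<open>D g\<close> says that g is an L2 limit of polynomials. This class is a linear
  space closed under L2 limits. It contains the continuous functions bounded by one by Weierstrass
  on [-R, R], hence indicators of half-lines, hence of Borel sets, and finally all of L2 by monotone
  approximation.\<close>

lemma poly_dense_L2:
  fixes M :: "real measure"
  assumes fin: "finite_measure M" and sets: "sets M = sets borel" and R: "AE x in M. \<bar>x\<bar> \<le> R"
    and h: "h \<in> L2f M" and e: "e > 0"
  shows "\<exists>p. (\<integral>x. (h x - poly p x)\<^sup>2 \<partial>M) < e"
proof -
  interpret finite_measure M by fact
  note [measurable_cong] = sets
  define D where "D g \<longleftrightarrow> g \<in> L2f M \<and> (\<forall>e>0. \<exists>p. (\<integral>x. (g x - poly p x)\<^sup>2 \<partial>M) < e)" for g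
  have poly_meas [measurable]: "poly p \<in> borel_measurable borel" for p :: "real poly"
    by (intro borel_measurable_continuous_onI) (auto intro!: continuous_intros)
  have poly_L2: "poly p \<in> L2f M" for p
  proof -
    have "compact (poly p ` {-R..R})"
      by (intro compact_continuous_image continuous_intros) auto
    then obtain C where "\<forall>x\<in>{-R..R}. \<bar>poly p x\<bar> \<le> C"
      by (auto dest!: compact_imp_bounded simp: bounded_iff)
    moreover have "poly p \<in> borel_measurable M" by measurable
    moreover have "AE x in M. \<bar>poly p x\<bar> \<le> C"
      using R
    proof eventually_elim
      case (elim x)
      then have "x \<in> {-R..R}" by auto
      then show ?case using \<open>\<forall>x\<in>{-R..R}. \<bar>poly p x\<bar> \<le> C\<close> by blast
    qed
    ultimately show ?thesis by (intro L2f_bounded[OF fin])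
  qed
  have D_poly: "D (poly p)" for p
    using poly_L2 unfolding D_def by (auto intro!: exI[of _ p])
  have D_limit: "D g" if g: "g \<in> L2f M" and ap: "\<And>e. e > 0 \<Longrightarrow> \<exists>k. D k \<and> (\<integral>x. (g x - k x)\<^sup>2 \<partial>M) < e" for g
    unfolding D_def
  proof (intro conjI allI impI)
    fix e :: real assume "e > 0"
    then obtain k where k: "D k" "(\<integral>x. (g x - k x)\<^sup>2 \<partial>M) < e / 4" using ap[of "e/4"] by auto
    with \<open>e > 0\<close> obtain p where p: "(\<integral>x. (k x - poly p x)\<^sup>2 \<partial>M) < e / 4"
      unfolding D_def by (meson divide_pos_pos zero_less_numeral)
    have kL: "k \<in> L2f M" using k by (simp add: D_def)
    have "(\<integral>x. (g x - poly p x)\<^sup>2 \<partial>M) = (\<integral>x. ((g x - k x) + (k x - poly p x))\<^sup>2 \<partial>M)" by simp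
    also have "\<dots> \<le> 2 * (\<integral>x. (g x - k x)\<^sup>2 \<partial>M) + 2 * (\<integral>x. (k x - poly p x)\<^sup>2 \<partial>M)"
      by (intro L2_double L2f_diff g kL poly_L2)
    also have "\<dots> < e" using k p by simp
    finally show "\<exists>p. (\<integral>x. (g x - poly p x)\<^sup>2 \<partial>M) < e" by blast
  qed (fact g)
  have D_add: "D (\<lambda>x. f x + g x)" if f: "D f" and g: "D g" for f g
    unfolding D_def
  proof (intro conjI allI impI)
    fix e :: real assume "e > 0"
    have fL: "f \<in> L2f M" and gL: "g \<in> L2f M" using f g by (auto simp: D_def)
    from \<open>e > 0\<close> f g obtain p q where p: "(\<integral>x. (f x - poly p x)\<^sup>2 \<partial>M) < e / 4"
      and q: "(\<integral>x. (g x - poly q x)\<^sup>2 \<partial>M) < e / 4"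
      unfolding D_def by (meson divide_pos_pos zero_less_numeral)
    have "(\<integral>x. (f x + g x - poly (p + q) x)\<^sup>2 \<partial>M) = (\<integral>x. ((f x - poly p x) + (g x - poly q x))\<^sup>2 \<partial>M)"
      by (simp add: algebra_simps)
    also have "\<dots> \<le> 2 * (\<integral>x. (f x - poly p x)\<^sup>2 \<partial>M) + 2 * (\<integral>x. (g x - poly q x)\<^sup>2 \<partial>M)"
      by (intro L2_double L2f_diff fL gL poly_L2)
    also have "\<dots> < e" using p q by simp
    finally show "\<exists>p. (\<integral>x. (f x + g x - poly p x)\<^sup>2 \<partial>M) < e" by blast
  qed (use f g in \<open>auto simp: D_def intro: L2f_add\<close>)
  have D_cmult: "D (\<lambda>x. c * f x)" if f: "D f" for f c
    unfolding D_def
  proof (intro conjI allI impI)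
    fix e :: real assume "e > 0"
    show "\<exists>p. (\<integral>x. (c * f x - poly p x)\<^sup>2 \<partial>M) < e"
    proof (cases "c = 0")
      case True
      then show ?thesis using \<open>e > 0\<close> by (intro exI[of _ 0]) simp
    next
      case False
      then have "e / c\<^sup>2 > 0" using \<open>e > 0\<close> by simp
      then obtain p where p: "(\<integral>x. (f x - poly p x)\<^sup>2 \<partial>M) < e / c\<^sup>2"
        using f unfolding D_def by blast
      have "(\<integral>x. (c * f x - poly (smult c p) x)\<^sup>2 \<partial>M) = (\<integral>x. c\<^sup>2 * (f x - poly p x)\<^sup>2 \<partial>M)"
        by (simp add: power_mult_distrib[symmetric] algebra_simps)
      also have "\<dots> = c\<^sup>2 * (\<integral>x. (f x - poly p x)\<^sup>2 \<partial>M)" by simp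
      also have "\<dots> < e" using p False by (simp add: field_simps)
      finally show ?thesis by blast
    qed
  qed (use f in \<open>auto simp: D_def intro: L2f_cmult\<close>)
  have D_seq: "D g" if g: "g \<in> L2f M" and k: "\<And>i. D (k i)" and lim: "\<And>x. (\<lambda>i. k i x) \<longlonglongrightarrow> g x"
    and dom: "w \<in> L2f M" "\<And>i x. \<bar>k i x\<bar> \<le> w x" for g k w
  proof (rule D_limit[OF g])
    fix e :: real assume "e > 0"
    have [measurable]: "k i \<in> borel_measurable M" for i using k[of i] by (auto simp: D_def L2f_def)
    have [measurable]: "g \<in> borel_measurable M" using g by (simp add: L2f_def)
    have "(\<lambda>i. \<integral>x. (g x - k i x)\<^sup>2 \<partial>M) \<longlonglongrightarrow> (\<integral>x. 0 \<partial>M)"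
    proof (rule integral_dominated_convergence[where w="\<lambda>x. (\<bar>g x\<bar> + w x)\<^sup>2"])
      have "(\<lambda>x. \<bar>g x\<bar>) \<in> L2f M" using g by (auto simp: L2f_def)
      from L2f_add[OF this dom(1)] show "integrable M (\<lambda>x. (\<bar>g x\<bar> + w x)\<^sup>2)" by (rule L2f_sq)
      show "AE x in M. (\<lambda>i. (g x - k i x)\<^sup>2) \<longlonglongrightarrow> 0"
      proof (rule AE_I2)
        fix x
        have "(\<lambda>i. (g x - k i x)\<^sup>2) \<longlonglongrightarrow> (g x - g x)\<^sup>2" by (intro tendsto_intros lim)
        then show "(\<lambda>i. (g x - k i x)\<^sup>2) \<longlonglongrightarrow> 0" by simp
      qed
      show "AE x in M. norm ((g x - k i x)\<^sup>2) \<le> (\<bar>g x\<bar> + w x)\<^sup>2" for i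
      proof (rule AE_I2)
        fix x
        have "\<bar>g x - k i x\<bar> \<le> \<bar>g x\<bar> + w x" using dom(2)[of i x] by linarith
        from power_mono[OF this abs_ge_zero, of 2] show "norm ((g x - k i x)\<^sup>2) \<le> (\<bar>g x\<bar> + w x)\<^sup>2" by simp
      qed
    qed measurable
    then have "\<forall>\<^sub>F i in sequentially. (\<integral>x. (g x - k i x)\<^sup>2 \<partial>M) < e"
      using \<open>e > 0\<close> by (intro order_tendstoD) auto
    then show "\<exists>k. D k \<and> (\<integral>x. (g x - k x)\<^sup>2 \<partial>M) < e"
      using k by (auto dest!: eventually_happens)
  qed
  have D_cont: "D f" if f: "continuous_on UNIV f" and b: "\<And>x. \<bar>f x\<bar> \<le> 1" for f :: "real \<Rightarrow> real"
  proof (rule D_limit)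
    have [measurable]: "f \<in> borel_measurable borel" using f by (rule borel_measurable_continuous_onI)
    show fL: "f \<in> L2f M" by (rule L2f_bounded[OF fin, where C=1]) (auto simp: b)
    fix e :: real assume "e > 0"
    \<comment> \<open>Chosen so that the total mass times d^2 stays below e; the added 1 covers a
      measure of mass zero.\<close>
    define d where "d = sqrt (e / (2 * (measure M (space M) + 1)))"
    have m: "measure M (space M) + 1 > 0" by (simp add: add_nonneg_pos)
    have d: "d > 0" "d\<^sup>2 = e / (2 * (measure M (space M) + 1))" using \<open>e > 0\<close> m by (auto simp: d_def)
    obtain g where g: "real_polynomial_function g" "\<And>x. x \<in> {-R..R} \<Longrightarrow> \<bar>f x - g x\<bar> < d"
      using Stone_Weierstrass_real_polynomial_function[OF _ continuous_on_subset[OF f subset_UNIV] \<open>d > 0\<close>, of "{-R..R}"]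
      by auto
    then obtain a n where gs: "g = (\<lambda>x. \<Sum>i\<le>n. a i * x ^ i)"
      unfolding real_polynomial_function_iff_sum by blast
    define p where "p = (\<Sum>i\<le>n. monom (a i) i)"
    have gp: "g = poly p" by (simp add: gs p_def poly_sum poly_monom fun_eq_iff)
    have "(\<integral>x. (f x - poly p x)\<^sup>2 \<partial>M) \<le> (\<integral>x. d\<^sup>2 \<partial>M)"
    proof (rule integral_mono_AE)
      show "integrable M (\<lambda>x. (f x - poly p x)\<^sup>2)" by (intro L2f_sq L2f_diff fL poly_L2)
      show "AE x in M. (f x - poly p x)\<^sup>2 \<le> d\<^sup>2"
        using R
      proof eventually_elim
        case (elim x)
        then have "x \<in> {-R..R}" by auto
        from g(2)[OF this] have "\<bar>f x - poly p x\<bar> \<le> d" using gp by simp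
        from power_mono[OF this abs_ge_zero, of 2] show ?case by simp
      qed
    qed simp
    also have "\<dots> = measure M (space M) * d\<^sup>2" by simp
    also have "\<dots> \<le> (measure M (space M) + 1) * d\<^sup>2" by (intro mult_right_mono) auto
    also have "\<dots> = e / 2"
    proof -
      have "K * (e / (2 * K)) = e / 2" if "K > 0" for K using that by (simp add: field_simps)
      from this[OF m] show ?thesis unfolding d(2) .
    qed
    also have "\<dots> < e" using \<open>e > 0\<close> by simp
    finally show "\<exists>k. D k \<and> (\<integral>x. (f x - k x)\<^sup>2 \<partial>M) < e" using D_poly by blast
  qed
  have one: "(\<lambda>x. 1) \<in> L2f M" by (rule L2f_const[OF fin])
  have ind_L2: "indicat_real A \<in> L2f M" if "A \<in> sets borel" for A
    using that by (intro L2f_bounded[OF fin, where C=1]) (auto simp: indicator_def)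
  have D_atMost: "D (indicat_real {..a})" for a
  \<comment> \<open>The approximants are ramps that equal 1 up to a and fall linearly to 0 at a +
    1/i.\<close>
  proof (rule D_seq[where w="\<lambda>x. 1" and k="\<lambda>i x. max 0 (min 1 (1 - real i * (x - a)))"])
    show "D (\<lambda>x. max 0 (min 1 (1 - real i * (x - a))))" for i
      by (rule D_cont) (auto intro!: continuous_intros)
    show "(\<lambda>i. max 0 (min 1 (1 - real i * (x - a)))) \<longlonglongrightarrow> indicat_real {..a} x" for x
    proof (cases "x \<le> a")
      case True
      then have "1 - real i * (x - a) \<ge> 1" for i by (simp add: mult_nonneg_nonpos)
      then show ?thesis using True by simp
    next
      case False
      obtain n where n: "1 < real n * (x - a)" using False reals_Archimedean3[of "x - a"] by auto
      have "\<forall>\<^sub>F i in sequentially. max 0 (min 1 (1 - real i * (x - a))) = 0"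
        using eventually_ge_at_top[of n]
      proof eventually_elim
        case (elim i)
        then have "real n * (x - a) \<le> real i * (x - a)" using False by (intro mult_right_mono) auto
        then show ?case using n by simp
      qed
      then show ?thesis using False by (simp add: tendsto_eventually)
    qed
  qed (auto intro!: one ind_L2)
  have D_one: "D (\<lambda>x. 1)" by (rule D_cont) (auto intro: continuous_intros)
  have D_ind: "D (indicat_real A)" if A: "A \<in> sets borel" for A
  proof -
    have "Int_stable (range atMost :: real set set)" "range atMost \<subseteq> Pow (UNIV :: real set)"
         "A \<in> sigma_sets UNIV (range atMost)"
      using A by (auto simp: borel_eq_atMost Int_stable_def)
    then show ?thesis
    \<comment> \<open>Dynkin's argument: half-lines are stable under intersection, and complements
      and disjoint unions stay in D by linearity and dominated convergence.\<close>
    proof (induction rule: sigma_sets_induct_disjoint)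
      case (basic A)
      then show ?case using D_atMost by auto
    next
      case empty
      show ?case using D_cmult[OF D_one, of 0] by simp
    next
      case (compl A)
      have "indicat_real (UNIV - A) = (\<lambda>x. 1 + (-1) * indicat_real A x)" by (auto simp: indicator_def)
      then show ?case using D_add[OF D_one D_cmult[OF compl.IH, of "-1"]] by simp
    next
      case (union A)
      show ?case
      proof (rule D_seq[where w="\<lambda>x. 1" and k="\<lambda>i x. \<Sum>j<i. indicat_real (A j) x"])
        have "D (\<lambda>x. \<Sum>j<i. indicat_real (A j) x)" for i
        proof (induction i)
          case 0
          then show ?case using D_cmult[OF D_one, of 0] by simp
        next
          case (Suc i)
          from D_add[OF this union.IH[of i]] show ?case by simp
        qed
        then show "D (\<lambda>x. \<Sum>j<i. indicat_real (A j) x)" for i .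
        have un: "(\<Sum>j<i. indicat_real (A j) x) = indicat_real (\<Union>j<i. A j) x" for i x
          by (subst indicator_UN_disjoint) (use union.hyps in \<open>auto simp: disjoint_family_on_def\<close>)
        show "(\<lambda>i. \<Sum>j<i. indicat_real (A j) x) \<longlonglongrightarrow> indicat_real (\<Union>(range A)) x" for x
          unfolding un by (rule LIMSEQ_indicator_UN)
        show "\<bar>\<Sum>j<i. indicat_real (A j) x\<bar> \<le> 1" for i x
          unfolding un by (simp add: indicator_def)
        have "A i \<in> sets borel" for i using union.hyps by (auto simp: borel_eq_atMost)
        then show "indicat_real (\<Union>(range A)) \<in> L2f M" by (intro ind_L2) auto
      qed (rule one)
    qed
  qed
  have D_nonneg: "D g" if g: "g \<in> L2f M" and nn: "\<And>x. g x \<ge> 0" for g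
  proof -
    have "g \<in> borel_measurable M" using g by (simp add: L2f_def)
    then have "g \<in> L2f M \<longrightarrow> D g"
      using nn
    proof (induction g rule: borel_measurable_induct_real)
      case (set A)
      then show ?case using D_ind sets by simp
    next
      case (mult u c)
      show ?case
      proof
        assume c: "(\<lambda>x. c * u x) \<in> L2f M"
        show "D (\<lambda>x. c * u x)"
        \<comment> \<open>Square integrability of \<open>c * u\<close> says nothing about u when c =
          0, so the induction hypothesis is available only for c nonzero.\<close>
        proof (cases "c = 0")
          case True
          then show ?thesis using D_cmult[OF D_one, of 0] by simp
        next
          case False
          then have "u \<in> L2f M" using L2f_cmult[OF c, of "1/c"] by simp
          then show ?thesis using mult D_cmult by blast
        qed
      qed
    next
      case (add u v)
      show ?case
      proof
        assume c: "(\<lambda>x. v x + u x) \<in> L2f M"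
        have "u \<in> L2f M" "v \<in> L2f M"
          using add by (auto intro!: L2f_dominated[OF c])
        then show "D (\<lambda>x. v x + u x)" using add D_add by blast
      qed
    next
      case (seq U)
      show ?case
      proof
        assume c: "g \<in> L2f M"
        have sp: "space M = UNIV" using sets_eq_imp_space_eq[OF sets] by simp
        have lim: "(\<lambda>i. U i x) \<longlonglongrightarrow> g x" for x using seq.hyps(4) sp by simp
        have le: "U i x \<le> g x" for i x
          using seq.hyps(3) lim[of x] by (intro incseq_le) (auto simp: mono_def le_fun_def)
        have UL: "U i \<in> L2f M" for i
        proof (rule L2f_dominated[OF c seq.hyps(1)])
          have "\<bar>U i x\<bar> \<le> \<bar>g x\<bar>" for x using seq.hyps(2)[of i x] le[of i x] by linarith
          then show "AE x in M. \<bar>U i x\<bar> \<le> \<bar>g x\<bar>" by simp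
        qed
        show "D g"
        proof (rule D_seq[OF c _ lim c])
          show "D (U i)" for i using seq.IH UL by blast
          show "\<bar>U i x\<bar> \<le> g x" for i x using seq.hyps(2)[of i x] le[of i x] by simp
        qed
      qed
    qed
    then show ?thesis using g by blast
  qed
  have "D h"
  proof -
    have "(\<lambda>x. max 0 (h x)) \<in> L2f M" "(\<lambda>x. max 0 (- h x)) \<in> L2f M"
      using h by (auto intro!: L2f_dominated[OF h])
    then have "D (\<lambda>x. max 0 (h x) + (-1) * max 0 (- h x))"
      by (intro D_add D_cmult D_nonneg) auto
    moreover have "(\<lambda>x. max 0 (h x) + (-1) * max 0 (- h x)) = h" by (auto simp: fun_eq_iff max_def)
    ultimately show ?thesis by simp
  qed
  then show ?thesis using e by (simp add: D_def)
qed

section \<open>Triangular forms on polynomials\<close>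

text \<open>Degree strictly below d, phrased by coefficients so that d = 0 singles out the zero
  polynomial, whose \<open>degree\<close> is 0.\<close>

definition lowdeg :: "nat \<Rightarrow> real poly \<Rightarrow> bool" where
  "lowdeg d p \<longleftrightarrow> (\<forall>i\<ge>d. coeff p i = 0)"

lemma lowdeg_0: "lowdeg 0 p \<longleftrightarrow> p = 0"
  by (auto simp: lowdeg_def poly_eq_iff)

lemma lowdeg_add: "lowdeg d p \<Longrightarrow> lowdeg d q \<Longrightarrow> lowdeg d (p + q)"
  and lowdeg_smult: "lowdeg d p \<Longrightarrow> lowdeg d (smult c p)"
  and lowdeg_mono: "lowdeg d p \<Longrightarrow> d \<le> d' \<Longrightarrow> lowdeg d' p"
  by (auto simp: lowdeg_def)

lemma lowdeg_monom: "i < d \<Longrightarrow> lowdeg d (monom c i)"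
  by (auto simp: lowdeg_def)

lemma lowdeg_exists: "\<exists>d\<ge>m. lowdeg d p"
  by (intro exI[of _ "max m (Suc (degree p))"]) (auto simp: lowdeg_def intro: coeff_eq_0)

lemma lowdeg_Suc_drop:
  assumes "lowdeg (Suc d) p" "lowdeg d (r - monom 1 d)"
  shows "lowdeg d (p - smult (coeff p d) r)"
proof -
  have "coeff (p - smult (coeff p d) r) i = 0" if "i \<ge> d" for i
  proof (cases "i = d")
    case True
    have "coeff (r - monom 1 d) d = 0" using assms(2) by (simp add: lowdeg_def)
    then show ?thesis using True by simp
  next
    case False
    have "coeff (r - monom 1 d) i = 0" using assms(2) that by (simp add: lowdeg_def)
    then have "coeff r i = 0" using False by simp
    moreover have "coeff p i = 0" using assms(1)[unfolded lowdeg_def, rule_format, of i] that False by simp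
    ultimately show ?thesis by simp
  qed
  then show ?thesis unfolding lowdeg_def by blast
qed

text \<open>\<open>B p q\<close> is a symmetric form \<open>\<langle>p, T q\<rangle>\<close> for an operator \<open>T\<close> that is triangular in the monomial
  basis; its spectrum is then read off the diagonal, by orthogonalising the monomials.\<close>

locale triangular_form =
  fixes ip B :: "real poly \<Rightarrow> real poly \<Rightarrow> real" and T :: "nat \<Rightarrow> real poly"
  assumes ip_add: "ip (p + q) s = ip p s + ip q s" and ip_smult: "ip (smult a p) s = a * ip p s"
    and ip_sym: "ip p q = ip q p" and ip_nonneg: "ip p p \<ge> 0"
    and B_add: "B (p + q) s = B p s + B q s" and B_smult: "B (smult a p) s = a * B p s"
    and B_sym: "B p q = B q p"
    and B_monom: "B p (monom 1 m) = ip p (T m)"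
    and lowdeg_T: "lowdeg (Suc m) (T m)"
begin

lemma ip_add_right: "ip s (p + q) = ip s p + ip s q"
  using ip_add ip_sym by metis
lemma ip_smult_right: "ip s (smult a p) = a * ip s p"
  using ip_smult ip_sym by metis
lemma B_add_right: "B s (p + q) = B s p + B s q"
  using B_add B_sym by metis
lemma B_smult_right: "B s (smult a p) = a * B s p"
  using B_smult B_sym by metis
lemma ip_zero: "ip 0 s = 0" "ip s 0 = 0"
  using ip_smult[of 0 0 s] ip_sym[of s 0] by simp_all
lemma B_zero: "B s 0 = 0"
  using B_smult_right[of s 0 0] by simp
lemma ip_diff: "ip (p - q) s = ip p s - ip q s"
  using ip_add[of "p - q" q s] by simp
lemma ip_diff_right: "ip s (p - q) = ip s p - ip s q"
  using ip_add_right[of s "p - q" q] by simp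
lemma B_diff_right: "B s (p - q) = B s p - B s q"
  using B_add_right[of s "p - q" q] by simp

text \<open>The form is only assumed semidefinite. If r were null but not orthogonal to u, the norm
  of u + l r would be affine in l with nonzero slope and would become negative; the chosen l gives
  the value -1.\<close>

lemma ip_null:
  assumes "ip r r = 0"
  shows "ip u r = 0"
proof (rule ccontr)
  assume ne: "ip u r \<noteq> 0"
  define l where "l = - (ip u u + 1) / (2 * ip u r)"
  have "ip (u + smult l r) (u + smult l r) = ip u u + 2 * l * ip u r + l\<^sup>2 * ip r r"
    by (simp add: ip_add ip_add_right ip_smult ip_smult_right ip_sym[of r u] algebra_simps power2_eq_square)
  also have "2 * l * ip u r = - (ip u u + 1)" using ne by (simp add: l_def field_simps)
  also have "ip u u + - (ip u u + 1) + l\<^sup>2 * ip r r = -1" using assms by simp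
  finally show False using ip_nonneg[of "u + smult l r"] by simp
qed

text \<open>Gram-Schmidt by induction on the degree: r is the monomial of degree d made orthogonal
  to all lower degrees, and the component of p - q along r is added to q.\<close>

lemma projection: "\<exists>q. lowdeg d q \<and> (\<forall>s. lowdeg d s \<longrightarrow> ip (p - q) s = 0)"
proof (induction d arbitrary: p)
  case 0
  then show ?case by (auto simp: lowdeg_0 ip_zero)
next
  case (Suc d)
  obtain m where m: "lowdeg d m" "\<And>s. lowdeg d s \<Longrightarrow> ip (monom 1 d - m) s = 0"
    using Suc.IH[of "monom 1 d"] by blast
  define r where "r = monom 1 d - m"
  obtain q where q: "lowdeg d q" "\<And>s. lowdeg d s \<Longrightarrow> ip (p - q) s = 0"
    using Suc.IH[of p] by blast
  \<comment> \<open>If r is null, division by zero gives a = 0, and \<open>ip_null\<close> makes the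
    numerator vanish as well, so \<open>a * ip r r = ip (p - q) r\<close> holds in every
    case.\<close>
  define a where "a = ip (p - q) r / ip r r"
  have rd: "lowdeg d (r - monom 1 d)" using lowdeg_smult[OF m(1), of "-1"] by (simp add: r_def)
  have ar: "a * ip r r = ip (p - q) r"
    using ip_null[of r "p - q"] by (cases "ip r r = 0") (auto simp: a_def)
  show ?case
  proof (intro exI[of _ "q + smult a r"] conjI allI impI)
    have "lowdeg (Suc d) r" using rd lowdeg_monom[of d "Suc d" 1] lowdeg_mono[of d "r - monom 1 d" "Suc d"]
      by (auto simp: lowdeg_def)
    then show "lowdeg (Suc d) (q + smult a r)"
      using q(1) by (intro lowdeg_add lowdeg_smult) (auto intro: lowdeg_mono)
    fix s assume s: "lowdeg (Suc d) s"
    define s' where "s' = s - smult (coeff s d) r"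
    have s': "lowdeg d s'" using lowdeg_Suc_drop[OF s rd] by (simp add: s'_def)
    have "ip (p - (q + smult a r)) s = ip (p - q) s' + coeff s d * ip (p - q) r - a * (ip r s' + coeff s d * ip r r)"
      by (simp add: s'_def ip_diff ip_add ip_smult ip_diff_right ip_smult_right algebra_simps)
    also have "\<dots> = coeff s d * (ip (p - q) r - a * ip r r)"
      using q(2)[OF s'] m(2)[OF s'] by (simp add: r_def algebra_simps)
    finally show "ip (p - (q + smult a r)) s = 0" by (simp add: ar)
  qed
qed

text \<open>Peel off the leading term as a r + q, where r is the orthogonalised monomial of degree
  d. Triangularity and symmetry make r orthogonal to q for B as well as for \<open>ip\<close>, and
  on r the form B is the diagonal entry times \<open>ip r r\<close>; hence both forms split and the
  bound adds up. The set S carries linear constraints of low degree, which remove eigenvectors with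
  large eigenvalues and pass from p to q.\<close>

lemma form_bound:
  assumes S: "\<And>s. s \<in> S \<Longrightarrow> lowdeg d0 s"
    and diag: "\<And>m. m \<ge> d0 \<Longrightarrow> \<bar>coeff (T m) m\<bar> \<le> c"
    and base: "\<And>p. lowdeg d0 p \<Longrightarrow> (\<And>s. s \<in> S \<Longrightarrow> ip p s = 0) \<Longrightarrow> \<bar>B p p\<bar> \<le> c * ip p p"
    and p: "\<And>s. s \<in> S \<Longrightarrow> ip p s = 0"
  shows "\<bar>B p p\<bar> \<le> c * ip p p"
proof -
  obtain d where d: "d \<ge> d0" "lowdeg d p" using lowdeg_exists by blast
  then show ?thesis using p
  proof (induction d arbitrary: p rule: dec_induct)
    case base
    then show ?case by (rule assms(3))
  next
    case (step d)
    obtain m where m: "lowdeg d m" "\<And>s. lowdeg d s \<Longrightarrow> ip (monom 1 d - m) s = 0"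
      using projection[of d "monom 1 d"] by blast
    define r where "r = monom 1 d - m"
    have r: "ip r s = 0" if "lowdeg d s" for s using m(2)[OF that] by (simp add: r_def)
    have rd: "lowdeg d (r - monom 1 d)" using lowdeg_smult[OF m(1), of "-1"] by (simp add: r_def)
    define a where "a = coeff p d"
    define q where "q = p - smult a r"
    have q: "lowdeg d q" using lowdeg_Suc_drop[OF step.prems(1) rd] by (simp add: q_def a_def)
    have peq: "p = smult a r + q" by (simp add: q_def)
    \<comment> \<open>For e < d, B r of the monomial of degree e is the \<open>ip\<close> of r with
      T e, which has degree at most e and is orthogonal to r.\<close>
    have Br: "B r s = 0" if s: "lowdeg d s" for s
    proof -
      have "lowdeg e s \<Longrightarrow> e \<le> d \<Longrightarrow> B r s = 0" for e s
      proof (induction e arbitrary: s)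
        case 0
        then show ?case by (simp add: lowdeg_0 B_zero)
      next
        case (Suc e)
        have "lowdeg e (s - smult (coeff s e) (monom 1 e))"
          by (rule lowdeg_Suc_drop[OF Suc.prems(1)]) (simp add: lowdeg_def)
        then have "B r (s - smult (coeff s e) (monom 1 e)) = 0" using Suc by simp
        moreover have "ip r (T e) = 0"
          using Suc.prems lowdeg_T[of e] by (intro r) (auto intro: lowdeg_mono)
        ultimately show ?case by (simp add: B_diff_right B_smult_right B_monom)
      qed
      then show ?thesis using s by blast
    qed
    have ipr: "ip r (monom 1 d) = ip r r"
      using r[OF m(1)] by (simp add: r_def ip_diff_right)
    have Brr: "B r r = coeff (T d) d * ip r r"
    proof -
      have "lowdeg d (T d - smult (coeff (T d) d) (monom 1 d))"
        by (rule lowdeg_Suc_drop[OF lowdeg_T]) (simp add: lowdeg_def)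
      from r[OF this] have "ip r (T d) = coeff (T d) d * ip r r"
        by (simp add: ip_diff_right ip_smult_right ipr)
      moreover have "B r r = B r (monom 1 d) - B r m" by (simp add: r_def B_diff_right)
      ultimately show ?thesis using Br[OF m(1)] by (simp add: B_monom)
    qed
    have "\<bar>B q q\<bar> \<le> c * ip q q"
    proof (rule step.IH[OF q])
      fix s assume "s \<in> S"
      then have "ip r s = 0" using r S step.hyps(1) lowdeg_mono by blast
      then show "ip q s = 0" using step.prems(2)[OF \<open>s \<in> S\<close>] by (simp add: q_def ip_diff ip_smult)
    qed
    moreover have "B p p = a\<^sup>2 * (coeff (T d) d * ip r r) + B q q"
      using Br[OF q] by (simp add: peq B_add B_add_right B_smult B_smult_right B_sym[of q r] Brr power2_eq_square)
    moreover have "ip p p = a\<^sup>2 * ip r r + ip q q"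
      using r[OF q] by (simp add: peq ip_add ip_add_right ip_smult ip_smult_right ip_sym[of q r] power2_eq_square)
    moreover have "\<bar>a\<^sup>2 * (coeff (T d) d * ip r r)\<bar> \<le> c * (a\<^sup>2 * ip r r)"
    proof -
      have "\<bar>coeff (T d) d\<bar> * (a\<^sup>2 * ip r r) \<le> c * (a\<^sup>2 * ip r r)"
        using diag[of d] step.hyps ip_nonneg[of r] by (intro mult_right_mono) auto
      then show ?thesis using ip_nonneg[of r] by (simp add: abs_mult algebra_simps)
    qed
    ultimately show ?case by (simp add: algebra_simps)
  qed
qed

end

section \<open>Moments of one coordinate\<close>

lemma finite_measure_usph: "finite_measure (usph n)"
  using prob_space_usph[of n] by (simp add: prob_space_def)

lemma finite_measure_marg: "n \<ge> 1 \<Longrightarrow> finite_measure (marg n)"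
  using prob_space_marg[of n] by (simp add: prob_space_def)

lemma usph_slices:
  fixes F :: "(nat \<Rightarrow> real) \<Rightarrow> real"
  assumes n: "n \<ge> 1" and F: "integrable (usph (Suc n)) F"
  shows "AE x in marg (Suc n). integrable (usph n) (\<lambda>w. F (glue n x w))"
    and "integrable (marg (Suc n)) (\<lambda>x. \<integral>w. F (glue n x w) \<partial>usph n)"
    and "(\<integral>v. F v \<partial>usph (Suc n)) = (\<integral>x. \<integral>w. F (glue n x w) \<partial>usph n \<partial>marg (Suc n))"
proof -
  interpret u: prob_space "usph n" by (rule prob_space_usph)
  interpret m: prob_space "marg (Suc n)" by (rule prob_space_marg) simp
  interpret p: pair_sigma_finite "marg (Suc n)" "usph n" ..
  have [measurable]: "F \<in> borel_measurable (PB (Suc n))"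
    using borel_measurable_integrable[OF F] by simp
  have g: "(\<lambda>(x, w). glue n x w) \<in> measurable (marg (Suc n) \<Otimes>\<^sub>M usph n) (PB (Suc n))"
    by measurable
  have i: "integrable (marg (Suc n) \<Otimes>\<^sub>M usph n) (\<lambda>z. F (glue n (fst z) (snd z)))"
    using F unfolding usph_Suc[OF n] by (subst (asm) integrable_distr_eq) (auto simp: split_beta)
  show "AE x in marg (Suc n). integrable (usph n) (\<lambda>w. F (glue n x w))"
    using p.AE_integrable_fst'[OF i] by simp
  show "integrable (marg (Suc n)) (\<lambda>x. \<integral>w. F (glue n x w) \<partial>usph n)"
    using p.integrable_fst'[OF i] by simp
  have "(\<integral>v. F v \<partial>usph (Suc n)) = (\<integral>z. F (glue n (fst z) (snd z)) \<partial>(marg (Suc n) \<Otimes>\<^sub>M usph n))"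
    unfolding usph_Suc[OF n] using g by (subst integral_distr) (auto simp: split_beta)
  also have "\<dots> = (\<integral>x. \<integral>w. F (glue n x w) \<partial>usph n \<partial>marg (Suc n))"
    using p.integral_fst'[OF i] by simp
  finally show "(\<integral>v. F v \<partial>usph (Suc n)) = (\<integral>x. \<integral>w. F (glue n x w) \<partial>usph n \<partial>marg (Suc n))" .
qed

lemma nth_measurable_usph: "i \<in> {1..n} \<Longrightarrow> (\<lambda>v. v i) \<in> borel_measurable (usph n)"
  by measurable

lemma usph_coordinate_law:
  assumes "i \<in> {1..n}"
  shows "distr (usph n) borel (\<lambda>v. v i) = marg n"
proof -
  have n: "n \<in> {1..n}" using assms by auto
  have "distr (usph n) borel (\<lambda>v. v i) = distr (distr (usph n) (PB n) (\<lambda>v. v(i := v n, n := v i))) borel (\<lambda>v. v i)"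
    using usph_swap[OF assms n] by simp
  also have "\<dots> = distr (usph n) borel ((\<lambda>v. v i) \<circ> (\<lambda>v. v(i := v n, n := v i)))"
    by (rule distr_distr) (use assms n in \<open>simp_all add: swap_measurable cong: measurable_cong_sets\<close>)
  also have "(\<lambda>v. v i) \<circ> (\<lambda>v. v(i := v n, n := v i)) = (\<lambda>v. v n)"
    by (auto simp: fun_eq_iff)
  finally show ?thesis by (simp add: marg_def)
qed

lemma usph_coordinate:
  fixes h :: "real \<Rightarrow> real"
  assumes i: "i \<in> {1..n}" and h: "h \<in> borel_measurable borel"
  shows "(\<integral>v. h (v i) \<partial>usph n) = (\<integral>x. h x \<partial>marg n)"
    and "integrable (usph n) (\<lambda>v. h (v i)) \<longleftrightarrow> integrable (marg n) h"
  unfolding usph_coordinate_law[OF i, symmetric]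
  using h nth_measurable_usph[OF i] by (simp_all add: integral_distr integrable_distr_eq)

lemma L2f_marg_borel: "h \<in> L2f (marg n) \<Longrightarrow> h \<in> borel_measurable borel"
  using measurable_cong_sets[OF sets_marg[of n] refl, of borel] by (auto simp: L2f_def)

lemma L2f_coordinate:
  assumes i: "i \<in> {1..n}" and h: "h \<in> L2f (marg n)"
  shows "(\<lambda>v. h (v i)) \<in> L2f (usph n)" "(\<integral>v. (h (v i))\<^sup>2 \<partial>usph n) = (\<integral>x. (h x)\<^sup>2 \<partial>marg n)"
    "(\<integral>v. h (v i) \<partial>usph n) = (\<integral>x. h x \<partial>marg n)"
proof -
  have [measurable]: "h \<in> borel_measurable borel" using h by (rule L2f_marg_borel)
  show "(\<lambda>v. h (v i)) \<in> L2f (usph n)"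
    using usph_coordinate(2)[OF i, of "\<lambda>x. (h x)\<^sup>2"] h i by (simp add: L2f_def)
  show "(\<integral>v. (h (v i))\<^sup>2 \<partial>usph n) = (\<integral>x. (h x)\<^sup>2 \<partial>marg n)"
    using usph_coordinate(1)[OF i, of "\<lambda>x. (h x)\<^sup>2"] by simp
  show "(\<integral>v. h (v i) \<partial>usph n) = (\<integral>x. h x \<partial>marg n)"
    using usph_coordinate(1)[OF i] by simp
qed

lemma usph_pair:
  fixes H :: "real \<Rightarrow> real \<Rightarrow> real"
  assumes ij: "i \<in> {1..n}" "j \<in> {1..n}" "i \<noteq> j" and kl: "k \<in> {1..n}" "l \<in> {1..n}" "k \<noteq> l"
    and [measurable]: "(\<lambda>z. H (fst z) (snd z)) \<in> borel_measurable (borel \<Otimes>\<^sub>M borel)"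
  shows "(\<integral>v. H (v i) (v j) \<partial>usph n) = (\<integral>v. H (v k) (v l) \<partial>usph n)"
    and "integrable (usph n) (\<lambda>v. H (v i) (v j)) \<longleftrightarrow> integrable (usph n) (\<lambda>v. H (v k) (v l))"
proof -
  have m: "(\<lambda>v. (v i, v j)) \<in> measurable (usph n) (borel \<Otimes>\<^sub>M borel)" "(\<lambda>v. (v k, v l)) \<in> measurable (usph n) (borel \<Otimes>\<^sub>M borel)"
    using ij kl by measurable
  show "(\<integral>v. H (v i) (v j) \<partial>usph n) = (\<integral>v. H (v k) (v l) \<partial>usph n)"
    using integral_distr[OF m(1) assms(7)] integral_distr[OF m(2) assms(7)] usph_pair_law[OF ij kl] by simp
  show "integrable (usph n) (\<lambda>v. H (v i) (v j)) \<longleftrightarrow> integrable (usph n) (\<lambda>v. H (v k) (v l))"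
    using integrable_distr_eq[OF m(1) assms(7)] integrable_distr_eq[OF m(2) assms(7)] usph_pair_law[OF ij kl] by simp
qed

lemma AE_usph_bound: "i \<in> {1..n} \<Longrightarrow> AE v in usph n. (v i)\<^sup>2 \<le> real n"
proof -
  assume i: "i \<in> {1..n}"
  then have "n \<ge> 1" by auto
  from AE_usph_sphere[OF this] show ?thesis
  proof eventually_elim
    case (elim v)
    have "(v i)\<^sup>2 \<le> (\<Sum>j=1..n. (v j)\<^sup>2)" using i by (intro member_le_sum) auto
    then show ?case using elim by (simp add: kac_sphere_def)
  qed
qed

lemma AE_marg_bound: "n \<ge> 1 \<Longrightarrow> AE x in marg n. x\<^sup>2 \<le> real n"
proof -
  assume n: "n \<ge> 1"
  then have i: "n \<in> {1..n}" by simp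
  have "(\<lambda>v. v n) \<in> measurable (usph n) borel" using nth_measurable_usph[OF i] .
  moreover have "{x \<in> space (borel::real measure). x\<^sup>2 \<le> real n} \<in> sets borel" by measurable
  ultimately show ?thesis
    unfolding marg_def using AE_usph_bound[OF i] by (subst AE_distr_iff) auto
qed

lemma abs_le_of_sq: "x\<^sup>2 \<le> real n \<Longrightarrow> \<bar>x\<bar> \<le> sqrt (real n)"
  using real_sqrt_le_mono[of "x\<^sup>2" "real n"] by simp

lemma continuous_L2f_marg:
  assumes n: "n \<ge> 1" and f: "continuous_on UNIV f"
  shows "f \<in> L2f (marg n)"
proof -
  have "compact (f ` {- sqrt (real n)..sqrt (real n)})"
    by (intro compact_continuous_image continuous_on_subset[OF f]) auto
  then obtain C where C: "\<forall>x\<in>{- sqrt (real n)..sqrt (real n)}. \<bar>f x\<bar> \<le> C"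
    by (auto dest!: compact_imp_bounded simp: bounded_iff)
  have "f \<in> borel_measurable (marg n)"
    using borel_measurable_continuous_onI[OF f] by simp
  moreover have "AE x in marg n. \<bar>f x\<bar> \<le> C"
    using AE_marg_bound[OF n]
  proof eventually_elim
    case (elim x)
    then have "x \<in> {- sqrt (real n)..sqrt (real n)}" using abs_le_of_sq[OF elim] by auto
    then show ?case using C by blast
  qed
  ultimately show ?thesis by (rule L2f_bounded[OF finite_measure_marg[OF n]])
qed

lemma poly_L2f_marg: "n \<ge> 1 \<Longrightarrow> poly p \<in> L2f (marg n)"
  by (intro continuous_L2f_marg) (auto intro!: continuous_intros)

lemma pow_L2f_marg: "n \<ge> 1 \<Longrightarrow> (\<lambda>x. x ^ m) \<in> L2f (marg n)"
  by (intro continuous_L2f_marg) (auto intro!: continuous_intros)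

lemma marg_moment2:
  assumes n: "n \<ge> 1"
  shows "(\<integral>x. x\<^sup>2 \<partial>marg n) = 1"
proof -
  have i: "integrable (usph n) (\<lambda>v. (v j)\<^sup>2)" if "j \<in> {1..n}" for j
    using L2f_integrable[OF finite_measure_usph L2f_coordinate(1)[OF that pow_L2f_marg[OF n, of 2]]] .
  have "real n * (\<integral>x. x\<^sup>2 \<partial>marg n) = (\<Sum>j=1..n. \<integral>v. (v j)\<^sup>2 \<partial>usph n)"
    by (simp add: usph_coordinate(1)[of _ _ "\<lambda>x. x\<^sup>2"])
  also have "\<dots> = (\<integral>v. (\<Sum>j=1..n. (v j)\<^sup>2) \<partial>usph n)"
    using i by simp
  also have "\<dots> = (\<integral>v. real n \<partial>usph n)"
    using AE_usph_sphere[OF n] by (intro integral_cong_AE) (auto simp: kac_sphere_def)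
  finally show ?thesis using n prob_space.prob_space[OF prob_space_usph[of n]] by simp
qed

text \<open>Two linear relations determine the fourth moment and the mixed moment of v1^2 v2^2:
  invariance under rotation by pi/4 makes the former three times the latter, and squaring the
  equation of the sphere gives the second relation.\<close>

lemma marg_moment4:
  assumes n: "n \<ge> 2"
  shows "(\<integral>x. x ^ 4 \<partial>marg n) = 3 * real n / (real n + 2)"
proof -
  have n1: "n \<ge> 1" and i1: "1 \<in> {1..n}" and i2: "2 \<in> {1..n}" using n by auto
  define m4 where "m4 = (\<integral>x. x ^ 4 \<partial>marg n)"
  define m22 where "m22 = (\<integral>v. (v 1)\<^sup>2 * (v 2)\<^sup>2 \<partial>usph n)"
  have L: "(\<lambda>v. (v j)\<^sup>2) \<in> L2f (usph n)" if "j \<in> {1..n}" for j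
    using L2f_coordinate(1)[OF that pow_L2f_marg[OF n1, of 2]] .
  have i22: "integrable (usph n) (\<lambda>v. (v i)\<^sup>2 * (v j)\<^sup>2)" if "i \<in> {1..n}" "j \<in> {1..n}" for i j
    by (intro L2f_mult L that)
  have i4: "integrable (usph n) (\<lambda>v. (v i) ^ 4)" if "i \<in> {1..n}" for i
    using i22[OF that that] by (simp add: power2_eq_square power4_eq_xxxx mult.assoc)
  have e4: "(\<integral>v. (v i) ^ 4 \<partial>usph n) = m4" if "i \<in> {1..n}" for i
    using usph_coordinate(1)[OF that, of "\<lambda>x. x ^ 4"] by (simp add: m4_def)
  have e22: "(\<integral>v. (v i)\<^sup>2 * (v j)\<^sup>2 \<partial>usph n) = (if i = j then m4 else m22)" if "i \<in> {1..n}" "j \<in> {1..n}" for i j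
    using e4[OF that(1)] usph_pair(1)[OF that _ i1 i2, of "\<lambda>a b. a\<^sup>2 * b\<^sup>2"]
    by (auto simp: m22_def power2_eq_square power4_eq_xxxx mult.assoc)
  have rot: "m4 = 3 * m22"
  proof -
    let ?R = "pair_rot 1 2 (pi/4)"
    have R: "distr (usph n) (PB n) ?R = usph n"
      using i1 i2 by (intro usph_rot) (auto simp: sin_45)
    have "2 * m4 = (\<integral>v. (v 1) ^ 4 + (v 2) ^ 4 \<partial>usph n)"
      using e4 i4 i1 i2 by simp
    also have "\<dots> = (\<integral>v. (v 1) ^ 4 + (v 2) ^ 4 \<partial>distr (usph n) (PB n) ?R)" by (simp add: R)
    also have "\<dots> = (\<integral>v. (?R v 1) ^ 4 + (?R v 2) ^ 4 \<partial>usph n)"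
      using i1 i2 by (intro integral_distr) measurable
    also have "\<dots> = (\<integral>v. (v 1) ^ 4 / 2 + 3 * ((v 1)\<^sup>2 * (v 2)\<^sup>2) + (v 2) ^ 4 / 2 \<partial>usph n)"
    proof (rule Bochner_Integration.integral_cong[OF refl])
      fix v :: "nat \<Rightarrow> real"
      have s4: "sqrt 2 ^ 4 = 4" by (simp add: power4_eq_xxxx)
      have "(a * c + b * c) ^ 4 + (- a * c + b * c) ^ 4 = c ^ 4 * (2 * a ^ 4 + 12 * (a\<^sup>2 * b\<^sup>2) + 2 * b ^ 4)" for a b c :: real
        by algebra
      from this[of "v 1" "sqrt 2 / 2" "v 2"]
      show "(?R v 1) ^ 4 + (?R v 2) ^ 4 = (v 1) ^ 4 / 2 + 3 * ((v 1)\<^sup>2 * (v 2)\<^sup>2) + (v 2) ^ 4 / 2"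
        by (simp add: pair_rot_def sin_45 cos_45 power_divide s4)
    qed
    also have "\<dots> = m4 + 3 * m22"
      using e4 e22[OF i1 i2] i4 i22 i1 i2 by simp
    finally show ?thesis by simp
  qed
  have "(real n)\<^sup>2 = (\<integral>v. (real n)\<^sup>2 \<partial>usph n)"
    using prob_space.prob_space[OF prob_space_usph[of n]] by simp
  also have "\<dots> = (\<integral>v. (\<Sum>i=1..n. \<Sum>j=1..n. (v i)\<^sup>2 * (v j)\<^sup>2) \<partial>usph n)"
  proof (rule integral_cong_AE)
    show "AE v in usph n. (real n)\<^sup>2 = (\<Sum>i=1..n. \<Sum>j=1..n. (v i)\<^sup>2 * (v j)\<^sup>2)"
      using AE_usph_sphere[OF n1]
    proof eventually_elim
      case (elim v)
      then have "(\<Sum>j=1..n. (v j)\<^sup>2) = real n" by (simp add: kac_sphere_def)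
      then show ?case unfolding sum_product[symmetric] by (simp add: power2_eq_square)
    qed
  qed simp_all
  also have "\<dots> = (\<Sum>i=1..n. \<Sum>j=1..n. \<integral>v. (v i)\<^sup>2 * (v j)\<^sup>2 \<partial>usph n)"
    by (subst Bochner_Integration.integral_sum, intro Bochner_Integration.integrable_sum i22, assumption+)
       (intro sum.cong refl Bochner_Integration.integral_sum i22)
  also have "\<dots> = (\<Sum>i=1..n. \<Sum>j=1..n. if i = j then m4 else m22)"
    by (intro sum.cong refl e22)
  also have "\<dots> = (\<Sum>i=1..n. (m4 - m22) + real n * m22)"
  proof (rule sum.cong[OF refl])
    fix i assume i: "i \<in> {1..n}"
    have "(\<Sum>j=1..n. if i = j then m4 else m22) = (\<Sum>j=1..n. (if i = j then m4 - m22 else 0) + m22)"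
      by (intro sum.cong) auto
    also have "\<dots> = (m4 - m22) + real n * m22"
      unfolding sum.distrib using i by simp
    finally show "(\<Sum>j=1..n. if i = j then m4 else m22) = (m4 - m22) + real n * m22" .
  qed
  also have "\<dots> = real n * ((m4 - m22) + real n * m22)" by simp
  finally have "real n = (m4 - m22) + real n * m22" using n by (simp add: power2_eq_square)
  then have "real n = m22 * (real n + 2)" using rot by (simp add: algebra_simps)
  then have "m22 = real n / (real n + 2)" by (simp add: field_simps)
  then show ?thesis using rot by (simp add: m4_def)
qed

lemma marg_moment_odd:
  assumes n: "n \<ge> 1" and m: "odd m"
  shows "(\<integral>x. x ^ m \<partial>marg n) = 0"
proof -
  have i: "n \<in> {1..n}" using n by simp
  have "(\<integral>x. x ^ m \<partial>marg n) = (\<integral>v. (v n) ^ m \<partial>usph n)"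
    using usph_coordinate(1)[OF i, of "\<lambda>x. x ^ m"] by simp
  also have "\<dots> = (\<integral>v. (v n) ^ m \<partial>distr (usph n) (PB n) (\<lambda>v. v(n := - v n)))"
    by (simp add: usph_reflect[OF i])
  also have "\<dots> = (\<integral>v. ((v(n := - v n)) n) ^ m \<partial>usph n)"
    using i by (intro integral_distr) (simp_all add: reflect_measurable cong: measurable_cong_sets)
  also have "\<dots> = - (\<integral>v. (v n) ^ m \<partial>usph n)"
    using m by (simp add: power_minus_odd)
  finally have "(\<integral>v. (v n) ^ m \<partial>usph n) = 0"
    using \<open>(\<integral>x. x ^ m \<partial>marg n) = (\<integral>v. (v n) ^ m \<partial>usph n)\<close> by simp
  then show ?thesis using \<open>(\<integral>x. x ^ m \<partial>marg n) = (\<integral>v. (v n) ^ m \<partial>usph n)\<close> by simp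
qed

text \<open>Since x^2 <= n on the support, the normalised moments decrease in k, so the fourth
  moment is the worst case. In terms of N = n + 1 the bound is 3/(N^2 - 1).\<close>

lemma marg_moment_even_bound:
  assumes n: "n \<ge> 2" and k: "k \<ge> 2"
  shows "\<bar>(\<integral>x. x ^ (2 * k) \<partial>marg n) / real n ^ k\<bar> \<le> 3 / (real n * (real n + 2))"
proof -
  have n1: "n \<ge> 1" using n by simp
  have i: "integrable (marg n) (\<lambda>x. x ^ m)" for m
    using L2f_integrable[OF finite_measure_marg[OF n1] pow_L2f_marg[OF n1]] .
  have "(\<integral>x. x ^ (2 * k) \<partial>marg n) \<ge> 0"
    by (intro integral_nonneg_AE) (simp add: power_mult)
  moreover have "(\<integral>x. x ^ (2 * k) \<partial>marg n) \<le> (\<integral>x. real n ^ (k - 2) * x ^ 4 \<partial>marg n)"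
  proof (rule integral_mono_AE)
    show "AE x in marg n. x ^ (2 * k) \<le> real n ^ (k - 2) * x ^ 4"
      using AE_marg_bound[OF n1]
    proof eventually_elim
      case (elim x)
      have "x ^ (2 * k) = (x\<^sup>2) ^ (k - 2) * (x\<^sup>2) ^ 2"
        using k by (metis le_add_diff_inverse2 power_add power_mult)
      also have "\<dots> \<le> real n ^ (k - 2) * (x\<^sup>2) ^ 2"
        using elim by (intro mult_right_mono power_mono) auto
      also have "(x\<^sup>2) ^ 2 = x ^ 4" by (simp flip: power_mult)
      finally show ?case .
    qed
  qed (use i in auto)
  moreover have "\<dots> = real n ^ (k - 2) * (3 * real n / (real n + 2))"
    by (simp add: marg_moment4[OF n])
  moreover have "real n ^ (k - 2) * (3 * real n / (real n + 2)) / real n ^ k = 3 / (real n * (real n + 2))"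
  proof -
    have "real n ^ k = real n ^ (k - 2) * (real n)\<^sup>2"
      using k by (metis le_add_diff_inverse2 power_add)
    moreover have aux: "X * (3 * r / (r + 2)) / (X * r\<^sup>2) = 3 / (r * (r + 2))" if "X > 0" "r > 0" for X r :: real
      using that by (simp add: divide_simps power2_eq_square)
    moreover have "real n ^ (k - 2) > 0" "real n > 0" using n by auto
    ultimately show ?thesis using aux[of "real n ^ (k - 2)" "real n"] by (simp only:)
  qed
  moreover have "a / real n ^ k \<le> b / real n ^ k" if "a \<le> b" for a b
    using that n by (intro divide_right_mono) auto
  ultimately show ?thesis using n by (metis abs_of_nonneg divide_nonneg_nonneg of_nat_0_le_iff zero_le_power)
qed

section \<open>Correlation of two coordinates\<close>

text \<open>The bilinear form of the operator that maps k to the conditional expectation of k(v 1)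
  given the last coordinate. The last coordinate is used in the first slot because slices condition
  on it.\<close>

definition corr :: "nat \<Rightarrow> (real \<Rightarrow> real) \<Rightarrow> (real \<Rightarrow> real) \<Rightarrow> real" where
  "corr n h k = (\<integral>v. h (v n) * k (v 1) \<partial>usph n)"

text \<open>\<open>corr_poly n m\<close> is the conditional expectation of \<open>(v 1)\<^sup>m\<close> given \<open>v (Suc n) = x\<close> on the sphere in
  dimension \<open>Suc n\<close>, as a polynomial in \<open>x\<close>.\<close>

definition corr_poly :: "nat \<Rightarrow> nat \<Rightarrow> real poly" where
  "corr_poly n m = (if even m
     then smult ((\<integral>x. x ^ m \<partial>marg n) / real n ^ (m div 2)) ([:real (Suc n), 0, -1:] ^ (m div 2)) else 0)"

lemma degree_quadratic_power: "degree ([:a, 0, -1:] ^ k :: real poly) = 2 * k"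
  by (subst degree_power_eq) auto

lemma lowdeg_corr_poly: "lowdeg (Suc m) (corr_poly n m)"
proof -
  have "coeff (corr_poly n m) i = 0" if "i \<ge> Suc m" for i
    using that by (auto simp: corr_poly_def degree_quadratic_power intro!: coeff_eq_0)
  then show ?thesis unfolding lowdeg_def by blast
qed

text \<open>These are the diagonal entries, that is, the eigenvalues of the correlation operator.
  Odd ones vanish; for m = 2k the k-th power of n + 1 - x^2 has leading coefficient (-1)^k, leaving
  a normalised moment up to sign.\<close>

lemma coeff_corr_poly_bound:
  assumes n: "n \<ge> 2" and m: "m \<ge> 3"
  shows "\<bar>coeff (corr_poly n m) m\<bar> \<le> 3 / (real n * (real n + 2))"
proof (cases "even m")
  case True
  then obtain k where k: "m = 2 * k" by blast
  have "coeff ([:real (Suc n), 0, -1:] ^ k) (2 * k) = (-1) ^ k"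
    using lead_coeff_power[of "[:real (Suc n), 0, -1:]" k] by (simp add: degree_quadratic_power)
  then have "\<bar>coeff (corr_poly n m) m\<bar> = \<bar>(\<integral>x. x ^ (2 * k) \<partial>marg n) / real n ^ k\<bar>"
    by (simp add: corr_poly_def k abs_mult)
  also have "\<dots> \<le> 3 / (real n * (real n + 2))"
    using m k by (intro marg_moment_even_bound n) auto
  finally show ?thesis .
qed (simp add: corr_poly_def)

lemma L2f_usph_ends:
  assumes "n \<ge> 2" "h \<in> L2f (marg n)"
  shows "(\<lambda>v. h (v n)) \<in> L2f (usph n)" "(\<lambda>v. h (v 1)) \<in> L2f (usph n)"
  using assms by (auto intro!: L2f_coordinate(1))

lemma corr_sym:
  assumes n: "n \<ge> 2" and "h \<in> borel_measurable borel" "k \<in> borel_measurable borel"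
  shows "corr n h k = corr n k h"
proof -
  have "(\<integral>v. h (v n) * k (v 1) \<partial>usph n) = (\<integral>v. h (v 1) * k (v n) \<partial>usph n)"
    using n assms by (intro usph_pair(1)) auto
  then show ?thesis by (simp add: corr_def mult.commute)
qed

lemma corr_add_left:
  assumes "n \<ge> 2" "h \<in> L2f (marg n)" "h' \<in> L2f (marg n)" "k \<in> L2f (marg n)"
  shows "corr n (\<lambda>x. h x + h' x) k = corr n h k + corr n h' k"
  unfolding corr_def distrib_right
  by (intro Bochner_Integration.integral_add L2f_mult L2f_usph_ends assms)

lemma corr_diff_left:
  assumes "n \<ge> 2" "h \<in> L2f (marg n)" "h' \<in> L2f (marg n)" "k \<in> L2f (marg n)"
  shows "corr n (\<lambda>x. h x - h' x) k = corr n h k - corr n h' k"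
  unfolding corr_def left_diff_distrib
  by (intro Bochner_Integration.integral_diff L2f_mult L2f_usph_ends assms)

lemma corr_cmult_left: "corr n (\<lambda>x. a * h x) k = a * corr n h k"
  unfolding corr_def by (simp add: mult.assoc)

lemma corr_am_gm:
  assumes n: "n \<ge> 2" and h: "h \<in> L2f (marg n)" and k: "k \<in> L2f (marg n)" and t: "t > 0"
  shows "2 * \<bar>corr n h k\<bar> \<le> t * (\<integral>x. (h x)\<^sup>2 \<partial>marg n) + (\<integral>x. (k x)\<^sup>2 \<partial>marg n) / t"
  using L2_am_gm[OF L2f_usph_ends(1)[OF n h] L2f_usph_ends(2)[OF n k] t] n
  by (simp add: corr_def L2f_coordinate(2)[OF _ h] L2f_coordinate(2)[OF _ k])

lemma slice_factor_sq: "n \<ge> 1 \<Longrightarrow> x\<^sup>2 \<le> real (Suc n) \<Longrightarrow> (slice_factor n x)\<^sup>2 = (real (Suc n) - x\<^sup>2) / real n"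
  by (simp add: slice_factor_def)

text \<open>On the slice at x the coordinate v 1 is the slice factor times w 1. Odd moments of w 1
  vanish, so only even powers of the slice factor occur, and these are polynomials in x.\<close>

lemma corr_monomial:
  assumes n: "n \<ge> 1" and h: "h \<in> L2f (marg (Suc n))"
  shows "corr (Suc n) h (\<lambda>x. x ^ m) = (\<integral>x. h x * poly (corr_poly n m) x \<partial>marg (Suc n))"
proof -
  have n1: "Suc n \<ge> 1" by simp
  have n2: "Suc n \<ge> 2" and i1: "1 \<in> {1..n}" using n by auto
  have [measurable]: "h \<in> borel_measurable borel" using h by (rule L2f_marg_borel)
  have [measurable]: "poly p \<in> borel_measurable borel" for p :: "real poly"
    by (intro borel_measurable_continuous_onI) (auto intro!: continuous_intros)
  have "integrable (usph (Suc n)) (\<lambda>v. h (v (Suc n)) * v 1 ^ m)"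
    using L2f_mult[OF L2f_usph_ends(1)[OF n2 h] L2f_usph_ends(2)[OF n2 pow_L2f_marg, of m]] by simp
  from usph_slices(3)[OF n this]
  have "corr (Suc n) h (\<lambda>x. x ^ m) = (\<integral>x. \<integral>w. h x * (slice_factor n x * w 1) ^ m \<partial>usph n \<partial>marg (Suc n))"
    using n by (simp add: corr_def glue_nth)
  also have "\<dots> = (\<integral>x. h x * (slice_factor n x ^ m * (\<integral>y. y ^ m \<partial>marg n)) \<partial>marg (Suc n))"
    using usph_coordinate(1)[OF i1, of "\<lambda>y. y ^ m"] by (simp add: power_mult_distrib)
  also have "\<dots> = (\<integral>x. h x * poly (corr_poly n m) x \<partial>marg (Suc n))"
  proof (rule integral_cong_AE)
    show "AE x in marg (Suc n). h x * (slice_factor n x ^ m * (\<integral>y. y ^ m \<partial>marg n)) = h x * poly (corr_poly n m) x"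
      using AE_marg_bound[OF n1]
    proof eventually_elim
      case (elim x)
      show ?case
      proof (cases "even m")
        case True
        then obtain k where k: "m = 2 * k" by blast
        have "slice_factor n x ^ m = ((real (Suc n) - x\<^sup>2) / real n) ^ k"
          using elim n by (simp add: k power_mult slice_factor_sq)
        then show ?thesis
          by (simp add: corr_poly_def k power_divide poly_power power2_eq_square)
      qed (simp add: marg_moment_odd[OF n] corr_poly_def)
    qed
  qed measurable
  finally show ?thesis .
qed

lemma integral_L2_add_sq:
  assumes "f \<in> L2f M" "g \<in> L2f M"
  shows "(\<integral>x. (f x + g x)\<^sup>2 \<partial>M) = (\<integral>x. (f x)\<^sup>2 \<partial>M) + 2 * (\<integral>x. f x * g x \<partial>M) + (\<integral>x. (g x)\<^sup>2 \<partial>M)"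
  using L2f_sq[OF assms(1)] L2f_sq[OF assms(2)] L2f_mult[OF assms] by (simp add: power2_sum mult.assoc)

text \<open>The constraint functions 1 and x^2 span the part with the eigenvalues 1 and -1/n. In
  degree below three and orthogonal to both, the form vanishes: the operator kills x and maps 1 and
  x^2 into their own span.\<close>

lemma corr_poly_bound_perp:
  assumes n: "n \<ge> 2" and p: "(\<integral>x. poly p x \<partial>marg (Suc n)) = 0" "(\<integral>x. poly p x * x\<^sup>2 \<partial>marg (Suc n)) = 0"
  shows "\<bar>corr (Suc n) (poly p) (poly p)\<bar> \<le> 3 / (real n * (real n + 2)) * (\<integral>x. (poly p x)\<^sup>2 \<partial>marg (Suc n))"
proof -
  have N: "Suc n \<ge> 2" "Suc n \<ge> 1" "n \<ge> 1" using n by auto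
  note L = poly_L2f_marg[OF N(2)]
  define ip where "ip p q = (\<integral>x. poly p x * poly q x \<partial>marg (Suc n))" for p q
  define B where "B p q = corr (Suc n) (poly p) (poly q)" for p q
  interpret triangular_form ip B "corr_poly n"
  proof
    fix p q s a m
    show "ip (p + q) s = ip p s + ip q s"
      by (simp add: ip_def distrib_right L2f_mult[OF L L])
    show "ip (smult a p) s = a * ip p s" by (simp add: ip_def mult.assoc)
    show "ip p q = ip q p" by (simp add: ip_def mult.commute)
    show "ip p p \<ge> 0" by (simp add: ip_def)
    show "B (p + q) s = B p s + B q s"
    proof -
      have "poly (p + q) = (\<lambda>x. poly p x + poly q x)" by (simp add: fun_eq_iff)
      then show ?thesis using corr_add_left[OF N(1) L L L, of p q s] by (simp add: B_def)
    qed
    show "B (smult a p) s = a * B p s"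
    proof -
      have "poly (smult a p) = (\<lambda>x. a * poly p x)" by (simp add: fun_eq_iff)
      then show ?thesis using corr_cmult_left[of "Suc n" a "poly p"] by (simp add: B_def)
    qed
    show "B p q = B q p"
      unfolding B_def by (rule corr_sym[OF N(1) L2f_marg_borel[OF L] L2f_marg_borel[OF L]])
    show "B p (monom 1 m) = ip p (corr_poly n m)"
    proof -
      have "poly (monom 1 m) = (\<lambda>x::real. x ^ m)" by (simp add: fun_eq_iff poly_monom)
      then show ?thesis using corr_monomial[OF N(3) L, of p m] by (simp add: B_def ip_def)
    qed
    show "lowdeg (Suc m) (corr_poly n m)" by (rule lowdeg_corr_poly)
  qed
  have c: "0 \<le> 3 / (real n * (real n + 2))" by simp
  have "\<bar>B p p\<bar> \<le> 3 / (real n * (real n + 2)) * ip p p"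
  proof (rule form_bound[where S="{[:1:], monom 1 2}" and ?d0.0=3])
    show "lowdeg 3 s" if "s \<in> {[:1:], monom 1 2}" for s
      using that by (auto simp: lowdeg_def coeff_pCons split: nat.splits)
    show "\<bar>coeff (corr_poly n m) m\<bar> \<le> 3 / (real n * (real n + 2))" if "m \<ge> 3" for m
      by (rule coeff_corr_poly_bound[OF n that])
    show "ip p s = 0" if "s \<in> {[:1:], monom 1 2}" for s
      using that p by (auto simp: ip_def poly_monom)
    fix q assume q: "lowdeg 3 q" and orth: "\<And>s. s \<in> {[:1:], monom 1 2} \<Longrightarrow> ip q s = 0"
    have o1: "ip q [:1:] = 0" and o2: "ip q (monom 1 2) = 0" using orth by auto
    have T0: "ip q (corr_poly n 0) = 0"
    proof -
      have "corr_poly n 0 = smult (integral\<^sup>L (marg n) (\<lambda>x. 1)) [:1:]"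
        by (simp add: corr_poly_def one_pCons)
      then show ?thesis using o1 by (simp only: ip_smult_right)
    qed
    have T1: "ip q (corr_poly n 1) = 0" by (simp add: corr_poly_def ip_zero)
    have T2: "ip q (corr_poly n 2) = 0"
    proof -
      obtain c where "corr_poly n 2 = smult c [:real (Suc n), 0, -1:]" by (auto simp: corr_poly_def)
      moreover have "[:real (Suc n), 0, -1:] = smult (real (Suc n)) [:1:] - monom 1 2"
        by (simp add: monom_altdef numeral_2_eq_2)
      ultimately have "ip q (corr_poly n 2) = c * (real (Suc n) * ip q [:1:] - ip q (monom 1 2))"
        by (simp only: ip_smult_right ip_diff_right)
      then show ?thesis by (simp only: o1 o2) simp
    qed
    have qe: "q = smult (coeff q 0) (monom 1 0) + smult (coeff q 1) (monom 1 1) + smult (coeff q 2) (monom 1 2)"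
    proof (rule poly_eqI)
      fix i :: nat
      consider "i = 0" | "i = 1" | "i = 2" | "i \<ge> 3" by linarith
      then show "coeff q i = coeff (smult (coeff q 0) (monom 1 0) + smult (coeff q 1) (monom 1 1) + smult (coeff q 2) (monom 1 2)) i"
        using q unfolding coeff_add coeff_smult coeff_monom by cases (auto simp: lowdeg_def)
    qed
    have "B q q = 0"
      by (subst (2) qe) (simp only: B_add_right B_smult_right B_monom T0 T1 T2)
    then show "\<bar>B q q\<bar> \<le> 3 / (real n * (real n + 2)) * ip q q"
      using c ip_nonneg[of q] by simp
  qed
  then show ?thesis by (simp add: B_def ip_def power2_eq_square)
qed

lemma quadratic_marg:
  assumes N: "N \<ge> 2"
  shows "(\<lambda>x. x\<^sup>2 - 1) \<in> L2f (marg N)" "(\<integral>x. x\<^sup>2 - 1 \<partial>marg N) = 0" "(\<integral>x. (x\<^sup>2 - 1)\<^sup>2 \<partial>marg N) > 0"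
proof -
  have N1: "N \<ge> 1" using N by simp
  interpret M: prob_space "marg N" by (rule prob_space_marg[OF N1])
  have i: "integrable (marg N) (\<lambda>x. x ^ m)" for m
    using L2f_integrable[OF finite_measure_marg[OF N1] pow_L2f_marg[OF N1]] .
  show "(\<lambda>x. x\<^sup>2 - 1) \<in> L2f (marg N)"
    by (intro continuous_L2f_marg N1) (auto intro!: continuous_intros)
  show "(\<integral>x. x\<^sup>2 - 1 \<partial>marg N) = 0"
    using marg_moment2[OF N1] i[of 2] by (simp add: M.prob_space[simplified])
  have "(\<integral>x. (x\<^sup>2 - 1)\<^sup>2 \<partial>marg N) = (\<integral>x. x ^ 4 - 2 * x\<^sup>2 + 1 \<partial>marg N)"
    by (intro Bochner_Integration.integral_cong) (auto simp: power2_eq_square power4_eq_xxxx algebra_simps)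
  also have "\<dots> = 3 * real N / (real N + 2) - 1"
    using marg_moment2[OF N1] marg_moment4[OF N] i[of 2] i[of 4] by (simp add: M.prob_space[simplified])
  also have "\<dots> > 0" using N by (simp add: field_simps)
  finally show "(\<integral>x. (x\<^sup>2 - 1)\<^sup>2 \<partial>marg N) > 0" .
qed

text \<open>Passage from polynomials to L2 by density. An approximating polynomial does not inherit
  the two orthogonality relations, so it is corrected by a combination of 1 and x^2 - 1, which does
  not worsen the approximation. The parameter t measures the error and weights the AM-GM estimates;
  finally t tends to 0.\<close>

lemma corr_bound_perp:
  assumes n: "n \<ge> 2" and h: "h \<in> L2f (marg (Suc n))"
    and h0: "(\<integral>x. h x \<partial>marg (Suc n)) = 0" and h2: "(\<integral>x. h x * x\<^sup>2 \<partial>marg (Suc n)) = 0"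
  shows "\<bar>corr (Suc n) h h\<bar> \<le> 3 / (real n * (real n + 2)) * (\<integral>x. (h x)\<^sup>2 \<partial>marg (Suc n))"
proof -
  let ?M = "marg (Suc n)"
  have N: "Suc n \<ge> 2" "Suc n \<ge> 1" "n \<ge> 1" using n by auto
  interpret M: prob_space ?M by (rule prob_space_marg[OF N(2)])
  note fin = finite_measure_marg[OF N(2)]
  note PL = poly_L2f_marg[OF N(2)]
  define c where "c = 3 / (real n * (real n + 2))"
  have c: "0 \<le> c" "c \<le> 1"
  proof -
    have "2 * 4 \<le> real n * (real n + 2)" using n by (intro mult_mono) auto
    then show "0 \<le> c" "c \<le> 1" by (auto simp: c_def field_simps)
  qed
  define H where "H = (\<integral>x. (h x)\<^sup>2 \<partial>?M)"
  have H: "H \<ge> 0" by (simp add: H_def)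
  define y where "y = (\<lambda>x::real. x\<^sup>2 - 1)"
  have yp: "y = poly [:-1, 0, 1:]" by (auto simp: y_def power2_eq_square fun_eq_iff)
  define \<kappa> where "\<kappa> = (\<integral>x. (y x)\<^sup>2 \<partial>?M)"
  have yL: "y \<in> L2f ?M" and y0: "(\<integral>x. y x \<partial>?M) = 0" and \<kappa>: "\<kappa> > 0"
    using quadratic_marg[OF N(1)] by (simp_all add: y_def \<kappa>_def)
  have main: "\<bar>corr (Suc n) h h\<bar> \<le> c * H + 4 * (t * H + t + t\<^sup>2)" if t: "t > 0" for t
  proof -
    obtain p where p: "(\<integral>x. (h x - poly p x)\<^sup>2 \<partial>?M) < t\<^sup>2"
    proof (rule exE[OF poly_dense_L2[OF fin sets_marg _ h, of "sqrt (real (Suc n))" "t\<^sup>2"]])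
      show "AE x in ?M. \<bar>x\<bar> \<le> sqrt (real (Suc n))"
        using AE_marg_bound[OF N(2)] by eventually_elim (rule abs_le_of_sq)
    qed (use t in auto)
    define g where "g = (\<lambda>x. h x - poly p x)"
    have gL: "g \<in> L2f ?M" unfolding g_def by (intro L2f_diff h PL)
    \<comment> \<open>With a and b the error g loses its components along the orthogonal functions 1
      and y. Thus \<delta> = g + r is an orthogonal projection of g and has no larger norm, and h -
      \<delta> is a polynomial that satisfies the constraints exactly.\<close>
    define a where "a = - (\<integral>x. g x \<partial>?M)"
    define b where "b = - (\<integral>x. g x * y x \<partial>?M) / \<kappa>"
    define r where "r = (\<lambda>x. a + b * y x)"
    have rL: "r \<in> L2f ?M" unfolding r_def by (intro L2f_add L2f_const[OF fin] L2f_cmult yL)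
    define \<delta> where "\<delta> = (\<lambda>x. g x + r x)"
    have \<delta>L: "\<delta> \<in> L2f ?M" unfolding \<delta>_def by (intro L2f_add gL rL)
    define p' where "p' = p - [:a:] - smult b [:-1, 0, 1:]"
    have hp: "h x = poly p' x + \<delta> x" for x
      by (simp add: p'_def \<delta>_def r_def g_def yp algebra_simps)
    have ig: "integrable ?M g" "integrable ?M y" "integrable ?M (\<lambda>x. g x * y x)" "integrable ?M (\<lambda>x. (y x)\<^sup>2)" "integrable ?M (\<lambda>x. h x * y x)"
      "integrable ?M h" "integrable ?M (\<lambda>x. h x * x\<^sup>2)"
      using L2f_integrable[OF fin] gL yL h L2f_mult L2f_sq pow_L2f_marg[OF N(2), of 2] by auto
    have gr: "(\<integral>x. g x * r x \<partial>?M) = - a\<^sup>2 - b\<^sup>2 * \<kappa>"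
    proof -
      have "(\<integral>x. g x * r x \<partial>?M) = (\<integral>x. a * g x + b * (g x * y x) \<partial>?M)"
        by (intro Bochner_Integration.integral_cong) (auto simp: r_def algebra_simps)
      also have "\<dots> = a * (\<integral>x. g x \<partial>?M) + b * (\<integral>x. g x * y x \<partial>?M)"
        using ig by simp
      also have "(\<integral>x. g x * y x \<partial>?M) = - b * \<kappa>" using \<kappa> by (simp add: b_def)
      also have "(\<integral>x. g x \<partial>?M) = - a" by (simp add: a_def)
      finally show ?thesis by (simp add: power2_eq_square algebra_simps)
    qed
    have rr: "(\<integral>x. (r x)\<^sup>2 \<partial>?M) = a\<^sup>2 + b\<^sup>2 * \<kappa>"
    proof -
      have "(\<integral>x. (r x)\<^sup>2 \<partial>?M) = (\<integral>x. a\<^sup>2 + 2 * a * b * y x + b\<^sup>2 * (y x)\<^sup>2 \<partial>?M)"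
        by (intro Bochner_Integration.integral_cong) (auto simp: r_def power2_eq_square algebra_simps)
      also have "\<dots> = a\<^sup>2 + b\<^sup>2 * \<kappa>"
        using ig y0 by (simp add: \<kappa>_def M.prob_space[simplified])
      finally show ?thesis .
    qed
    define D where "D = (\<integral>x. (\<delta> x)\<^sup>2 \<partial>?M)"
    have D: "0 \<le> D" "D \<le> t\<^sup>2"
    proof -
      show "0 \<le> D" by (simp add: D_def)
      have "D = (\<integral>x. (g x)\<^sup>2 \<partial>?M) - a\<^sup>2 - b\<^sup>2 * \<kappa>"
        unfolding D_def \<delta>_def integral_L2_add_sq[OF gL rL] gr rr by simp
      moreover have "b\<^sup>2 * \<kappa> \<ge> 0" using \<kappa> by simp
      moreover have "(\<integral>x. (g x)\<^sup>2 \<partial>?M) < t\<^sup>2" using p by (simp add: g_def)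
      ultimately show "D \<le> t\<^sup>2" using zero_le_power2[of a] by linarith
    qed
    have ir: "integrable ?M r" "integrable ?M (\<lambda>x. r x * y x)" using L2f_integrable[OF fin rL] L2f_mult[OF rL yL] .
    have iy2: "(\<integral>x. r x * y x \<partial>?M) = b * \<kappa>"
    proof -
      have "(\<integral>x. r x * y x \<partial>?M) = (\<integral>x. a * y x + b * (y x)\<^sup>2 \<partial>?M)"
        by (intro Bochner_Integration.integral_cong) (auto simp: r_def power2_eq_square algebra_simps)
      then show ?thesis using ig y0 by (simp add: \<kappa>_def)
    qed
    have hy: "(\<integral>x. h x * y x \<partial>?M) = 0"
      using h0 h2 ig by (simp add: y_def right_diff_distrib)
    have p'0: "(\<integral>x. poly p' x \<partial>?M) = 0"
    proof -
      have "(\<integral>x. poly p' x \<partial>?M) = (\<integral>x. h x - g x - r x \<partial>?M)"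
        using hp by (intro Bochner_Integration.integral_cong) (auto simp: \<delta>_def)
      also have "\<dots> = 0 - (\<integral>x. g x \<partial>?M) - (\<integral>x. r x \<partial>?M)"
        using ig ir h0 by simp
      also have "(\<integral>x. r x \<partial>?M) = a" unfolding r_def using ig y0 by (simp add: M.prob_space[simplified])
      finally show ?thesis by (simp add: a_def)
    qed
    have p'y: "(\<integral>x. poly p' x * y x \<partial>?M) = 0"
    proof -
      have "(\<integral>x. poly p' x * y x \<partial>?M) = (\<integral>x. h x * y x - g x * y x - r x * y x \<partial>?M)"
        using hp by (intro Bochner_Integration.integral_cong) (auto simp: \<delta>_def algebra_simps)
      also have "\<dots> = 0 - (\<integral>x. g x * y x \<partial>?M) - b * \<kappa>"
        using ig ir hy iy2 by simp
      also have "(\<integral>x. g x * y x \<partial>?M) = - b * \<kappa>" using \<kappa> by (simp add: b_def)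
      finally show ?thesis by simp
    qed
    have p'2: "(\<integral>x. poly p' x * x\<^sup>2 \<partial>?M) = 0"
    proof -
      have "(\<integral>x. poly p' x * x\<^sup>2 \<partial>?M) = (\<integral>x. poly p' x * y x + poly p' x \<partial>?M)"
        by (intro Bochner_Integration.integral_cong) (auto simp: y_def algebra_simps)
      also have "\<dots> = 0" using p'0 p'y L2f_mult[OF PL yL] L2f_integrable[OF fin PL] by simp
      finally show ?thesis .
    qed
    have P: "\<bar>corr (Suc n) (poly p') (poly p')\<bar> \<le> c * (\<integral>x. (poly p' x)\<^sup>2 \<partial>?M)"
      unfolding c_def by (rule corr_poly_bound_perp[OF n p'0 p'2])
    have pe: "poly p' = (\<lambda>x. h x - \<delta> x)" using hp by (auto simp: fun_eq_iff)
    have C: "corr (Suc n) h h = corr (Suc n) (poly p') (poly p') + 2 * corr (Suc n) h \<delta> - corr (Suc n) \<delta> \<delta>"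
    proof -
      have "corr (Suc n) (poly p') (poly p') = corr (Suc n) h (poly p') - corr (Suc n) \<delta> (poly p')"
        using corr_diff_left[OF N(1) h \<delta>L PL[of p']] pe by simp
      moreover have "corr (Suc n) k (poly p') = corr (Suc n) h k - corr (Suc n) \<delta> k" if k: "k \<in> L2f ?M" for k
        using corr_diff_left[OF N(1) h \<delta>L k] corr_sym[OF N(1) L2f_marg_borel[OF k] L2f_marg_borel[OF PL[of p']]]
        unfolding pe by simp
      moreover have "corr (Suc n) \<delta> h = corr (Suc n) h \<delta>"
        by (rule corr_sym[OF N(1) L2f_marg_borel[OF \<delta>L] L2f_marg_borel[OF h]])
      ultimately show ?thesis using h \<delta>L by simp
    qed
    have I: "(\<integral>x. (poly p' x)\<^sup>2 \<partial>?M) = H - 2 * (\<integral>x. h x * \<delta> x \<partial>?M) + D"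
    proof -
      have "(\<integral>x. (poly p' x)\<^sup>2 \<partial>?M) = (\<integral>x. (h x)\<^sup>2 - 2 * (h x * \<delta> x) + (\<delta> x)\<^sup>2 \<partial>?M)"
        using hp by (intro Bochner_Integration.integral_cong) (auto simp: power2_eq_square algebra_simps)
      then show ?thesis using L2f_sq[OF h] L2f_sq[OF \<delta>L] L2f_mult[OF h \<delta>L] by (simp add: H_def D_def)
    qed
    have X1: "2 * \<bar>corr (Suc n) h \<delta>\<bar> \<le> t * H + D / t"
      using corr_am_gm[OF N(1) h \<delta>L t] by (simp add: H_def D_def)
    have X2: "\<bar>corr (Suc n) \<delta> \<delta>\<bar> \<le> D"
      using corr_am_gm[OF N(1) \<delta>L \<delta>L, of 1] by (simp add: D_def)
    have X3: "2 * \<bar>\<integral>x. h x * \<delta> x \<partial>?M\<bar> \<le> t * H + D / t"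
      using L2_am_gm[OF h \<delta>L t] by (simp add: H_def D_def)
    have Dt: "D / t \<le> t" using D t by (simp add: field_simps power2_eq_square)
    have "c * (\<integral>x. (poly p' x)\<^sup>2 \<partial>?M) \<le> c * (H + (t * H + t) + t\<^sup>2)"
      unfolding I using X3 Dt D c(1) by (intro mult_left_mono) linarith+
    also have "\<dots> \<le> c * H + (t * H + t) + t\<^sup>2"
    proof -
      have "c * ((t * H + t) + t\<^sup>2) \<le> 1 * ((t * H + t) + t\<^sup>2)"
        using c t H by (intro mult_right_mono) auto
      then show ?thesis by (simp add: algebra_simps)
    qed
    finally have "c * (\<integral>x. (poly p' x)\<^sup>2 \<partial>?M) \<le> c * H + (t * H + t) + t\<^sup>2" .
    moreover have "t * H \<ge> 0" "t\<^sup>2 \<ge> 0" using t H by auto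
    ultimately show ?thesis using C P X1 X2 Dt D t unfolding distrib_left by linarith
  qed
  have "((\<lambda>t. c * H + 4 * (t * H + t + t\<^sup>2)) \<longlongrightarrow> c * H + 4 * (0 * H + 0 + 0\<^sup>2)) (at_right 0)"
    by (intro tendsto_intros)
  moreover have "\<forall>\<^sub>F t in at_right 0. \<bar>corr (Suc n) h h\<bar> \<le> c * H + 4 * (t * H + t + t\<^sup>2)"
    using main by (auto simp: eventually_at_filter)
  ultimately have "\<bar>corr (Suc n) h h\<bar> \<le> c * H + 4 * (0 * H + 0 + 0\<^sup>2)"
    by (rule tendsto_lowerbound) simp
  then show ?thesis by (simp add: c_def H_def)
qed

text \<open>So x^2 - 1 is an eigenfunction with eigenvalue -1/n: given the last coordinate x, the
  other n coordinates are exchangeable and their values of this function add up to -(x^2 -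
  1).\<close>

lemma corr_quadratic:
  assumes n: "n \<ge> 1" and h: "h \<in> L2f (marg (Suc n))"
  shows "corr (Suc n) h (\<lambda>x. x\<^sup>2 - 1) = - (\<integral>x. h x * (x\<^sup>2 - 1) \<partial>marg (Suc n)) / real n"
proof -
  have N: "Suc n \<ge> 2" "Suc n \<ge> 1" using n by auto
  have pL: "(\<lambda>x. x ^ m) \<in> L2f (marg (Suc n))" for m by (rule pow_L2f_marg[OF N(2)])
  note hb = L2f_marg_borel[OF h]
  have i: "integrable (marg (Suc n)) h" "integrable (marg (Suc n)) (\<lambda>x. h x * x\<^sup>2)"
    using L2f_integrable[OF finite_measure_marg[OF N(2)] h] L2f_mult[OF h pL] by auto
  have "corr (Suc n) h (\<lambda>x. x\<^sup>2 - 1) = corr (Suc n) (\<lambda>x. x\<^sup>2 - x ^ 0) h"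
    using corr_sym[OF N(1) hb, of "\<lambda>x. x\<^sup>2 - 1"] by simp
  also have "\<dots> = corr (Suc n) h (\<lambda>x. x\<^sup>2) - corr (Suc n) h (\<lambda>x. x ^ 0)"
    using corr_diff_left[OF N(1) pL pL h, of 2 0] corr_sym[OF N(1) hb L2f_marg_borel[OF pL], of 2]
      corr_sym[OF N(1) hb L2f_marg_borel[OF pL], of 0] by simp
  also have "\<dots> = (\<integral>x. h x * poly (corr_poly n 2) x \<partial>marg (Suc n)) - (\<integral>x. h x \<partial>marg (Suc n))"
    using corr_monomial[OF n h, of 0] corr_monomial[OF n h, of 2] prob_space.prob_space[OF prob_space_marg[OF n]]
    by (simp add: corr_poly_def)
  also have "(\<integral>x. h x * poly (corr_poly n 2) x \<partial>marg (Suc n)) = (\<integral>x. h x * (real (Suc n) / real n) - h x * x\<^sup>2 / real n \<partial>marg (Suc n))"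
    using marg_moment2[OF n]
    by (intro Bochner_Integration.integral_cong) (auto simp: corr_poly_def power2_eq_square algebra_simps add_divide_distrib diff_divide_distrib)
  also have "\<dots> = (\<integral>x. h x \<partial>marg (Suc n)) * (real (Suc n) / real n) - (\<integral>x. h x * x\<^sup>2 \<partial>marg (Suc n)) / real n"
    using i by simp
  also have "\<dots> - (\<integral>x. h x \<partial>marg (Suc n)) = - ((\<integral>x. h x * x\<^sup>2 \<partial>marg (Suc n)) - (\<integral>x. h x \<partial>marg (Suc n))) / real n"
    using n by (simp add: field_simps)
  also have "(\<integral>x. h x * x\<^sup>2 \<partial>marg (Suc n)) - (\<integral>x. h x \<partial>marg (Suc n)) = (\<integral>x. h x * (x\<^sup>2 - 1) \<partial>marg (Suc n))"
    using i by (simp add: right_diff_distrib)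
  finally show ?thesis .
qed

text \<open>Subtracting a multiple of \<open>x\<^sup>2 - 1\<close> does not change \<open>\<Sum>j. h (v j)\<close> on the sphere.\<close>

lemma quadratic_part:
  assumes N: "N \<ge> 2" and h: "h \<in> L2f (marg N)" and h0: "(\<integral>x. h x \<partial>marg N) = 0"
  obtains a where "(\<lambda>x. h x - a * (x\<^sup>2 - 1)) \<in> L2f (marg N)"
    "(\<integral>x. h x - a * (x\<^sup>2 - 1) \<partial>marg N) = 0"
    "(\<integral>x. (h x - a * (x\<^sup>2 - 1)) * (x\<^sup>2 - 1) \<partial>marg N) = 0"
    "(\<integral>x. (h x - a * (x\<^sup>2 - 1)) * x\<^sup>2 \<partial>marg N) = 0"
    "(\<integral>x. (h x - a * (x\<^sup>2 - 1))\<^sup>2 \<partial>marg N) \<le> (\<integral>x. (h x)\<^sup>2 \<partial>marg N)"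
proof
  let ?M = "marg N"
  note y = quadratic_marg[OF N]
  have fin: "finite_measure ?M" using N by (intro finite_measure_marg) auto
  define k where "k = (\<integral>x. (x\<^sup>2 - 1)\<^sup>2 \<partial>?M)"
  have k: "k > 0" using y by (simp add: k_def)
  define a where "a = (\<integral>x. h x * (x\<^sup>2 - 1) \<partial>?M) / k"
  let ?g = "\<lambda>x. h x - a * (x\<^sup>2 - 1)"
  show gL: "?g \<in> L2f ?M" by (intro L2f_diff L2f_cmult h y)
  have i: "integrable ?M h" "integrable ?M (\<lambda>x. x\<^sup>2 - 1)" "integrable ?M (\<lambda>x. h x * (x\<^sup>2 - 1))"
     "integrable ?M (\<lambda>x. (x\<^sup>2 - 1)\<^sup>2)" "integrable ?M ?g" "integrable ?M (\<lambda>x. ?g x * (x\<^sup>2 - 1))" "integrable ?M (\<lambda>x. (?g x)\<^sup>2)"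
    using h y L2f_integrable[OF fin] L2f_mult L2f_sq gL by blast+
  have "(\<integral>x. ?g x \<partial>?M) = (\<integral>x. h x \<partial>?M) - a * (\<integral>x. x\<^sup>2 - 1 \<partial>?M)"
    by (subst Bochner_Integration.integral_diff) (use i in simp_all)
  then show g0: "(\<integral>x. ?g x \<partial>?M) = 0" using h0 y by simp
  have "(\<integral>x. ?g x * (x\<^sup>2 - 1) \<partial>?M) = (\<integral>x. h x * (x\<^sup>2 - 1) - a * (x\<^sup>2 - 1)\<^sup>2 \<partial>?M)"
    by (intro Bochner_Integration.integral_cong) (auto simp: power2_eq_square algebra_simps)
  also have "\<dots> = (\<integral>x. h x * (x\<^sup>2 - 1) \<partial>?M) - a * k"
    by (subst Bochner_Integration.integral_diff) (use i in \<open>simp_all add: k_def\<close>)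
  also have "\<dots> = 0" using k by (simp add: a_def)
  finally show gy: "(\<integral>x. ?g x * (x\<^sup>2 - 1) \<partial>?M) = 0" .
  have "(\<integral>x. ?g x * x\<^sup>2 \<partial>?M) = (\<integral>x. ?g x * (x\<^sup>2 - 1) + ?g x \<partial>?M)"
    by (intro Bochner_Integration.integral_cong) (auto simp: algebra_simps)
  also have "\<dots> = 0" using i g0 gy by (subst Bochner_Integration.integral_add) simp_all
  finally show "(\<integral>x. ?g x * x\<^sup>2 \<partial>?M) = 0" .
  have "(\<integral>x. (h x)\<^sup>2 \<partial>?M) = (\<integral>x. (?g x + a * (x\<^sup>2 - 1))\<^sup>2 \<partial>?M)" by simp
  also have "\<dots> = (\<integral>x. (?g x)\<^sup>2 \<partial>?M) + 2 * (\<integral>x. a * (?g x * (x\<^sup>2 - 1)) \<partial>?M) + (\<integral>x. (a * (x\<^sup>2 - 1))\<^sup>2 \<partial>?M)"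
    by (subst integral_L2_add_sq[OF gL L2f_cmult[OF y(1)]]) (simp add: algebra_simps)
  also have "\<dots> = (\<integral>x. (?g x)\<^sup>2 \<partial>?M) + (\<integral>x. (a * (x\<^sup>2 - 1))\<^sup>2 \<partial>?M)"
    using gy by (subst integral_mult_right_zero) simp
  finally show "(\<integral>x. (?g x)\<^sup>2 \<partial>?M) \<le> (\<integral>x. (h x)\<^sup>2 \<partial>?M)" by simp
qed

text \<open>Without orthogonality to x^2 the upper bound survives: after splitting off the multiple
  of x^2 - 1 the cross terms vanish because it is an eigenfunction, and its own contribution is
  nonpositive because the eigenvalue is negative. The corresponding lower bound fails.\<close>

lemma corr_bound:
  assumes n: "n \<ge> 2" and h: "h \<in> L2f (marg (Suc n))" and h0: "(\<integral>x. h x \<partial>marg (Suc n)) = 0"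
  shows "corr (Suc n) h h \<le> 3 / (real n * (real n + 2)) * (\<integral>x. (h x)\<^sup>2 \<partial>marg (Suc n))"
proof -
  have N: "Suc n \<ge> 2" "n \<ge> 1" using n by auto
  let ?y = "\<lambda>x::real. x\<^sup>2 - 1"
  obtain a where g: "(\<lambda>x. h x - a * ?y x) \<in> L2f (marg (Suc n))"
    "(\<integral>x. (h x - a * ?y x) \<partial>marg (Suc n)) = 0"
    "(\<integral>x. (h x - a * ?y x) * ?y x \<partial>marg (Suc n)) = 0"
    "(\<integral>x. (h x - a * ?y x) * x\<^sup>2 \<partial>marg (Suc n)) = 0"
    "(\<integral>x. ((h x - a * ?y x))\<^sup>2 \<partial>marg (Suc n)) \<le> (\<integral>x. (h x)\<^sup>2 \<partial>marg (Suc n))"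
    using quadratic_part[OF N(1) h h0] by blast
  let ?g = "\<lambda>x. h x - a * ?y x"
  note yL = quadratic_marg(1)[OF N(1)]
  note ayL = L2f_cmult[OF yL, of a]
  note gb = L2f_marg_borel[OF g(1)] and yb = L2f_marg_borel[OF yL] and hb = L2f_marg_borel[OF h]
  have gy: "corr (Suc n) ?g ?y = 0" using corr_quadratic[OF N(2) g(1)] g(3) by simp
  have yy: "corr (Suc n) ?y ?y \<le> 0"
    using corr_quadratic[OF N(2) yL] by (simp flip: power2_eq_square)
  have "corr (Suc n) h h = corr (Suc n) (\<lambda>x. ?g x + a * ?y x) h" by simp
  also have "\<dots> = corr (Suc n) ?g h + a * corr (Suc n) ?y h"
    by (subst corr_add_left[OF N(1) g(1) ayL h]) (simp only: corr_cmult_left)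
  also have "corr (Suc n) ?g h = corr (Suc n) (\<lambda>x. ?g x + a * ?y x) ?g"
    using corr_sym[OF N(1) gb hb] by simp
  also have "\<dots> = corr (Suc n) ?g ?g + a * corr (Suc n) ?y ?g"
    by (subst corr_add_left[OF N(1) g(1) ayL g(1)]) (simp only: corr_cmult_left)
  also have "corr (Suc n) ?y ?g = 0" using corr_sym[OF N(1) yb gb] gy by simp
  also have "corr (Suc n) ?y h = corr (Suc n) (\<lambda>x. ?g x + a * ?y x) ?y"
    using corr_sym[OF N(1) yb hb] by simp
  also have "\<dots> = corr (Suc n) ?g ?y + a * corr (Suc n) ?y ?y"
    by (subst corr_add_left[OF N(1) g(1) ayL yL]) (simp only: corr_cmult_left)
  also have "corr (Suc n) ?g ?g + a * 0 + a * (corr (Suc n) ?g ?y + a * corr (Suc n) ?y ?y)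
      = corr (Suc n) ?g ?g + a\<^sup>2 * corr (Suc n) ?y ?y"
    using gy by (simp add: power2_eq_square)
  also have "\<dots> \<le> corr (Suc n) ?g ?g"
    using yy by (simp add: mult_nonneg_nonpos)
  also have "\<dots> \<le> 3 / (real n * (real n + 2)) * (\<integral>x. (?g x)\<^sup>2 \<partial>marg (Suc n))"
    using corr_bound_perp[OF n g(1,2,4)] by linarith
  also have "\<dots> \<le> 3 / (real n * (real n + 2)) * (\<integral>x. (h x)\<^sup>2 \<partial>marg (Suc n))"
    by (intro mult_left_mono g(5)) simp
  finally show ?thesis .
qed

section \<open>Norm of a sum over coordinates compared with the norm of its summand\<close>

lemma integral_sum_sq:
  assumes N: "N \<ge> 2" and h: "h \<in> L2f (marg N)"
  shows "(\<integral>v. (\<Sum>j=1..N. h (v j))\<^sup>2 \<partial>usph N) = real N * (\<integral>x. (h x)\<^sup>2 \<partial>marg N) + real N * (real N - 1) * corr N h h"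
proof -
  define H where "H = (\<integral>x. (h x)\<^sup>2 \<partial>marg N)"
  have i: "integrable (usph N) (\<lambda>v. h (v i) * h (v j))" if "i \<in> {1..N}" "j \<in> {1..N}" for i j
    by (intro L2f_mult L2f_coordinate h that)
  have [measurable]: "h \<in> borel_measurable borel" by (rule L2f_marg_borel[OF h])
  have e: "(\<integral>v. h (v i) * h (v j) \<partial>usph N) = (if i = j then H else corr N h h)" if "i \<in> {1..N}" "j \<in> {1..N}" for i j
  proof (cases "i = j")
    case True
    then show ?thesis using L2f_coordinate(2)[OF that(1) h] by (simp add: H_def power2_eq_square)
  next
    case False
    have "(\<integral>v. h (v i) * h (v j) \<partial>usph N) = (\<integral>v. h (v N) * h (v 1) \<partial>usph N)"
      using N that False by (intro usph_pair(1)) auto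
    then show ?thesis using False by (simp add: corr_def)
  qed
  have "(\<integral>v. (\<Sum>j=1..N. h (v j))\<^sup>2 \<partial>usph N) = (\<integral>v. (\<Sum>i=1..N. \<Sum>j=1..N. h (v i) * h (v j)) \<partial>usph N)"
    by (simp add: power2_eq_square sum_product)
  also have "\<dots> = (\<Sum>i=1..N. \<Sum>j=1..N. \<integral>v. h (v i) * h (v j) \<partial>usph N)"
    by (subst Bochner_Integration.integral_sum, intro Bochner_Integration.integrable_sum i, assumption+)
       (intro sum.cong refl Bochner_Integration.integral_sum i)
  also have "\<dots> = (\<Sum>i=1..N. \<Sum>j=1..N. if i = j then H else corr N h h)"
    by (intro sum.cong refl e)
  also have "\<dots> = (\<Sum>i=1..N. (H - corr N h h) + real N * corr N h h)"
  proof (rule sum.cong[OF refl])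
    fix i assume i: "i \<in> {1..N}"
    have "(\<Sum>j=1..N. if i = j then H else corr N h h) = (\<Sum>j=1..N. (if i = j then H - corr N h h else 0) + corr N h h)"
      by (intro sum.cong) auto
    also have "\<dots> = (H - corr N h h) + real N * corr N h h"
      unfolding sum.distrib using i by simp
    finally show "(\<Sum>j=1..N. if i = j then H else corr N h h) = (H - corr N h h) + real N * corr N h h" .
  qed
  also have "\<dots> = real N * H + real N * (real N - 1) * corr N h h" by (simp add: algebra_simps)
  finally show ?thesis by (simp add: H_def)
qed

lemma sum_sq_upper:
  assumes N: "N \<ge> 3" and h: "h \<in> L2f (marg N)" and h0: "(\<integral>x. h x \<partial>marg N) = 0"
  shows "(\<integral>v. (\<Sum>j=1..N. h (v j))\<^sup>2 \<partial>usph N) \<le> real N * (real N + 4) / (real N + 1) * (\<integral>x. (h x)\<^sup>2 \<partial>marg N)"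
proof -
  define n where "n = N - 1"
  have n: "N = Suc n" "n \<ge> 2" using N by (auto simp: n_def)
  have r: "real N - 1 = real n" "real N + 1 = real n + 2" by (simp_all add: n)
  define H where "H = (\<integral>x. (h x)\<^sup>2 \<partial>marg N)"
  have "corr N h h \<le> 3 / ((real N - 1) * (real N + 1)) * H"
    using corr_bound[OF n(2), of h] h h0 unfolding r H_def by (simp add: n)
  then have "real N * (real N - 1) * corr N h h \<le> real N * (real N - 1) * (3 / ((real N - 1) * (real N + 1)) * H)"
    using N by (intro mult_left_mono) auto
  also have "\<dots> = 3 * real N / (real N + 1) * H"
    using N by (simp add: divide_simps)
  finally have "real N * H + real N * (real N - 1) * corr N h h \<le> real N * H + 3 * real N / (real N + 1) * H" by simp
  also have "\<dots> = real N * (real N + 4) / (real N + 1) * H"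
    using N by (simp add: divide_simps) (simp add: algebra_simps)
  finally show ?thesis using integral_sum_sq[OF _ h] N by (simp add: H_def)
qed

text \<open>Orthogonality to x^2 is essential, because x^2 - 1 has the sum zero on the sphere. The
  lemma recovers the size of a summand from its sum once this kernel is removed.\<close>

lemma sum_sq_lower:
  assumes N: "N \<ge> 3" and h: "h \<in> L2f (marg N)" and h0: "(\<integral>x. h x \<partial>marg N) = 0" "(\<integral>x. h x * x\<^sup>2 \<partial>marg N) = 0"
  shows "real N * (real N - 2) / (real N + 1) * (\<integral>x. (h x)\<^sup>2 \<partial>marg N) \<le> (\<integral>v. (\<Sum>j=1..N. h (v j))\<^sup>2 \<partial>usph N)"
proof -
  define n where "n = N - 1"
  have n: "N = Suc n" "n \<ge> 2" using N by (auto simp: n_def)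
  have r: "real N - 1 = real n" "real N + 1 = real n + 2" by (simp_all add: n)
  define H where "H = (\<integral>x. (h x)\<^sup>2 \<partial>marg N)"
  have "- (3 / ((real N - 1) * (real N + 1)) * H) \<le> corr N h h"
    using corr_bound_perp[OF n(2), of h] h h0 unfolding r H_def by (simp add: n abs_le_iff)
  then have "real N * (real N - 1) * (- (3 / ((real N - 1) * (real N + 1)) * H)) \<le> real N * (real N - 1) * corr N h h"
    using N by (intro mult_left_mono) auto
  moreover have "real N * (real N - 1) * (- (3 / ((real N - 1) * (real N + 1)) * H)) = - (3 * real N / (real N + 1) * H)"
    using N by (simp add: divide_simps)
  moreover have "real N * H - 3 * real N / (real N + 1) * H = real N * (real N - 2) / (real N + 1) * H"
    using N by (simp add: divide_simps) (simp add: algebra_simps)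
  ultimately show ?thesis using integral_sum_sq[OF _ h] N by (simp add: H_def)
qed

section \<open>Conditional variance on slices\<close>

definition slice_mean :: "nat \<Rightarrow> ((nat \<Rightarrow> real) \<Rightarrow> real) \<Rightarrow> real \<Rightarrow> real" where
  "slice_mean n f x = (\<integral>w. f (glue n x w) \<partial>usph n)"

text \<open>On a slice where the function is not square integrable the first integral defaults to
  zero and the value can be negative; therefore nonnegativity is claimed only almost
  everywhere.\<close>

definition slice_var :: "nat \<Rightarrow> ((nat \<Rightarrow> real) \<Rightarrow> real) \<Rightarrow> real \<Rightarrow> real" where
  "slice_var n f x = (\<integral>w. (f (glue n x w))\<^sup>2 \<partial>usph n) - (slice_mean n f x)\<^sup>2"

lemma glue_measurable1 [measurable]: "glue n x \<in> measurable (PB n) (PB (Suc n))"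
  unfolding glue_def
proof (rule measurable_fun_upd[where J="{1..n}"])
  show "{1..Suc n} = {1..n} \<union> {Suc n}" by auto
qed measurable

lemma L2f_usph_borel: "f \<in> L2f (usph n) \<Longrightarrow> f \<in> borel_measurable (PB n)"
  using measurable_cong_sets[OF sets_usph[of n] refl, of borel] by (auto simp: L2f_def)

lemma slice_mean_measurable:
  assumes [measurable]: "f \<in> borel_measurable (PB (Suc n))"
  shows "slice_mean n f \<in> borel_measurable borel"
proof -
  interpret u: prob_space "usph n" by (rule prob_space_usph)
  show ?thesis unfolding slice_mean_def by measurable
qed

lemma slice_var_measurable:
  assumes [measurable]: "f \<in> borel_measurable (PB (Suc n))"
  shows "slice_var n f \<in> borel_measurable borel"
proof -
  interpret u: prob_space "usph n" by (rule prob_space_usph)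
  note [measurable] = slice_mean_measurable[OF assms]
  show ?thesis unfolding slice_var_def by measurable
qed

lemma AE_slice_L2f:
  assumes n: "n \<ge> 1" and f: "f \<in> L2f (usph (Suc n))"
  shows "AE x in marg (Suc n). (\<lambda>w. f (glue n x w)) \<in> L2f (usph n)"
proof -
  have [measurable]: "f \<in> borel_measurable (PB (Suc n))" by (rule L2f_usph_borel[OF f])
  show ?thesis
    using usph_slices(1)[OF n L2f_sq[OF f]] by eventually_elim (simp add: L2f_def)
qed

lemma square_mean_le:
  assumes f: "f \<in> L2f M" and M: "prob_space M"
  shows "(\<integral>x. f x \<partial>M)\<^sup>2 \<le> (\<integral>x. (f x)\<^sup>2 \<partial>M)"
    and "(\<integral>x. (f x - (\<integral>x. f x \<partial>M))\<^sup>2 \<partial>M) = (\<integral>x. (f x)\<^sup>2 \<partial>M) - (\<integral>x. f x \<partial>M)\<^sup>2"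
proof -
  interpret prob_space M by fact
  have fin: "finite_measure M" by unfold_locales
  define m where "m = (\<integral>x. f x \<partial>M)"
  have i: "integrable M f" "integrable M (\<lambda>x. (f x)\<^sup>2)" using L2f_integrable[OF fin f] L2f_sq[OF f] .
  have "(\<integral>x. (f x - m)\<^sup>2 \<partial>M) = (\<integral>x. (f x)\<^sup>2 - 2 * m * f x + m\<^sup>2 \<partial>M)"
    by (intro Bochner_Integration.integral_cong) (auto simp: power2_eq_square algebra_simps)
  also have "\<dots> = (\<integral>x. (f x)\<^sup>2 \<partial>M) - m\<^sup>2"
    using i by (simp add: prob_space m_def[symmetric] power2_eq_square)
  finally show eq: "(\<integral>x. (f x - (\<integral>x. f x \<partial>M))\<^sup>2 \<partial>M) = (\<integral>x. (f x)\<^sup>2 \<partial>M) - (\<integral>x. f x \<partial>M)\<^sup>2"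
    by (simp add: m_def)
  have "0 \<le> (\<integral>x. (f x - (\<integral>x. f x \<partial>M))\<^sup>2 \<partial>M)" by simp
  then show "(\<integral>x. f x \<partial>M)\<^sup>2 \<le> (\<integral>x. (f x)\<^sup>2 \<partial>M)" unfolding eq by simp
qed

lemma slice_var_nonneg:
  assumes n: "n \<ge> 1" and f: "f \<in> L2f (usph (Suc n))"
  shows "AE x in marg (Suc n). slice_var n f x \<ge> 0"
  using AE_slice_L2f[OF n f]
proof eventually_elim
  case (elim x)
  from square_mean_le(1)[OF this prob_space_usph] show ?case
    by (simp add: slice_var_def slice_mean_def)
qed

lemma slice_mean_L2f:
  assumes n: "n \<ge> 1" and f: "f \<in> L2f (usph (Suc n))"
  shows "slice_mean n f \<in> L2f (marg (Suc n))"
proof -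
  have [measurable]: "slice_mean n f \<in> borel_measurable borel"
    by (rule slice_mean_measurable[OF L2f_usph_borel[OF f]])
  have "integrable (marg (Suc n)) (\<lambda>x. (slice_mean n f x)\<^sup>2)"
  proof (rule Bochner_Integration.integrable_bound[OF usph_slices(2)[OF n L2f_sq[OF f]]])
    show "AE x in marg (Suc n). norm ((slice_mean n f x)\<^sup>2) \<le> norm (\<integral>w. (f (glue n x w))\<^sup>2 \<partial>usph n)"
      using slice_var_nonneg[OF n f] by eventually_elim (simp add: slice_var_def)
  qed measurable
  then show ?thesis by (simp add: L2f_def)
qed

lemma slice_mean_inner:
  assumes n: "n \<ge> 1" and f: "f \<in> L2f (usph (Suc n))" and h: "h \<in> L2f (marg (Suc n))"
  shows "(\<integral>v. f v * h (v (Suc n)) \<partial>usph (Suc n)) = (\<integral>x. slice_mean n f x * h x \<partial>marg (Suc n))"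
proof -
  have "integrable (usph (Suc n)) (\<lambda>v. f v * h (v (Suc n)))"
    by (intro L2f_mult f L2f_coordinate h) simp
  from usph_slices(3)[OF n this] show ?thesis by (simp add: slice_mean_def)
qed

text \<open>The law of total variance with a weight depending on the conditioning coordinate; the
  bound C provides integrability.\<close>

lemma slice_var_weighted:
  assumes n: "n \<ge> 1" and f: "f \<in> L2f (usph (Suc n))"
    and g[measurable]: "g \<in> borel_measurable borel" and C: "AE x in marg (Suc n). \<bar>g x\<bar> \<le> C"
  shows "integrable (marg (Suc n)) (\<lambda>x. g x * slice_var n f x)"
    and "integrable (usph (Suc n)) (\<lambda>v. g (v (Suc n)) * (f v)\<^sup>2)"
    and "(\<integral>x. g x * slice_var n f x \<partial>marg (Suc n)) =
      (\<integral>v. g (v (Suc n)) * (f v)\<^sup>2 \<partial>usph (Suc n)) - (\<integral>x. g x * (slice_mean n f x)\<^sup>2 \<partial>marg (Suc n))"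
proof -
  have [measurable]: "f \<in> borel_measurable (PB (Suc n))" by (rule L2f_usph_borel[OF f])
  note [measurable] = slice_mean_measurable[of f n] slice_var_measurable[of f n]
  have Cv: "AE v in usph (Suc n). \<bar>g (v (Suc n))\<bar> \<le> C"
  proof -
    have "AE x in distr (usph (Suc n)) borel (\<lambda>v. v (Suc n)). \<bar>g x\<bar> \<le> C"
      using C unfolding marg_def .
    then show ?thesis by (rule AE_distrD[rotated]) (rule nth_measurable_usph, simp)
  qed
  show ig: "integrable (usph (Suc n)) (\<lambda>v. g (v (Suc n)) * (f v)\<^sup>2)"
  proof (rule Bochner_Integration.integrable_bound[where f="\<lambda>v. C * (f v)\<^sup>2"])
    show "AE v in usph (Suc n). norm (g (v (Suc n)) * (f v)\<^sup>2) \<le> norm (C * (f v)\<^sup>2)"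
      using Cv by eventually_elim (auto simp: abs_mult intro!: mult_right_mono)
  qed (use L2f_sq[OF f] in \<open>simp, measurable\<close>)
  have im: "integrable (marg (Suc n)) (\<lambda>x. g x * (slice_mean n f x)\<^sup>2)"
  proof (rule Bochner_Integration.integrable_bound[where f="\<lambda>x. C * (slice_mean n f x)\<^sup>2"])
    show "AE x in marg (Suc n). norm (g x * (slice_mean n f x)\<^sup>2) \<le> norm (C * (slice_mean n f x)\<^sup>2)"
      using C by eventually_elim (auto simp: abs_mult intro!: mult_right_mono)
  qed (use L2f_sq[OF slice_mean_L2f[OF n f]] in \<open>simp, measurable\<close>)
  have i2: "integrable (marg (Suc n)) (\<lambda>x. g x * (\<integral>w. (f (glue n x w))\<^sup>2 \<partial>usph n))"
    using usph_slices(2)[OF n ig] by simp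
  have eq: "g x * slice_var n f x = g x * (\<integral>w. (f (glue n x w))\<^sup>2 \<partial>usph n) - g x * (slice_mean n f x)\<^sup>2" for x
    by (simp add: slice_var_def right_diff_distrib)
  show "integrable (marg (Suc n)) (\<lambda>x. g x * slice_var n f x)"
    unfolding eq by (intro Bochner_Integration.integrable_diff i2 im)
  show "(\<integral>x. g x * slice_var n f x \<partial>marg (Suc n)) =
      (\<integral>v. g (v (Suc n)) * (f v)\<^sup>2 \<partial>usph (Suc n)) - (\<integral>x. g x * (slice_mean n f x)\<^sup>2 \<partial>marg (Suc n))"
    unfolding eq Bochner_Integration.integral_diff[OF i2 im] usph_slices(3)[OF n ig] by simp
qed

text \<open>Exchanges with the last coordinate suffice, since they move any coordinate into the
  position on which slices condition.\<close>

definition sym_fun :: "nat \<Rightarrow> ((nat \<Rightarrow> real) \<Rightarrow> real) \<Rightarrow> bool" where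
  "sym_fun n f \<longleftrightarrow> (\<forall>j\<in>{1..n}. \<forall>v. f (v(j := v n, n := v j)) = f v)"

lemma sym_fun_sum: "sym_fun n (\<lambda>v. \<Sum>j=1..n. \<phi> (v j))"
  unfolding sym_fun_def
proof (intro ballI allI)
  fix j v assume j: "j \<in> {1..n}"
  have n: "n \<in> {1..n}" using j by auto
  have "(\<Sum>i=1..n. \<phi> ((v(j := v n, n := v j)) i)) = (\<Sum>i=1..n. \<phi> (v (Transposition.transpose j n i)))"
    by (intro sum.cong) (auto simp: Transposition.transpose_def)
  also have "\<dots> = (\<Sum>i=1..n. \<phi> (v i))"
    using sum.permute[OF permutes_swap_id[OF j n], of "\<lambda>i. \<phi> (v i)"] by (simp add: comp_def)
  finally show "(\<Sum>i=1..n. \<phi> ((v(j := v n, n := v j)) i)) = (\<Sum>i=1..n. \<phi> (v i))" .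
qed

lemma sym_fun_integral:
  fixes h :: "real \<Rightarrow> real"
  assumes f: "sym_fun n f" and [measurable]: "f \<in> borel_measurable (PB n)" "h \<in> borel_measurable borel" and j: "j \<in> {1..n}"
  shows "(\<integral>v. f v * h (v j) \<partial>usph n) = (\<integral>v. f v * h (v n) \<partial>usph n)"
proof -
  have n: "n \<in> {1..n}" using j by auto
  let ?T = "\<lambda>v :: nat \<Rightarrow> real. v(j := v n, n := v j)"
  have "(\<integral>v. f v * h (v j) \<partial>usph n) = (\<integral>v. f v * h (v j) \<partial>distr (usph n) (PB n) ?T)"
    by (simp only: usph_swap[OF j n])
  also have "\<dots> = (\<integral>v. f (?T v) * h (?T v j) \<partial>usph n)"
  proof (rule integral_distr)
    show "?T \<in> measurable (usph n) (PB n)"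
      using swap_measurable[OF j n] by (simp cong: measurable_cong_sets)
    show "(\<lambda>v. f v * h (v j)) \<in> borel_measurable (PB n)"
      using j by measurable
  qed
  also have "\<dots> = (\<integral>v. f v * h (v n) \<partial>usph n)"
    using f j unfolding sym_fun_def by (intro Bochner_Integration.integral_cong) auto
  finally show ?thesis .
qed

text \<open>With \<open>h\<close> the slice mean, symmetry gives \<open>\<langle>f, \<Sum>j. h (v j)\<rangle> = (n + 1) \<parallel>h\<parallel>\<^sup>2\<close>, and the second factor is
  controlled by the two-coordinate correlation bound.\<close>

lemma slice_mean_bound:
  assumes n: "n \<ge> 2" and f: "f \<in> L2f (usph (Suc n))" and s: "sym_fun (Suc n) f"
    and f0: "(\<integral>v. f v \<partial>usph (Suc n)) = 0"
  shows "(\<integral>x. (slice_mean n f x)\<^sup>2 \<partial>marg (Suc n)) \<le> (real n + 5) / ((real n + 1) * (real n + 2)) * (\<integral>v. (f v)\<^sup>2 \<partial>usph (Suc n))"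
proof -
  have n1: "n \<ge> 1" using n by simp
  define N where "N = Suc n"
  have N: "N \<ge> 3" using n by (simp add: N_def)
  define h where "h = slice_mean n f"
  have hL: "h \<in> L2f (marg N)" using slice_mean_L2f[OF n1 f] by (simp add: h_def N_def)
  note [measurable] = L2f_marg_borel[OF hL] L2f_usph_borel[OF f[folded N_def]]
  have h0: "(\<integral>x. h x \<partial>marg N) = 0"
    using usph_slices(3)[OF n1 L2f_integrable[OF finite_measure_usph f]] f0 by (simp add: h_def N_def slice_mean_def[abs_def])
  define H where "H = (\<integral>x. (h x)\<^sup>2 \<partial>marg N)"
  define F where "F = (\<integral>v. (f v)\<^sup>2 \<partial>usph N)"
  \<comment> \<open>This is the constant of \<open>sum_sq_upper\<close> divided by N. It makes the
    second half of the AM-GM bound equal to \<open>real N * H\<close>, so that one of the two copies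
    on the left can be absorbed.\<close>
  define t where "t = (real N + 4) / (real N + 1)"
  have t: "t > 0" by (simp add: t_def)
  define S where "S = (\<lambda>v. \<Sum>j=1..N. h (v j))"
  have SL: "S \<in> L2f (usph N)" unfolding S_def by (intro L2f_sum L2f_coordinate hL)
  have S2: "(\<integral>v. (S v)\<^sup>2 \<partial>usph N) \<le> real N * t * H"
    using sum_sq_upper[OF N hL h0] by (simp add: S_def t_def H_def)
  have "(\<integral>v. f v * S v \<partial>usph N) = (\<Sum>j=1..N. \<integral>v. f v * h (v j) \<partial>usph N)"
    unfolding S_def sum_distrib_left
    by (intro Bochner_Integration.integral_sum L2f_mult L2f_coordinate hL f[folded N_def])
  also have "\<dots> = (\<Sum>j=1..N. H)"
  proof (rule sum.cong[OF refl])
    fix j assume j: "j \<in> {1..N}"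
    have "(\<integral>v. f v * h (v j) \<partial>usph N) = (\<integral>v. f v * h (v N) \<partial>usph N)"
      using sym_fun_integral[OF s L2f_usph_borel[OF f] L2f_marg_borel[OF hL], of j] j by (simp add: N_def)
    also have "\<dots> = (\<integral>x. slice_mean n f x * h x \<partial>marg N)"
      using slice_mean_inner[OF n1 f, of h] hL by (simp add: N_def)
    finally show "(\<integral>v. f v * h (v j) \<partial>usph N) = H" by (simp add: H_def h_def power2_eq_square)
  qed
  also have "\<dots> = real N * H" by simp
  finally have fS: "(\<integral>v. f v * S v \<partial>usph N) = real N * H" .
  have "2 * (real N * H) \<le> t * F + (\<integral>v. (S v)\<^sup>2 \<partial>usph N) / t"
    using L2_am_gm[OF f[folded N_def] SL t] unfolding fS F_def by linarith
  also have "\<dots> \<le> t * F + (real N * t * H) / t"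
    using S2 t by (intro add_left_mono divide_right_mono) auto
  also have "\<dots> = t * F + real N * H" using t by simp
  finally have "real N * H \<le> t * F" by linarith
  then have "H \<le> t * F / real N" using N by (simp add: pos_le_divide_eq) (simp add: mult.commute)
  also have "\<dots> = t / real N * F" by simp
  also have "t / real N = (real n + 5) / ((real n + 1) * (real n + 2))"
    unfolding t_def N_def by (simp add: add.commute mult.commute)
  finally show ?thesis by (simp add: H_def F_def h_def N_def)
qed

lemma slice_var_bound0:
  assumes n: "n \<ge> 2" and f: "f \<in> L2f (usph (Suc n))" and s: "sym_fun (Suc n) f"
    and f0: "(\<integral>v. f v \<partial>usph (Suc n)) = 0"
  shows "(1 - (real n + 5) / ((real n + 1) * (real n + 2))) * (\<integral>v. (f v)\<^sup>2 \<partial>usph (Suc n))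
    \<le> (\<integral>x. slice_var n f x \<partial>marg (Suc n))"
  using slice_mean_bound[OF assms] slice_var_weighted(3)[OF _ f, of "\<lambda>x. 1" 1] n
  by (simp add: left_diff_distrib)

text \<open>The weight W costs nothing on f^2: by symmetry each squared coordinate has the same
  f^2-average, and they sum to N. On the slice means, which are already of order 1/N, the crude
  bound W <= (n + 1)/n is affordable.\<close>

lemma slice_var_bound1:
  assumes n: "n \<ge> 2" and f: "f \<in> L2f (usph (Suc n))" and s: "sym_fun (Suc n) f"
    and f0: "(\<integral>v. f v \<partial>usph (Suc n)) = 0"
  shows "(1 - (real n + 5) / (real n * (real n + 2))) * (\<integral>v. (f v)\<^sup>2 \<partial>usph (Suc n))
    \<le> (\<integral>x. (real (Suc n) - x\<^sup>2) / real n * slice_var n f x \<partial>marg (Suc n))"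
proof -
  have n1: "n \<ge> 1" and N1: "Suc n \<ge> 1" using n by auto
  define N where "N = Suc n"
  have fL: "f \<in> L2f (usph N)" using f by (simp add: N_def)
  note [measurable] = L2f_usph_borel[OF fL]
  define F where "F = (\<integral>v. (f v)\<^sup>2 \<partial>usph N)"
  let ?W = "\<lambda>x. (real (Suc n) - x\<^sup>2) / real n"
  have W: "AE x in marg (Suc n). \<bar>?W x\<bar> \<le> real (Suc n) / real n"
    using AE_marg_bound[OF N1] by eventually_elim (auto simp: abs_le_iff intro!: divide_right_mono)
  have Wm: "?W \<in> borel_measurable borel" by measurable
  have sq: "integrable (usph N) (\<lambda>v. (v j)\<^sup>2 * (f v)\<^sup>2)" if j: "j \<in> {1..N}" for j
  proof (rule Bochner_Integration.integrable_bound[where f="\<lambda>v. real N * (f v)\<^sup>2"])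
    show "AE v in usph N. norm ((v j)\<^sup>2 * (f v)\<^sup>2) \<le> norm (real N * (f v)\<^sup>2)"
      using AE_usph_bound[OF j] by eventually_elim (auto intro!: mult_right_mono)
  qed (use L2f_sq[OF fL] j in \<open>simp, measurable\<close>)
  have s2: "sym_fun N (\<lambda>v. (f v)\<^sup>2)" using s by (simp add: sym_fun_def N_def)
  have e: "(\<integral>v. (v j)\<^sup>2 * (f v)\<^sup>2 \<partial>usph N) = (\<integral>v. (v N)\<^sup>2 * (f v)\<^sup>2 \<partial>usph N)" if j: "j \<in> {1..N}" for j
    using sym_fun_integral[OF s2 _ _ j, of "\<lambda>x. x\<^sup>2"] by (simp add: mult.commute)
  have "real N * (\<integral>v. (v N)\<^sup>2 * (f v)\<^sup>2 \<partial>usph N) = (\<Sum>j=1..N. \<integral>v. (v N)\<^sup>2 * (f v)\<^sup>2 \<partial>usph N)"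
    by simp
  also have "\<dots> = (\<Sum>j=1..N. \<integral>v. (v j)\<^sup>2 * (f v)\<^sup>2 \<partial>usph N)"
    by (intro sum.cong refl e[symmetric])
  also have "\<dots> = (\<integral>v. (\<Sum>j=1..N. (v j)\<^sup>2 * (f v)\<^sup>2) \<partial>usph N)"
    using sq by (subst Bochner_Integration.integral_sum) auto
  also have "\<dots> = (\<integral>v. real N * (f v)\<^sup>2 \<partial>usph N)"
  proof (rule integral_cong_AE)
    show "AE v in usph N. (\<Sum>j=1..N. (v j)\<^sup>2 * (f v)\<^sup>2) = real N * (f v)\<^sup>2"
      using AE_usph_sphere[OF N1[folded N_def]] by eventually_elim (simp add: kac_sphere_def flip: sum_distrib_right)
  qed measurable
  finally have vN: "(\<integral>v. (v N)\<^sup>2 * (f v)\<^sup>2 \<partial>usph N) = F" by (simp add: F_def N_def)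
  have "(\<integral>v. ?W (v (Suc n)) * (f v)\<^sup>2 \<partial>usph (Suc n)) = (\<integral>v. (real N * (f v)\<^sup>2 - (v N)\<^sup>2 * (f v)\<^sup>2) / real n \<partial>usph N)"
    by (intro Bochner_Integration.integral_cong) (auto simp: N_def algebra_simps diff_divide_distrib)
  also have "\<dots> = (real N * F - F) / real n"
    using sq[of N] L2f_sq[OF fL] vN by (simp add: F_def N_def)
  also have "\<dots> = F" using n by (simp add: N_def algebra_simps)
  finally have 1: "(\<integral>v. ?W (v (Suc n)) * (f v)\<^sup>2 \<partial>usph (Suc n)) = F" .
  have mL: "slice_mean n f \<in> L2f (marg (Suc n))" by (rule slice_mean_L2f[OF n1 f])
  note [measurable] = L2f_marg_borel[OF mL]
  have "(\<integral>x. ?W x * (slice_mean n f x)\<^sup>2 \<partial>marg (Suc n)) \<le> (\<integral>x. real (Suc n) / real n * (slice_mean n f x)\<^sup>2 \<partial>marg (Suc n))"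
  proof (rule integral_mono_AE)
    show "AE x in marg (Suc n). ?W x * (slice_mean n f x)\<^sup>2 \<le> real (Suc n) / real n * (slice_mean n f x)\<^sup>2"
      using W
    proof eventually_elim
      case (elim x)
      show ?case by (rule mult_right_mono[OF order_trans[OF abs_ge_self elim]]) simp
    qed
    show 2: "integrable (marg (Suc n)) (\<lambda>x. real (Suc n) / real n * (slice_mean n f x)\<^sup>2)"
      using L2f_sq[OF mL] by simp
    show "integrable (marg (Suc n)) (\<lambda>x. ?W x * (slice_mean n f x)\<^sup>2)"
    proof (rule Bochner_Integration.integrable_bound[OF 2])
      show "AE x in marg (Suc n). norm (?W x * (slice_mean n f x)\<^sup>2) \<le> norm (real (Suc n) / real n * (slice_mean n f x)\<^sup>2)"
        using W
      proof eventually_elim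
        case (elim x)
        have "\<bar>?W x\<bar> * (slice_mean n f x)\<^sup>2 \<le> real (Suc n) / real n * (slice_mean n f x)\<^sup>2"
          by (intro mult_right_mono elim) simp
        then show ?case by (simp add: abs_mult)
      qed
    qed measurable
  qed
  also have "\<dots> = real (Suc n) / real n * (\<integral>x. (slice_mean n f x)\<^sup>2 \<partial>marg (Suc n))" by simp
  also have "\<dots> \<le> real (Suc n) / real n * ((real n + 5) / ((real n + 1) * (real n + 2)) * F)"
    using slice_mean_bound[OF assms] by (intro mult_left_mono) (auto simp: F_def N_def)
  also have "\<dots> = (real n + 5) / (real n * (real n + 2)) * F"
    using n by (simp add: divide_simps)
  finally show ?thesis
    unfolding slice_var_weighted(3)[OF n1 f Wm W] 1
    by (simp add: F_def N_def left_diff_distrib)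
qed

section \<open>The quadratic weight\<close>

lemma slice_sum:
  "(\<Sum>j=1..Suc n. \<phi> (glue n x w j)) = \<phi> x + (\<Sum>j=1..n. \<phi> (slice_factor n x * w j))"
proof -
  have "{1..Suc n} = insert (Suc n) {1..n}" by auto
  moreover have "(\<Sum>j=1..n. \<phi> (glue n x w j)) = (\<Sum>j=1..n. \<phi> (slice_factor n x * w j))"
    by (intro sum.cong) (simp_all add: glue_nth)
  ultimately show ?thesis by simp
qed

text \<open>On a slice the term \<phi> x is constant, so the variance is that of a sum over the
  sphere in dimension n with a rescaled summand. After centring the summand,
  \<open>sum_sq_upper\<close> applies in dimension n; this is the origin of the hypothesis n >=
  3.\<close>

lemma slice_var_sum_le:
  assumes n: "n \<ge> 3" and \<phi>: "\<phi> \<in> L2f (marg (Suc n))"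
  shows "AE x in marg (Suc n). slice_var n (\<lambda>v. \<Sum>j=1..Suc n. \<phi> (v j)) x
     \<le> real n * (real n + 4) / (real n + 1) * (\<integral>w. (\<phi> (glue n x w 1))\<^sup>2 \<partial>usph n)"
proof -
  have n1: "n \<ge> 1" and i1: "1 \<in> {1..n}" and I1: "1 \<in> {1..Suc n}" using n by auto
  have [measurable]: "\<phi> \<in> borel_measurable borel" by (rule L2f_marg_borel[OF \<phi>])
  interpret u: prob_space "usph n" by (rule prob_space_usph)
  interpret m: prob_space "marg n" by (rule prob_space_marg[OF n1])
  have finm: "finite_measure (marg n)" by unfold_locales
  show ?thesis
    using AE_slice_L2f[OF n1 L2f_coordinate(1)[OF I1 \<phi>]]
  proof eventually_elim
    case (elim x)
    define \<psi> where "\<psi> = (\<lambda>y. \<phi> (slice_factor n x * y))"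
    have [measurable]: "\<psi> \<in> borel_measurable borel" unfolding \<psi>_def by measurable
    have e1: "\<phi> (glue n x w 1) = \<psi> (w 1)" for w using i1 by (simp add: glue_nth \<psi>_def)
    have "integrable (usph n) (\<lambda>w. (\<psi> (w 1))\<^sup>2)" using L2f_sq[OF elim] by (simp add: e1)
    then have \<psi>L: "\<psi> \<in> L2f (marg n)"
      using usph_coordinate(2)[OF i1, of "\<lambda>y. (\<psi> y)\<^sup>2"] by (simp add: L2f_def)
    define m where "m = (\<integral>y. \<psi> y \<partial>marg n)"
    define g where "g = (\<lambda>y. \<psi> y - m)"
    have gL: "g \<in> L2f (marg n)" unfolding g_def by (intro L2f_diff \<psi>L L2f_const finm)
    have g0: "(\<integral>y. g y \<partial>marg n) = 0"
      using L2f_integrable[OF finm \<psi>L] by (simp add: g_def m_def[symmetric] m.prob_space[simplified])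
    define G where "G = (\<lambda>w. \<Sum>j=1..n. g (w j))"
    have GL: "G \<in> L2f (usph n)" unfolding G_def by (intro L2f_sum L2f_coordinate gL)
    have G0: "(\<integral>w. G w \<partial>usph n) = 0"
    proof -
      have "(\<integral>w. G w \<partial>usph n) = (\<Sum>j=1..n. \<integral>w. g (w j) \<partial>usph n)"
        unfolding G_def by (intro Bochner_Integration.integral_sum L2f_integrable[OF finite_measure_usph] L2f_coordinate gL)
      also have "\<dots> = (\<Sum>j=1..n. 0)"
        using L2f_coordinate(3)[OF _ gL] g0 by (intro sum.cong refl) simp
      finally show ?thesis by simp
    qed
    define c where "c = \<phi> x + real n * m"
    have F: "(\<Sum>j=1..Suc n. \<phi> (glue n x w j)) = c + G w" for w
      unfolding slice_sum G_def g_def c_def \<psi>_def by (simp add: sum_subtractf)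
    have FL: "(\<lambda>w. c + G w) \<in> L2f (usph n)" by (intro L2f_add GL L2f_const finite_measure_usph)
    have F1: "(\<integral>w. c + G w \<partial>usph n) = c"
      using L2f_integrable[OF finite_measure_usph GL] G0 u.prob_space by simp
    have "slice_var n (\<lambda>v. \<Sum>j=1..Suc n. \<phi> (v j)) x = (\<integral>w. (c + G w - c)\<^sup>2 \<partial>usph n)"
      using square_mean_le(2)[OF FL prob_space_usph] unfolding slice_var_def slice_mean_def F F1 by simp
    also have "\<dots> = (\<integral>w. (G w)\<^sup>2 \<partial>usph n)" by simp
    also have "\<dots> \<le> real n * (real n + 4) / (real n + 1) * (\<integral>y. (g y)\<^sup>2 \<partial>marg n)"
      unfolding G_def by (rule sum_sq_upper[OF n gL g0])
    also have "\<dots> \<le> real n * (real n + 4) / (real n + 1) * (\<integral>y. (\<psi> y)\<^sup>2 \<partial>marg n)"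
      using square_mean_le(2)[OF \<psi>L prob_space_marg[OF n1]]
      by (intro mult_left_mono) (auto simp: g_def m_def)
    also have "(\<integral>y. (\<psi> y)\<^sup>2 \<partial>marg n) = (\<integral>w. (\<phi> (glue n x w 1))\<^sup>2 \<partial>usph n)"
      using usph_coordinate(1)[OF i1, of "\<lambda>y. (\<psi> y)\<^sup>2"] by (simp add: e1)
    finally show ?case .
  qed
qed

text \<open>With q the squared slice factor, the integral is a quadratic in q. Bounding one factor q
  by its maximum (n + 1)/n leaves a linear function with slope (n - 1)/(n + 2) > 0, which is then
  bounded at the same endpoint.\<close>

lemma slice_quadratic_moment:
  assumes n: "n \<ge> 2" and x: "x\<^sup>2 \<le> real (Suc n)"
  shows "(\<integral>w. (((glue n x w 1)\<^sup>2 - 1) / real n)\<^sup>2 \<partial>usph n)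
    \<le> (2 * (real n)\<^sup>2 + 2 * real n - 1) / (real n * (real n + 2)) / (real n)\<^sup>2"
proof -
  have n1: "n \<ge> 1" and i1: "1 \<in> {1..n}" using n by auto
  interpret u: prob_space "usph n" by (rule prob_space_usph)
  define r where "r = real n"
  have r: "r \<ge> 2" using n by (simp add: r_def)
  define q where "q = (slice_factor n x)\<^sup>2"
  have q: "q = (r + 1 - x\<^sup>2) / r" using slice_factor_sq[OF n1 x] by (simp add: q_def r_def)
  have q0: "0 \<le> q" by (simp add: q_def)
  have q1: "q \<le> (r + 1) / r" unfolding q using r by (intro divide_right_mono) auto
  have i: "integrable (usph n) (\<lambda>w. (w 1) ^ m)" and e: "(\<integral>w. (w 1) ^ m \<partial>usph n) = (\<integral>x. x ^ m \<partial>marg n)" for m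
    using L2f_integrable[OF finite_measure_usph L2f_coordinate(1)[OF i1 pow_L2f_marg[OF n1]]]
      L2f_coordinate(3)[OF i1 pow_L2f_marg[OF n1]] by auto
  have "(\<integral>w. (((glue n x w 1)\<^sup>2 - 1) / real n)\<^sup>2 \<partial>usph n) = (\<integral>w. (q\<^sup>2 * (w 1) ^ 4 - 2 * q * (w 1)\<^sup>2 + 1) / r\<^sup>2 \<partial>usph n)"
  proof (rule Bochner_Integration.integral_cong[OF refl])
    fix w :: "nat \<Rightarrow> real"
    have "(((s * y)\<^sup>2 - 1) / r)\<^sup>2 = ((s\<^sup>2)\<^sup>2 * y ^ 4 - 2 * s\<^sup>2 * y\<^sup>2 + 1) / r\<^sup>2" for s y :: real
      unfolding power_divide by (rule arg_cong[where f="\<lambda>z. z / r\<^sup>2"]) algebra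
    then show "(((glue n x w 1)\<^sup>2 - 1) / real n)\<^sup>2 = (q\<^sup>2 * (w 1) ^ 4 - 2 * q * (w 1)\<^sup>2 + 1) / r\<^sup>2"
      using i1 by (simp add: glue_nth q_def r_def)
  qed
  also have "\<dots> = (q\<^sup>2 * (3 * r / (r + 2)) - 2 * q + 1) / r\<^sup>2"
    using i e marg_moment2[OF n1] marg_moment4[OF n] u.prob_space by (simp add: r_def)
  also have "\<dots> \<le> ((2 * r\<^sup>2 + 2 * r - 1) / (r * (r + 2))) / r\<^sup>2"
  proof (intro divide_right_mono)
    have r2: "(r + 2) > 0" "r > 0" using r by auto
    have "q * q \<le> q * ((r + 1) / r)" using q0 q1 by (intro mult_left_mono)
    then have "q\<^sup>2 * (3 * r / (r + 2)) - 2 * q + 1 \<le> q * ((r + 1) / r) * (3 * r / (r + 2)) - 2 * q + 1"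
      using r2 by (intro diff_right_mono add_right_mono mult_right_mono) (auto simp: power2_eq_square)
    also have "\<dots> = q * ((r - 1) / (r + 2)) + 1"
      using r2 by (simp add: divide_simps) (simp add: algebra_simps)
    also have "\<dots> \<le> (r + 1) / r * ((r - 1) / (r + 2)) + 1"
      using q1 r by (intro add_right_mono mult_right_mono) auto
    also have "\<dots> = (2 * r\<^sup>2 + 2 * r - 1) / (r * (r + 2))"
      using r2 by (simp add: divide_simps) (simp add: algebra_simps power2_eq_square)
    finally show "q\<^sup>2 * (3 * r / (r + 2)) - 2 * q + 1 \<le> (2 * r\<^sup>2 + 2 * r - 1) / (r * (r + 2))" .
  qed simp
  finally show ?thesis by (simp add: r_def)
qed

lemma AE_usph_slices:
  assumes n: "n \<ge> 1" and P: "AE v in usph (Suc n). P v" and "{v \<in> space (PB (Suc n)). P v} \<in> sets (PB (Suc n))"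
  shows "AE x in marg (Suc n). AE w in usph n. P (glue n x w)"
proof -
  interpret u: prob_space "usph n" by (rule prob_space_usph)
  have g: "(\<lambda>(x, w). glue n x w) \<in> measurable (marg (Suc n) \<Otimes>\<^sub>M usph n) (PB (Suc n))"
    by measurable
  have AEz: "AE z in marg (Suc n) \<Otimes>\<^sub>M usph n. P (case z of (x, w) \<Rightarrow> glue n x w)"
    using P unfolding usph_Suc[OF n] by (subst (asm) AE_distr_iff[OF g assms(3)])
  interpret m: prob_space "marg (Suc n)" by (rule prob_space_marg) simp
  interpret p: pair_sigma_finite "marg (Suc n)" "usph n" ..
  from p.AE_pair[OF AEz] show ?thesis by simp
qed

text \<open>Three estimates are chained: the slice variance by the conditional second moment of the
  summand at coordinate 1, the weight by its conditional moment given the coordinate that carries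
  the summand, and the norm of the summand by that of the sum. The last needs a summand orthogonal
  to x^2, which is why \<phi> is replaced.\<close>

lemma slice_var_quadratic:
  assumes n: "n \<ge> 3" and \<phi>: "\<phi> \<in> L2f (marg (Suc n))"
    and f0: "(\<integral>v. (\<Sum>j=1..Suc n. \<phi> (v j)) \<partial>usph (Suc n)) = 0"
  shows "(\<integral>x. ((x\<^sup>2 - 1) / real n)\<^sup>2 * slice_var n (\<lambda>v. \<Sum>j=1..Suc n. \<phi> (v j)) x \<partial>marg (Suc n))
    \<le> (real n + 4) * (2 * (real n)\<^sup>2 + 2 * real n - 1) / ((real n)\<^sup>2 * (real n + 1)\<^sup>2 * (real n - 1))
       * (\<integral>v. (\<Sum>j=1..Suc n. \<phi> (v j))\<^sup>2 \<partial>usph (Suc n))"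
proof -
  define N where "N = Suc n"
  have n1: "n \<ge> 1" and n2: "n \<ge> 2" and N: "N \<ge> 3" "N \<ge> 2" "N \<ge> 1" using n by (auto simp: N_def)
  have I1: "1 \<in> {1..N}" and IN: "N \<in> {1..N}" and ne: "1 \<noteq> N" using N by auto
  let ?M = "marg N"
  have fin: "finite_measure ?M" by (rule finite_measure_marg[OF N(3)])
  have \<phi>L: "\<phi> \<in> L2f ?M" using \<phi> by (simp add: N_def)
  have \<phi>0: "(\<integral>x. \<phi> x \<partial>?M) = 0"
  proof -
    have "(\<integral>v. (\<Sum>j=1..N. \<phi> (v j)) \<partial>usph N) = (\<Sum>j=1..N. \<integral>v. \<phi> (v j) \<partial>usph N)"
      by (intro Bochner_Integration.integral_sum L2f_integrable[OF finite_measure_usph] L2f_coordinate \<phi>L)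
    also have "\<dots> = (\<Sum>j=1..N. \<integral>x. \<phi> x \<partial>?M)"
      using L2f_coordinate(3)[OF _ \<phi>L] by (intro sum.cong refl) simp
    also have "\<dots> = real N * (\<integral>x. \<phi> x \<partial>?M)" by simp
    finally show ?thesis using f0 N by (simp add: N_def)
  qed
  \<comment> \<open>The summand h has the same sum as \<phi> almost everywhere on the sphere, hence
    the same slice variances on almost every slice.\<close>
  obtain a where g: "(\<lambda>x. \<phi> x - a * (x\<^sup>2 - 1)) \<in> L2f ?M"
    "(\<integral>x. \<phi> x - a * (x\<^sup>2 - 1) \<partial>?M) = 0"
    "(\<integral>x. (\<phi> x - a * (x\<^sup>2 - 1)) * x\<^sup>2 \<partial>?M) = 0"
    using quadratic_part[OF N(2) \<phi>L \<phi>0] by blast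
  define h where "h = (\<lambda>x. \<phi> x - a * (x\<^sup>2 - 1))"
  have hL: "h \<in> L2f ?M" using g by (simp add: h_def)
  have [measurable]: "h \<in> borel_measurable borel" "\<phi> \<in> borel_measurable borel"
    by (rule L2f_marg_borel[OF hL], rule L2f_marg_borel[OF \<phi>L])
  define F where "F = (\<lambda>v. \<Sum>j=1..N. \<phi> (v j))"
  define G where "G = (\<lambda>v. \<Sum>j=1..N. h (v j))"
  have GL: "G \<in> L2f (usph N)" unfolding G_def by (intro L2f_sum L2f_coordinate hL)
  have [measurable]: "F \<in> borel_measurable (PB N)" "G \<in> borel_measurable (PB N)"
    unfolding F_def G_def by measurable
  have FG: "AE v in usph N. F v = G v"
    using AE_usph_sphere[OF N(3)]
  proof eventually_elim
    case (elim v)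
    then have "(\<Sum>j=1..N. (v j)\<^sup>2) = real N" by (simp add: kac_sphere_def)
    then have "(\<Sum>j=1..N. a * ((v j)\<^sup>2 - 1)) = 0"
      by (simp add: sum_subtractf flip: sum_distrib_left)
    then show ?case by (simp add: F_def G_def h_def sum_subtractf)
  qed
  have sv: "AE x in ?M. slice_var n F x = slice_var n G x"
  proof -
    have "AE x in marg (Suc n). AE w in usph n. F (glue n x w) = G (glue n x w)"
    proof (rule AE_usph_slices[OF n1])
      show "AE v in usph (Suc n). F v = G v" using FG by (simp only: N_def)
      have "{v \<in> space (PB N). F v = G v} \<in> sets (PB N)" by measurable
      then show "{v \<in> space (PB (Suc n)). F v = G v} \<in> sets (PB (Suc n))" by (simp only: N_def)
    qed
    then show ?thesis
      unfolding N_def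
    proof eventually_elim
      case (elim x)
      have m: "(\<lambda>w. F (glue n x w)) \<in> borel_measurable (usph n)" "(\<lambda>w. G (glue n x w)) \<in> borel_measurable (usph n)"
        using measurable_compose[OF glue_measurable1, of F n borel x] measurable_compose[OF glue_measurable1, of G n borel x]
          \<open>F \<in> borel_measurable (PB N)\<close> \<open>G \<in> borel_measurable (PB N)\<close>
        by (simp_all add: N_def cong: measurable_cong_sets)
      have "(\<integral>w. F (glue n x w) \<partial>usph n) = (\<integral>w. G (glue n x w) \<partial>usph n)"
        by (rule integral_cong_AE[OF m elim])
      moreover have "(\<integral>w. (F (glue n x w))\<^sup>2 \<partial>usph n) = (\<integral>w. (G (glue n x w))\<^sup>2 \<partial>usph n)"
        using m elim by (intro integral_cong_AE) auto
      ultimately show ?case by (simp add: slice_var_def slice_mean_def)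
    qed
  qed
  let ?u = "\<lambda>x. ((x\<^sup>2 - 1) / real n)\<^sup>2"
  define C where "C = real n * (real n + 4) / (real n + 1)"
  define K where "K = (2 * (real n)\<^sup>2 + 2 * real n - 1) / (real n * (real n + 2)) / (real n)\<^sup>2"
  have C0: "C \<ge> 0" by (simp add: C_def)
  have K0: "K \<ge> 0"
  proof -
    have "2 * (real n)\<^sup>2 + 2 * real n - 1 \<ge> 0" using n1 by (smt (verit) of_nat_1 of_nat_mono zero_le_power2)
    then show ?thesis by (simp add: K_def)
  qed
  have ub: "?u x \<le> (real N / real n)\<^sup>2" if "x\<^sup>2 \<le> real N" for x
  proof -
    have "\<bar>x\<^sup>2 - 1\<bar> \<le> real N" using that N zero_le_power2[of x] by linarith
    then have "\<bar>(x\<^sup>2 - 1) / real n\<bar> \<le> real N / real n"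
      by (simp add: divide_right_mono)
    from power_mono[OF this abs_ge_zero, of 2] show ?thesis by (simp only: power2_abs)
  qed
  have iu: "integrable (usph N) (\<lambda>v. ?u (v i) * (h (v j))\<^sup>2)" if ij: "i \<in> {1..N}" "j \<in> {1..N}" for i j
  proof (rule Bochner_Integration.integrable_bound[where f="\<lambda>v. (real N / real n)\<^sup>2 * (h (v j))\<^sup>2"])
    show "integrable (usph N) (\<lambda>v. (real N / real n)\<^sup>2 * (h (v j))\<^sup>2)"
      using L2f_sq[OF L2f_coordinate(1)[OF ij(2) hL]] by simp
    show "AE v in usph N. norm (?u (v i) * (h (v j))\<^sup>2) \<le> norm ((real N / real n)\<^sup>2 * (h (v j))\<^sup>2)"
      using AE_usph_bound[OF ij(1)]
    proof eventually_elim
      case (elim v)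
      have "?u (v i) * (h (v j))\<^sup>2 \<le> (real N / real n)\<^sup>2 * (h (v j))\<^sup>2"
        by (intro mult_right_mono ub elim) simp
      then show ?case by simp
    qed
  qed (use ij in measurable)
  have um: "?u \<in> borel_measurable borel" by measurable
  have uB: "AE x in marg (Suc n). \<bar>?u x\<bar> \<le> (real N / real n)\<^sup>2"
    using AE_marg_bound[OF N(3)] unfolding N_def[symmetric] by eventually_elim (use ub in simp)
  have "(\<integral>x. ?u x * slice_var n F x \<partial>?M) = (\<integral>x. ?u x * slice_var n G x \<partial>?M)"
    using sv slice_var_measurable[of F n] slice_var_measurable[of G n]
    by (intro integral_cong_AE) (auto simp: N_def[symmetric])
  also have "\<dots> \<le> (\<integral>x. C * (?u x * (\<integral>w. (h (glue n x w 1))\<^sup>2 \<partial>usph n)) \<partial>?M)"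
  proof (rule integral_mono_AE)
    show "integrable ?M (\<lambda>x. ?u x * slice_var n G x)"
      using slice_var_weighted(1)[OF n1 GL[unfolded N_def] um uB] by (simp add: N_def)
    show "integrable ?M (\<lambda>x. C * (?u x * (\<integral>w. (h (glue n x w 1))\<^sup>2 \<partial>usph n)))"
      using usph_slices(2)[OF n1 iu[OF IN I1, unfolded N_def]] by (simp add: N_def)
    show "AE x in ?M. ?u x * slice_var n G x \<le> C * (?u x * (\<integral>w. (h (glue n x w 1))\<^sup>2 \<partial>usph n))"
      using slice_var_sum_le[OF n hL[unfolded N_def]] unfolding N_def
    proof eventually_elim
      case (elim x)
      then have "?u x * slice_var n G x \<le> ?u x * (C * (\<integral>w. (h (glue n x w 1))\<^sup>2 \<partial>usph n))"
        by (intro mult_left_mono) (simp_all add: G_def N_def C_def)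
      then show ?case by (simp only: mult.left_commute)
    qed
  qed
  also have "\<dots> = C * (\<integral>v. ?u (v N) * (h (v 1))\<^sup>2 \<partial>usph N)"
    using usph_slices(3)[OF n1 iu[OF IN I1, unfolded N_def]] by (simp add: N_def)
  \<comment> \<open>Exchanging the two coordinates puts h at the conditioning coordinate. The weight
    can then be averaged over the slice first, with a bound uniform in x.\<close>
  also have "(\<integral>v. ?u (v N) * (h (v 1))\<^sup>2 \<partial>usph N) = (\<integral>v. ?u (v 1) * (h (v N))\<^sup>2 \<partial>usph N)"
    using IN I1 ne by (intro usph_pair(1)) auto
  also have "\<dots> = (\<integral>x. (\<integral>w. ?u (glue n x w 1) \<partial>usph n) * (h x)\<^sup>2 \<partial>?M)"
    using usph_slices(3)[OF n1 iu[OF I1 IN, unfolded N_def]] by (simp add: N_def)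
  also have "\<dots> \<le> (\<integral>x. K * (h x)\<^sup>2 \<partial>?M)"
  proof (rule integral_mono_AE)
    show "integrable ?M (\<lambda>x. (\<integral>w. ?u (glue n x w 1) \<partial>usph n) * (h x)\<^sup>2)"
      using usph_slices(2)[OF n1 iu[OF I1 IN, unfolded N_def]] by (simp add: N_def)
    show "integrable ?M (\<lambda>x. K * (h x)\<^sup>2)" using L2f_sq[OF hL] by simp
    show "AE x in ?M. (\<integral>w. ?u (glue n x w 1) \<partial>usph n) * (h x)\<^sup>2 \<le> K * (h x)\<^sup>2"
      using AE_marg_bound[OF N(3)]
    proof eventually_elim
      case (elim x)
      show ?case
        using slice_quadratic_moment[OF n2 elim[unfolded N_def]] by (intro mult_right_mono) (auto simp: K_def)
    qed
  qed
  also have "\<dots> = K * (\<integral>x. (h x)\<^sup>2 \<partial>?M)" by simp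
  also have "(\<integral>x. (h x)\<^sup>2 \<partial>?M) \<le> (real N + 1) / (real N * (real N - 2)) * (\<integral>v. (G v)\<^sup>2 \<partial>usph N)"
  proof -
    have "real N * (real N - 2) / (real N + 1) * (\<integral>x. (h x)\<^sup>2 \<partial>?M) \<le> (\<integral>v. (G v)\<^sup>2 \<partial>usph N)"
      using sum_sq_lower[OF N(1) hL] g by (simp add: h_def G_def)
    moreover have "a * b / c * x \<le> y \<Longrightarrow> x \<le> c / (a * b) * y" if "a > 0" "b > 0" "c > 0" for a b c x y :: real
      using that by (simp add: field_simps)
    ultimately show ?thesis using N by simp
  qed
  also have "(\<integral>v. (G v)\<^sup>2 \<partial>usph N) = (\<integral>v. (F v)\<^sup>2 \<partial>usph N)"
    using FG by (intro integral_cong_AE) auto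
  finally have "(\<integral>x. ?u x * slice_var n F x \<partial>?M) \<le> C * (K * ((real N + 1) / (real N * (real N - 2)) * (\<integral>v. (F v)\<^sup>2 \<partial>usph N)))"
    using C0 K0 by (simp add: mult_left_mono)
  also have "\<dots> = C * K * ((real N + 1) / (real N * (real N - 2))) * (\<integral>v. (F v)\<^sup>2 \<partial>usph N)" by simp
  also have "C * K * ((real N + 1) / (real N * (real N - 2)))
     = (real n + 4) * (2 * (real n)\<^sup>2 + 2 * real n - 1) / ((real n)\<^sup>2 * (real n + 1)\<^sup>2 * (real n - 1))"
  proof -
    have "r * (r + 4) / (r + 1) * (A / (r * (r + 2)) / r\<^sup>2) * ((r + 2) / ((r + 1) * (r - 1))) = (r + 4) * A / (r\<^sup>2 * (r + 1)\<^sup>2 * (r - 1))"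
      if "r > 1" for r A :: real
    proof -
      have "r \<noteq> 0" "r + 1 \<noteq> 0" "r + 2 \<noteq> 0" "r - 1 \<noteq> 0" using that by auto
      then show ?thesis by (simp add: divide_simps power2_eq_square)
    qed
    from this[of "real n" "2 * (real n)\<^sup>2 + 2 * real n - 1"] show ?thesis
      using n by (simp add: C_def K_def N_def add.commute)
  qed
  finally show ?thesis by (simp add: F_def N_def)
qed

section \<open>Integrability of the summand\<close>

lemma radial_map_deriv:
  fixes \<rho> :: real
  assumes "\<rho> > 0"
  shows "((\<lambda>t. c * t / sqrt (t\<^sup>2 + \<rho>\<^sup>2)) has_real_derivative c * \<rho>\<^sup>2 / sqrt (t\<^sup>2 + \<rho>\<^sup>2) ^ 3) (at t)"
proof -
  define s where "s = sqrt (t\<^sup>2 + \<rho>\<^sup>2)"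
  have p: "t\<^sup>2 + \<rho>\<^sup>2 > 0" using assms by (simp add: add_nonneg_pos)
  have s: "s > 0" "s\<^sup>2 = t\<^sup>2 + \<rho>\<^sup>2" using p by (simp_all add: s_def)
  have "((\<lambda>t. c * t / sqrt (t\<^sup>2 + \<rho>\<^sup>2)) has_real_derivative (c * s - c * t * (t / s)) / (s * s)) (at t)"
    unfolding s_def using p by (auto intro!: derivative_eq_intros simp: divide_simps)
  moreover have "(c * s - c * t * (t / s)) / (s * s) = c * \<rho>\<^sup>2 / s ^ 3"
  proof -
    have "c * s - c * t * (t / s) = c * (s\<^sup>2 - t\<^sup>2) / s"
      using s(1) by (simp add: diff_divide_distrib right_diff_distrib power2_eq_square)
    also have "s\<^sup>2 - t\<^sup>2 = \<rho>\<^sup>2" by (simp add: s(2))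
    finally have "c * s - c * t * (t / s) = c * \<rho>\<^sup>2 / s" .
    then show ?thesis by (simp add: power3_eq_cube)
  qed
  ultimately show ?thesis by (simp add: s_def)
qed

text \<open>Change of variable t -> c t / sqrt(t^2 + \<rho>^2) at a fixed norm \<rho>. Inside the
  unit ball the denominator of its derivative is at most one, so the derivative is at least c
  \<rho>^2.\<close>

lemma radial_preimage:
  fixes B :: "real set"
  assumes \<rho>: "\<rho> > 0" and c: "c > 0" and B[measurable]: "B \<in> sets borel"
  shows "ennreal (c * \<rho>\<^sup>2) * (\<integral>\<^sup>+t. indicator B (c * t / sqrt (t\<^sup>2 + \<rho>\<^sup>2)) * indicator {t. t\<^sup>2 + \<rho>\<^sup>2 \<le> 1} t \<partial>lborel) \<le> emeasure lborel B"
proof -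
  let ?g = "\<lambda>t. c * t / sqrt (t\<^sup>2 + \<rho>\<^sup>2)" and ?g' = "\<lambda>t. c * \<rho>\<^sup>2 / sqrt (t\<^sup>2 + \<rho>\<^sup>2) ^ 3"
  have p: "t\<^sup>2 + \<rho>\<^sup>2 > 0" for t using \<rho> by (simp add: add_nonneg_pos)
  have "(\<integral>\<^sup>+x. ennreal (indicator B x * indicator {?g (-1)..?g 1} x) \<partial>lborel)
      = (\<integral>\<^sup>+x. ennreal (indicator B (?g x) * ?g' x * indicator {-1..1} x) \<partial>lborel)"
  proof (rule nn_integral_substitution[where a="-1" and b=1 and g="?g" and f="indicator B"])
    show "set_borel_measurable borel {?g (-1)..?g 1} (indicator B :: real \<Rightarrow> real)"
      unfolding set_borel_measurable_def by measurable
    show "continuous_on {-1..1} ?g'"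
      using p by (intro continuous_intros) (auto simp: less_imp_neq[symmetric])
    show "0 \<le> ?g' t" if "t \<in> {-1..1}" for t using c by simp
    show "(?g has_real_derivative ?g' t) (at t)" for t by (rule radial_map_deriv[OF \<rho>])
  qed auto
  also have "\<dots> \<ge> (\<integral>\<^sup>+t. ennreal (c * \<rho>\<^sup>2) * (indicator B (?g t) * indicator {t. t\<^sup>2 + \<rho>\<^sup>2 \<le> 1} t) \<partial>lborel)"
  proof (rule nn_integral_mono)
    fix t :: real
    show "ennreal (c * \<rho>\<^sup>2) * (indicator B (?g t) * indicator {t. t\<^sup>2 + \<rho>\<^sup>2 \<le> 1} t) \<le> ennreal (indicator B (?g t) * ?g' t * indicator {-1..1} t)"
    proof (cases "t\<^sup>2 + \<rho>\<^sup>2 \<le> 1 \<and> ?g t \<in> B")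
      case True
      then have "t\<^sup>2 \<le> 1" using zero_le_power2[of \<rho>] by linarith
      then have t: "t \<in> {-1..1}" by (auto simp: abs_square_le_1 abs_le_iff)
      have "sqrt (t\<^sup>2 + \<rho>\<^sup>2) ^ 3 \<le> 1"
        using True by (intro power_le_one) auto
      then have "c * \<rho>\<^sup>2 \<le> ?g' t"
        using c p[of t] by (simp add: pos_le_divide_eq mult_left_le)
      then show ?thesis using True t by (simp add: ennreal_leI)
    qed auto
  qed
  finally have "(\<integral>\<^sup>+t. ennreal (c * \<rho>\<^sup>2) * (indicator B (?g t) * indicator {t. t\<^sup>2 + \<rho>\<^sup>2 \<le> 1} t) \<partial>lborel)
     \<le> (\<integral>\<^sup>+x. ennreal (indicator B x * indicator {?g (-1)..?g 1} x) \<partial>lborel)" .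
  also have "\<dots> \<le> (\<integral>\<^sup>+x. indicator B x \<partial>lborel)"
    by (intro nn_integral_mono) (auto simp: indicator_def)
  finally show ?thesis
    by (subst (asm) nn_integral_cmult) (simp_all)
qed

text \<open>The estimate of \<open>radial_preimage\<close> degenerates as the norm tends to 0, so
  norms up to e are bounded by volume alone, with t in [-1, 1]. A uniform multiple of Lebesgue
  measure would not do: in dimension two the law of a coordinate has unbounded density.\<close>

lemma marg_le_lborel:
  assumes k: "k \<ge> 1" and e: "e > 0" and B[measurable]: "B \<in> sets borel"
  shows "emeasure (marg (Suc k)) B * ennreal (unit_ball_vol (real (Suc k)))
    \<le> ennreal (2 * unit_ball_vol (real k) * e ^ k) + ennreal (unit_ball_vol (real k) / e\<^sup>2) * emeasure lborel B"
proof -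
  interpret u: prob_space "usph k" by (rule prob_space_usph)
  let ?c = "sqrt (real (Suc k))"
  let ?V = "unit_ball_vol (real (Suc k))"
  define J where "J r = (\<integral>\<^sup>+t. indicator B (?c * t / sqrt (t\<^sup>2 + r\<^sup>2)) * indicator {t. t\<^sup>2 + r\<^sup>2 \<le> 1} t \<partial>lborel)" for r
  have V: "?V > 0" by (rule unit_ball_vol_nat_pos)
  have c1: "?c \<ge> 1" by simp
  have m: "(\<lambda>v. indicator B (v (Suc k)) :: ennreal) \<in> borel_measurable (PB (Suc k))"
    by measurable
  have "emeasure (marg (Suc k)) B = (\<integral>\<^sup>+x. indicator B x \<partial>marg (Suc k))" by simp
  also have "\<dots> = (\<integral>\<^sup>+v. indicator B (v (Suc k)) \<partial>usph (Suc k))"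
    unfolding marg_def by (subst nn_integral_distr) (auto intro: nth_measurable_usph)
  also have "\<dots> = (\<integral>\<^sup>+x. J (nrm k x) \<partial>PL k) / ennreal ?V"
    unfolding nn_integral_slices_aux[OF k m] J_def by (simp add: u.emeasure_space_1[simplified])
  finally have eq: "emeasure (marg (Suc k)) B * ennreal ?V = (\<integral>\<^sup>+x. J (nrm k x) \<partial>PL k)"
    using less_imp_neq[OF V, symmetric] V by (simp add: ennreal_divide_times ennreal_mult_divide_eq)
  have J0: "J r = 0" if "r > 1" for r
  proof -
    have "\<not> t\<^sup>2 + r\<^sup>2 \<le> 1" for t
      using one_less_power[OF that, of 2] zero_le_power2[of t] by linarith
    then show ?thesis by (simp add: J_def)
  qed
  have J2: "J r \<le> 2" for r
  proof -
    have "J r \<le> (\<integral>\<^sup>+t. indicator {-1..1::real} t \<partial>lborel)"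
      unfolding J_def
    proof (rule nn_integral_mono)
      fix t :: real
      have "t\<^sup>2 + r\<^sup>2 \<le> 1 \<Longrightarrow> t \<in> {-1..1}"
      proof -
        assume "t\<^sup>2 + r\<^sup>2 \<le> 1"
        then have "t\<^sup>2 \<le> 1" using zero_le_power2[of r] by linarith
        then show ?thesis by (auto simp: abs_square_le_1 abs_le_iff)
      qed
      then show "indicator B (?c * t / sqrt (t\<^sup>2 + r\<^sup>2)) * indicator {t. t\<^sup>2 + r\<^sup>2 \<le> 1} t \<le> (indicator {-1..1} t :: ennreal)"
        by (auto simp: indicator_def)
    qed
    then show ?thesis by simp
  qed
  have J1: "J r \<le> ennreal (1 / e\<^sup>2) * emeasure lborel B" if "r > e" for r
  proof -
    have "J r = ennreal (1 / e\<^sup>2) * (ennreal (e\<^sup>2) * J r)"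
      using e by (simp add: ennreal_mult[symmetric] flip: mult.assoc)
    also have "ennreal (e\<^sup>2) * J r \<le> ennreal (?c * r\<^sup>2) * J r"
    proof (intro mult_right_mono ennreal_leI)
      have "e\<^sup>2 \<le> r\<^sup>2" using e that by (intro power_mono) auto
      also have "\<dots> \<le> ?c * r\<^sup>2" using c1 by (simp add: mult_right_le_one_le mult_le_cancel_right1)
      finally show "e\<^sup>2 \<le> ?c * r\<^sup>2" .
    qed simp
    also have "\<dots> \<le> emeasure lborel B"
      unfolding J_def using e that by (intro radial_preimage) auto
    finally show ?thesis by (simp add: mult_left_mono)
  qed
  have "(\<integral>\<^sup>+x. J (nrm k x) \<partial>PL k)
     \<le> (\<integral>\<^sup>+x. 2 * indicator {x \<in> {1..k} \<rightarrow>\<^sub>E UNIV. nrm k x \<le> e} x + ennreal (1 / e\<^sup>2) * emeasure lborel B * indicator (unit_ball_PL k) x \<partial>PL k)"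
  proof (rule nn_integral_mono)
    fix x assume "x \<in> space (PL k)"
    then have x: "x \<in> {1..k} \<rightarrow>\<^sub>E UNIV" by (simp add: space_PL)
    consider "nrm k x > 1" | "nrm k x \<le> e" | "nrm k x \<le> 1" "nrm k x > e" by linarith
    then show "J (nrm k x) \<le> 2 * indicator {x \<in> {1..k} \<rightarrow>\<^sub>E UNIV. nrm k x \<le> e} x + ennreal (1 / e\<^sup>2) * emeasure lborel B * indicator (unit_ball_PL k) x"
    proof cases
      case 1
      then show ?thesis by (simp add: J0)
    next
      case 2
      then show ?thesis using J2[of "nrm k x"] x by (auto intro: order_trans[OF J2] simp: add_increasing2)
    next
      case 3
      then show ?thesis using J1[of "nrm k x"] x by simp
    qed
  qed
  also have "\<dots> = 2 * ennreal (unit_ball_vol (real k) * e ^ k) + ennreal (1 / e\<^sup>2) * emeasure lborel B * ennreal (unit_ball_vol (real k))"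
  proof -
    have s: "{x \<in> {1..k} \<rightarrow>\<^sub>E UNIV. nrm k x \<le> e} \<in> sets (PB k)"
      unfolding space_PB[symmetric] by measurable
    show ?thesis
      using s by (subst nn_integral_add) (auto simp: nn_integral_cmult PL_ball[OF e] emeasure_unit_ball_PL)
  qed
  also have "\<dots> = ennreal (2 * unit_ball_vol (real k) * e ^ k) + ennreal (unit_ball_vol (real k) / e\<^sup>2) * emeasure lborel B"
  proof -
    have "ennreal (1 / e\<^sup>2) * emeasure lborel B * ennreal (unit_ball_vol (real k)) = (ennreal (unit_ball_vol (real k)) * ennreal (1 / e\<^sup>2)) * emeasure lborel B"
      by (simp only: mult.commute mult.left_commute)
    also have "ennreal (unit_ball_vol (real k)) * ennreal (1 / e\<^sup>2) = ennreal (unit_ball_vol (real k) / e\<^sup>2)"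
      by (subst ennreal_mult[symmetric]) simp_all
    moreover have "2 * ennreal (unit_ball_vol (real k) * e ^ k) = ennreal (2 * unit_ball_vol (real k) * e ^ k)"
      using e by (simp add: ennreal_mult mult.assoc)
    ultimately show ?thesis by simp
  qed
  finally show ?thesis using eq by simp
qed

lemma marg_abs_cont:
  assumes n: "n \<ge> 2" and \<epsilon>: "\<epsilon> > 0"
  obtains \<delta> where "\<delta> > 0" "\<And>B. B \<in> sets borel \<Longrightarrow> emeasure lborel B \<le> ennreal \<delta> \<Longrightarrow> measure (marg n) B \<le> \<epsilon>"
proof -
  define k where "k = n - 1"
  have k: "n = Suc k" "k \<ge> 1" using n by (auto simp: k_def)
  interpret m: prob_space "marg n" using n by (intro prob_space_marg) auto
  define V where "V = unit_ball_vol (real (Suc k))"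
  define U where "U = unit_ball_vol (real k)"
  have V: "V > 0" and U: "U > 0" by (simp_all only: V_def U_def unit_ball_vol_nat_pos)
  \<comment> \<open>The cap at 1 replaces e^k by e, and the other entry makes the first term of
    \<open>marg_le_lborel\<close> at most half of \<epsilon> V. The choice of \<delta> below spends
    the other half.\<close>
  define e where "e = min 1 (\<epsilon> * V / (4 * U))"
  have e: "0 < e" "e \<le> 1" using \<epsilon> U V by (auto simp: e_def)
  have ek: "2 * U * e ^ k \<le> \<epsilon> * V / 2"
  proof -
    have "e ^ k \<le> e ^ 1" using e k by (intro power_decreasing) auto
    also have "\<dots> \<le> \<epsilon> * V / (4 * U)" by (simp add: e_def)
    finally show ?thesis using U by (simp add: field_simps)
  qed
  define \<delta> where "\<delta> = \<epsilon> * V * e\<^sup>2 / (2 * U)"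
  show thesis
  proof
    show "\<delta> > 0" using \<epsilon> e U V by (simp add: \<delta>_def)
    fix B :: "real set" assume B: "B \<in> sets borel" and le: "emeasure lborel B \<le> ennreal \<delta>"
    have "ennreal (measure (marg n) B * V) = emeasure (marg (Suc k)) B * ennreal V"
      using V by (simp add: m.emeasure_eq_measure k(1)[symmetric] ennreal_mult)
    also have "\<dots> \<le> ennreal (2 * U * e ^ k) + ennreal (U / e\<^sup>2) * emeasure lborel B"
      using marg_le_lborel[OF k(2) e(1) B] by (simp add: U_def V_def)
    also have "\<dots> \<le> ennreal (2 * U * e ^ k) + ennreal (U / e\<^sup>2) * ennreal \<delta>"
      by (intro add_left_mono mult_left_mono le) simp
    also have "\<dots> = ennreal (2 * U * e ^ k + U / e\<^sup>2 * \<delta>)"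
      using U e \<open>\<delta> > 0\<close> by (subst ennreal_mult[symmetric], simp, simp, subst ennreal_plus) simp_all
    finally have "measure (marg n) B * V \<le> 2 * U * e ^ k + U / e\<^sup>2 * \<delta>"
      using U e \<open>\<delta> > 0\<close> by (subst (asm) ennreal_le_iff) auto
    also have "U / e\<^sup>2 * \<delta> = \<epsilon> * V / 2" using U e by (simp add: \<delta>_def field_simps)
    finally have "measure (marg n) B * V \<le> \<epsilon> * V" using ek by simp
    then show "measure (marg n) B \<le> \<epsilon>" using V by simp
  qed
qed

text \<open>The function is finite everywhere, so the sets where its modulus exceeds m decrease to
  the empty set; the restriction to |x| <= R makes their measures finite, as continuity from above
  requires.\<close>

lemma sublevel_complement_small:
  fixes \<phi> :: "real \<Rightarrow> real"
  assumes [measurable]: "\<phi> \<in> borel_measurable borel" and \<delta>: "\<delta> > 0"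
  obtains m :: nat where "emeasure lborel {x. \<bar>x\<bar> \<le> R \<and> \<bar>\<phi> x\<bar> > real m} \<le> ennreal \<delta>"
proof -
  let ?A = "\<lambda>m::nat. {x :: real. \<bar>x\<bar> \<le> R \<and> \<bar>\<phi> x :: real\<bar> > real m}"
  have "(\<lambda>m. emeasure lborel (?A m)) \<longlonglongrightarrow> emeasure lborel (\<Inter>m. ?A m)"
  proof (rule Lim_emeasure_decseq)
    show "range ?A \<subseteq> sets lborel" by auto
    show "decseq ?A" by (auto simp: decseq_def)
    fix m
    have "emeasure lborel (?A m) \<le> emeasure lborel {-R..R}"
      by (intro emeasure_mono) auto
    also have "\<dots> < \<infinity>" by (simp add: emeasure_lborel_Icc_eq)
    finally show "emeasure lborel (?A m) \<noteq> \<infinity>" by simp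
  qed
  moreover have "(\<Inter>m. ?A m) = {}"
  proof -
    have "\<exists>m::nat. \<not> \<bar>\<phi> x\<bar> > real m" for x using real_arch_simple[of "\<bar>\<phi> x\<bar>"] by (auto simp: not_less)
    then show ?thesis by blast
  qed
  ultimately have "(\<lambda>m. emeasure lborel (?A m)) \<longlonglongrightarrow> 0" by simp
  then have "\<forall>\<^sub>F m in sequentially. emeasure lborel (?A m) < ennreal \<delta>"
    using \<delta> by (intro order_tendstoD) auto
  then obtain m where "emeasure lborel (?A m) < ennreal \<delta>" by (auto dest!: eventually_happens)
  then show thesis by (intro that[of m]) simp
qed

text \<open>The bound M must be uniform in x. For x^2 <= N/2 the slice factor is at least 1/2, so
  rescaling at most doubles the Lebesgue measure of the exceptional set. Each coordinate then hits
  it with probability at most 1/(2n), and the union bound leaves one half.\<close>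

lemma slice_good_prob:
  assumes n: "n \<ge> 2" and \<phi>[measurable]: "\<phi> \<in> borel_measurable borel"
  obtains M :: real where "M \<ge> 0" "\<And>x. x\<^sup>2 \<le> real (Suc n) / 2 \<Longrightarrow>
     measure (usph n) {w \<in> space (usph n). \<forall>j\<in>{1..n}. \<bar>\<phi> (slice_factor n x * w j)\<bar> \<le> M} \<ge> 1/2"
proof -
  define N where "N = Suc n"
  interpret u: prob_space "usph n" by (rule prob_space_usph)
  obtain \<delta> where \<delta>: "\<delta> > 0" "\<And>B. B \<in> sets borel \<Longrightarrow> emeasure lborel B \<le> ennreal \<delta> \<Longrightarrow> measure (marg n) B \<le> 1 / (2 * real n)"
    using marg_abs_cont[OF n, of "1 / (2 * real n)"] n by auto
  obtain m :: nat where m: "emeasure lborel {x. \<bar>x\<bar> \<le> sqrt (real N) \<and> \<bar>\<phi> x\<bar> > real m} \<le> ennreal (\<delta> / 2)"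
    using sublevel_complement_small[OF \<phi>, of "\<delta> / 2"] \<delta> by auto
  define B where "B = {x. \<bar>x\<bar> \<le> sqrt (real N) \<and> \<bar>\<phi> x\<bar> > real m}"
  have [measurable]: "B \<in> sets borel" unfolding B_def by measurable
  show thesis
  proof (rule that[of "real m"])
    fix x :: real assume x: "x\<^sup>2 \<le> real (Suc n) / 2"
    define s where "s = slice_factor n x"
    have x2: "x\<^sup>2 \<le> real (Suc n)" using x by simp
    have s2: "s\<^sup>2 = (real N - x\<^sup>2) / real n" using slice_factor_sq[OF _ x2] n by (simp add: s_def N_def)
    have s0: "s \<ge> 0" using x2 by (simp add: s_def slice_factor_def)
    have "(1/2)\<^sup>2 \<le> s\<^sup>2"
    proof -
      have "real n * (1/4) \<le> real N - x\<^sup>2" using x by (simp add: N_def)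
      then show ?thesis using n unfolding s2 by (simp add: pos_le_divide_eq power2_eq_square)
    qed
    then have s: "s \<ge> 1/2" using power2_le_imp_le[of "1/2" s] s0 by simp
    have small: "measure (marg n) {y. s * y \<in> B} \<le> 1 / (2 * real n)"
    proof (rule \<delta>(2))
      show "{y. s * y \<in> B} \<in> sets borel" by measurable
      have "ennreal (1/2) * emeasure lborel {y. s * y \<in> B} \<le> ennreal s * emeasure lborel {y. s * y \<in> B}"
        using s by (intro mult_right_mono ennreal_leI) auto
      also have "\<dots> = emeasure lborel B" using s by (intro emeasure_lborel_scale) auto
      also have "\<dots> \<le> ennreal (\<delta> / 2)" using m by (simp add: B_def)
      finally have "2 * (ennreal (1/2) * emeasure lborel {y. s * y \<in> B}) \<le> 2 * ennreal (\<delta> / 2)"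
        by (intro mult_left_mono) auto
      moreover have "2 * (ennreal (1/2) * z) = z" for z
      proof -
        have "2 * ennreal (1/2) = ennreal (2 * (1/2))" by (subst ennreal_mult) auto
        then show ?thesis by (simp add: mult.assoc[symmetric])
      qed
      moreover have "2 * ennreal (\<delta> / 2) = ennreal \<delta>"
      proof -
        have "ennreal (2 * (\<delta> / 2)) = 2 * ennreal (\<delta> / 2)" using \<delta>(1) by (subst ennreal_mult) auto
        then show ?thesis by simp
      qed
      ultimately show "emeasure lborel {y. s * y \<in> B} \<le> ennreal \<delta>" by simp
    qed
    let ?G = "{w \<in> space (usph n). \<forall>j\<in>{1..n}. \<bar>\<phi> (s * w j)\<bar> \<le> real m}"
    have G: "?G \<in> sets (usph n)"
    proof -
      have "{w \<in> space (PB n). \<forall>j\<in>{1..n}. \<bar>\<phi> (s * w j)\<bar> \<le> real m} \<in> sets (PB n)" by measurable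
      then show ?thesis by (simp add: space_PB)
    qed
    let ?E = "\<lambda>j. {w \<in> space (usph n). s * w j \<in> B}"
    have E: "?E j \<in> sets (usph n)" if "j \<in> {1..n}" for j
    proof -
      have "{w \<in> space (PB n). s * w j \<in> B} \<in> sets (PB n)" using that by measurable
      then show ?thesis by (simp add: space_PB)
    qed
    have Ep: "u.prob (?E j) \<le> 1 / (2 * real n)" if j: "j \<in> {1..n}" for j
    proof -
      have Bm: "{y. s * y \<in> B} \<in> sets borel" by measurable
      have "measure (marg n) {y. s * y \<in> B} = u.prob ((\<lambda>w. w j) -` {y. s * y \<in> B} \<inter> space (usph n))"
        unfolding usph_coordinate_law[OF j, symmetric] by (rule measure_distr[OF nth_measurable_usph[OF j] Bm])
      also have "(\<lambda>w. w j) -` {y. s * y \<in> B} \<inter> space (usph n) = ?E j" by auto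
      finally show ?thesis using small by simp
    qed
    have bad: "AE w in usph n. w \<in> space (usph n) - ?G \<longrightarrow> w \<in> (\<Union>j\<in>{1..n}. ?E j)"
    proof -
      have "AE w in usph n. \<forall>j\<in>{1..n}. (w j)\<^sup>2 \<le> real n"
        using AE_usph_bound by (intro AE_finite_allI) auto
      then show ?thesis
      proof eventually_elim
        case (elim w)
        have "\<bar>s * w j\<bar> \<le> sqrt (real N)" if "j \<in> {1..n}" for j
        proof -
          have "(s * w j)\<^sup>2 \<le> (real N / real n) * real n"
            unfolding power_mult_distrib s2 using elim that by (intro mult_mono divide_right_mono) auto
          then have "(s * w j)\<^sup>2 \<le> real N" using n by simp
          then show ?thesis by (rule abs_le_of_sq)
        qed
        then show ?case by (auto simp: B_def not_le)
      qed
    qed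
    have "u.prob (space (usph n) - ?G) \<le> u.prob (\<Union>j\<in>{1..n}. ?E j)"
      using bad E by (intro u.finite_measure_mono_AE) auto
    also have "\<dots> \<le> (\<Sum>j\<in>{1..n}. u.prob (?E j))"
      using E by (intro u.finite_measure_subadditive_finite) auto
    also have "\<dots> \<le> (\<Sum>j\<in>{1..n}. 1 / (2 * real n))" by (intro sum_mono Ep)
    also have "\<dots> = 1/2" using n by simp
    finally have "u.prob (space (usph n) - ?G) \<le> 1/2" .
    then have "1 - u.prob ?G \<le> 1/2" using u.prob_compl[OF G] by (simp only:)
    then show "measure (usph n) {w \<in> space (usph n). \<forall>j\<in>{1..n}. \<bar>\<phi> (slice_factor n x * w j)\<bar> \<le> real m} \<ge> 1/2"
      unfolding s_def by linarith
  qed simp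
qed

text \<open>Square integrability of the sum alone does not obviously pass to \<open>\<phi>\<close> (it fails for \<open>N = 2\<close>).
  A coordinate with \<open>(v j)\<^sup>2 \<le> N/2\<close> leaves room for all others to lie, with probability at least
  one half, where \<open>\<phi>\<close> is bounded; if \<open>(v j)\<^sup>2 > N/2\<close>, then all other coordinates are of the first kind.\<close>

lemma sum_L2f_imp:
  assumes n: "n \<ge> 2" and \<phi>[measurable]: "\<phi> \<in> borel_measurable borel"
    and F: "(\<lambda>v. \<Sum>j=1..Suc n. \<phi> (v j)) \<in> L2f (usph (Suc n))"
  shows "\<phi> \<in> L2f (marg (Suc n))"
proof -
  define N where "N = Suc n"
  have n1: "n \<ge> 1" and N1: "N \<ge> 1" and IN: "N \<in> {1..N}" using n by (auto simp: N_def)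
  interpret u: prob_space "usph n" by (rule prob_space_usph)
  define S where "S = (\<lambda>v. \<Sum>j=1..N. \<phi> (v j))"
  have SL: "S \<in> L2f (usph N)" using F by (simp add: S_def N_def)
  have S_split: "S v = \<phi> (v N) + (\<Sum>j=1..n. \<phi> (v j))" for v by (simp add: S_def N_def)
  obtain M where M: "M \<ge> 0" "\<And>x. x\<^sup>2 \<le> real N / 2 \<Longrightarrow>
     measure (usph n) {w \<in> space (usph n). \<forall>j\<in>{1..n}. \<bar>\<phi> (slice_factor n x * w j)\<bar> \<le> M} \<ge> 1/2"
    using slice_good_prob[OF n \<phi>] unfolding N_def by blast
  define \<phi>1 where "\<phi>1 = (\<lambda>x. \<phi> x * indicator {x. x\<^sup>2 \<le> real N / 2} x)"
  define \<phi>2 where "\<phi>2 = (\<lambda>x. \<phi> x * indicator {x. x\<^sup>2 > real N / 2} x)"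
  have [measurable]: "\<phi>1 \<in> borel_measurable borel" "\<phi>2 \<in> borel_measurable borel"
    unfolding \<phi>1_def \<phi>2_def by measurable
  define G where "G = {v \<in> space (PB N). \<forall>j\<in>{1..n}. \<bar>\<phi> (v j)\<bar> \<le> M}"
  have [measurable]: "G \<in> sets (PB N)"
  proof -
    have "{1..n} \<subseteq> {1..N}" by (auto simp: N_def)
    then have "j \<in> {1..n} \<Longrightarrow> j \<in> {1..N}" for j by auto
    then show ?thesis unfolding G_def by measurable
  qed
  let ?H = "\<lambda>v. ennreal ((\<phi>1 (v N))\<^sup>2) * indicator G v"
  have Hm: "?H \<in> borel_measurable (PB N)" using IN by measurable
  \<comment> \<open>On G the other n values of \<phi> are at most M in modulus, so the value at the
    last coordinate is controlled by the square integrable sum S.\<close>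
  have "(\<integral>\<^sup>+v. ?H v \<partial>usph N) \<le> (\<integral>\<^sup>+v. ennreal ((\<bar>S v\<bar> + real n * M)\<^sup>2) \<partial>usph N)"
  proof (rule nn_integral_mono)
    fix v
    show "?H v \<le> ennreal ((\<bar>S v\<bar> + real n * M)\<^sup>2)"
    proof (cases "v \<in> G")
      case True
      have "\<bar>\<Sum>j=1..n. \<phi> (v j)\<bar> \<le> (\<Sum>j=1..n. \<bar>\<phi> (v j)\<bar>)" by (rule sum_abs)
      also have "\<dots> \<le> (\<Sum>j=1..n. M)" using True by (intro sum_mono) (auto simp: G_def)
      finally have "\<bar>\<phi> (v N)\<bar> \<le> \<bar>S v\<bar> + real n * M" using S_split[of v] by simp
      moreover have "\<bar>\<phi>1 (v N)\<bar> \<le> \<bar>\<phi> (v N)\<bar>" by (auto simp: \<phi>1_def indicator_def)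
      ultimately have "\<bar>\<phi>1 (v N)\<bar> \<le> \<bar>S v\<bar> + real n * M" by simp
      from power_mono[OF this abs_ge_zero, of 2] show ?thesis using True by (simp add: ennreal_leI)
    qed simp
  qed
  also have "\<dots> < \<infinity>"
  proof -
    have "(\<lambda>v. \<bar>S v\<bar>) \<in> L2f (usph N)" using SL by (auto simp: L2f_def)
    then have "(\<lambda>v. \<bar>S v\<bar> + real n * M) \<in> L2f (usph N)"
      by (intro L2f_add L2f_const finite_measure_usph)
    from integrableD(2)[OF L2f_sq[OF this]] show ?thesis by (simp add: top.not_eq_extremum)
  qed
  finally have fin: "(\<integral>\<^sup>+v. ?H v \<partial>usph N) < \<infinity>" .
  \<comment> \<open>Conditioning on the last coordinate removes the indicator of G at the price of a
    factor 2, because G has conditional probability at least 1/2 wherever \<phi>1 is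
    nonzero.\<close>
  have "(\<integral>\<^sup>+v. ennreal ((\<phi>1 (v N))\<^sup>2) * ennreal (1/2) \<partial>usph N)
      \<le> (\<integral>\<^sup>+v. \<integral>\<^sup>+w. ?H (glue n (v N) w) \<partial>usph n \<partial>usph N)"
  proof (rule nn_integral_mono)
    fix v :: "nat \<Rightarrow> real"
    define x where "x = v N"
    let ?G = "{w \<in> space (usph n). \<forall>j\<in>{1..n}. \<bar>\<phi> (slice_factor n x * w j)\<bar> \<le> M}"
    have Gs: "?G \<in> sets (usph n)"
    proof -
      have "{w \<in> space (PB n). \<forall>j\<in>{1..n}. \<bar>\<phi> (slice_factor n x * w j)\<bar> \<le> M} \<in> sets (PB n)" by measurable
      then show ?thesis by (simp add: space_PB)
    qed
    have gl: "glue n x w \<in> space (PB N)" if "w \<in> space (usph n)" for w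
      using measurable_space[OF glue_measurable1, of w n x] that by (simp add: space_PB N_def)
    have "(\<integral>\<^sup>+w. ?H (glue n x w) \<partial>usph n) = (\<integral>\<^sup>+w. ennreal ((\<phi>1 x)\<^sup>2) * indicator ?G w \<partial>usph n)"
    proof (rule nn_integral_cong)
      fix w assume w: "w \<in> space (usph n)"
      have "indicator G (glue n x w) = (indicator ?G w :: ennreal)"
        using w gl[OF w] unfolding G_def indicator_def by (auto simp: glue_nth)
      then show "?H (glue n x w) = ennreal ((\<phi>1 x)\<^sup>2) * indicator ?G w" by (simp add: N_def)
    qed
    also have "\<dots> = ennreal ((\<phi>1 x)\<^sup>2) * ennreal (u.prob ?G)"
      using Gs by (simp add: nn_integral_cmult u.emeasure_eq_measure)
    finally have eq: "(\<integral>\<^sup>+w. ?H (glue n x w) \<partial>usph n) = ennreal ((\<phi>1 x)\<^sup>2) * ennreal (u.prob ?G)" .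
    show "ennreal ((\<phi>1 (v N))\<^sup>2) * ennreal (1/2) \<le> (\<integral>\<^sup>+w. ?H (glue n (v N) w) \<partial>usph n)"
    proof (cases "x\<^sup>2 \<le> real N / 2")
      case True
      show ?thesis
        unfolding x_def[symmetric] eq by (intro mult_left_mono ennreal_leI M(2) True) simp
    next
      case False
      then show ?thesis by (simp add: \<phi>1_def x_def)
    qed
  qed
  also have "\<dots> = (\<integral>\<^sup>+v. ?H v \<partial>usph N)"
    using nn_integral_slices[OF n1 Hm[unfolded N_def]] by (simp only: N_def)
  finally have "(\<integral>\<^sup>+v. ennreal ((\<phi>1 (v N))\<^sup>2) * ennreal (1/2) \<partial>usph N) < \<infinity>" using fin by (rule le_less_trans)
  then have f1: "(\<integral>\<^sup>+v. ennreal ((\<phi>1 (v N))\<^sup>2) \<partial>usph N) < \<infinity>"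
    using IN by (subst (asm) nn_integral_multc) (auto simp: ennreal_mult_less_top)
  have lift: "h \<in> L2f (marg N)" if "h \<in> borel_measurable borel" "integrable (usph N) (\<lambda>v. (h (v N))\<^sup>2)" for h :: "real \<Rightarrow> real"
    using that usph_coordinate(2)[OF IN, of "\<lambda>x. (h x)\<^sup>2"] by (simp add: L2f_def)
  have \<phi>1L: "\<phi>1 \<in> L2f (marg N)"
  proof (rule lift)
    show "integrable (usph N) (\<lambda>v. (\<phi>1 (v N))\<^sup>2)"
      using f1 IN by (intro integrableI_bounded) auto
  qed simp
  have "(\<lambda>v. \<bar>S v\<bar> + (\<Sum>j=1..n. \<bar>\<phi>1 (v j)\<bar>)) \<in> L2f (usph N)"
  proof -
    have a: "(\<lambda>v. \<bar>f v\<bar>) \<in> L2f (usph N)" if "f \<in> L2f (usph N)" for f using that by (auto simp: L2f_def)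
    show ?thesis
      by (intro L2f_add L2f_sum a SL L2f_coordinate(1) \<phi>1L) (auto simp: N_def)
  qed
  then have "(\<lambda>v. \<phi>2 (v N)) \<in> L2f (usph N)"
  proof (rule L2f_dominated)
    show "(\<lambda>v. \<phi>2 (v N)) \<in> borel_measurable (usph N)" using IN by measurable
    show "AE v in usph N. \<bar>\<phi>2 (v N)\<bar> \<le> \<bar>\<bar>S v\<bar> + (\<Sum>j=1..n. \<bar>\<phi>1 (v j)\<bar>)\<bar>"
      using AE_usph_sphere[OF N1]
    proof eventually_elim
      case (elim v)
      show ?case
      proof (cases "(v N)\<^sup>2 > real N / 2")
        case True
        have tot: "(v N)\<^sup>2 + (\<Sum>j=1..n. (v j)\<^sup>2) = real N"
          using elim by (simp add: kac_sphere_def N_def)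
        have "\<phi> (v j) = \<phi>1 (v j)" if j: "j \<in> {1..n}" for j
        proof -
          have "(v j)\<^sup>2 \<le> (\<Sum>j=1..n. (v j)\<^sup>2)" using j by (intro member_le_sum) auto
          then show ?thesis using tot True by (simp add: \<phi>1_def)
        qed
        then have "(\<Sum>j=1..n. \<phi> (v j)) = (\<Sum>j=1..n. \<phi>1 (v j))" by (intro sum.cong refl)
        then have "\<bar>\<Sum>j=1..n. \<phi> (v j)\<bar> \<le> (\<Sum>j=1..n. \<bar>\<phi>1 (v j)\<bar>)"
          using sum_abs[of "\<lambda>j. \<phi>1 (v j)" "{1..n}"] by simp
        then show ?thesis using S_split[of v] True by (simp add: \<phi>2_def)
      next
        case False
        then show ?thesis by (simp add: \<phi>2_def)
      qed
    qed
  qed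
  then have "\<phi>2 \<in> L2f (marg N)" by (intro lift) (auto simp: L2f_def)
  from L2f_add[OF \<phi>1L this] have "(\<lambda>x. \<phi>1 x + \<phi>2 x) \<in> L2f (marg N)" .
  moreover have "(\<lambda>x. \<phi>1 x + \<phi>2 x) = \<phi>" by (auto simp: \<phi>1_def \<phi>2_def indicator_def fun_eq_iff not_le)
  ultimately show ?thesis by (simp add: N_def)
qed

section \<open>The Dirichlet form on sums of one-variable functions\<close>

text \<open>Averages over angles become integrals over a finite measure space, to which product
  measures apply. The total mass 2 pi is not normalised away.\<close>

abbreviation circ :: "real measure" where
  "circ \<equiv> restrict_space lborel {-pi..pi}"

lemma finite_measure_circ: "finite_measure circ"
  by (intro finite_measureI) (simp add: space_restrict_space emeasure_restrict_space)

lemma measure_circ: "measure circ {-pi..pi} = 2 * pi" "emeasure circ {-pi..pi} = ennreal (2 * pi)"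
  by (simp_all add: emeasure_restrict_space measure_restrict_space)

lemma circ_measurable [measurable (raw)]: "f \<in> borel_measurable borel \<Longrightarrow> f \<in> borel_measurable circ"
  by (rule measurable_restrict_space1) simp

lemma pair_avg_circ: "pair_avg i j f v = (\<integral>\<theta>. f (pair_rot i j \<theta> v) \<partial>circ) / (2 * pi)"
  by (simp add: pair_avg_def set_lebesgue_integral_def integral_restrict_space)

lemma AE_circ_sin: "AE \<theta> in circ. sin \<theta> \<noteq> 0"
proof -
  have "AE \<theta> in lborel. \<theta> \<noteq> -pi \<and> \<theta> \<noteq> 0 \<and> \<theta> \<noteq> pi"
    by (intro AE_conjI AE_lborel_singleton)
  then have "AE \<theta> in lborel. \<theta> \<in> {-pi..pi} \<longrightarrow> sin \<theta> \<noteq> 0"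
  proof eventually_elim
    case (elim \<theta>)
    show ?case
    proof
      assume t: "\<theta> \<in> {-pi..pi}"
      consider "\<theta> > 0" | "\<theta> < 0" using elim by linarith
      then show "sin \<theta> \<noteq> 0"
      proof cases
        case 1
        then show ?thesis using sin_gt_zero[of \<theta>] elim t by auto
      next
        case 2
        then show ?thesis using sin_gt_zero[of "-\<theta>"] elim t by auto
      qed
    qed
  qed
  then show ?thesis by (subst AE_restrict_space_iff) auto
qed

lemma pair_rot_measurable_circ:
  assumes i: "i \<in> {1..n}" "j \<in> {1..n}" and f: "f \<in> measurable (PB n) M"
  shows "(\<lambda>(v, \<theta>). f (pair_rot i j \<theta> v)) \<in> measurable (PB n \<Otimes>\<^sub>M circ) M"
proof -
  have "(\<lambda>z. (fst z, snd z)) \<in> measurable (PB n \<Otimes>\<^sub>M circ) (PB n \<Otimes>\<^sub>M borel)"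
    by (intro measurable_Pair measurable_fst measurable_compose[OF measurable_snd]) measurable
  from measurable_compose[OF this measurable_compose[OF pair_rot_measurable[OF i] f]]
  show ?thesis by (simp add: split_beta)
qed

lemma nn_integral_rot:
  assumes i: "i \<in> {1..n}" "j \<in> {1..n}" "i \<noteq> j" and F[measurable]: "F \<in> borel_measurable (PB n)"
  shows "(\<integral>\<^sup>+v. \<integral>\<^sup>+\<theta>. F (pair_rot i j \<theta> v) \<partial>circ \<partial>usph n) = ennreal (2 * pi) * (\<integral>\<^sup>+v. F v \<partial>usph n)"
proof -
  interpret u: prob_space "usph n" by (rule prob_space_usph)
  interpret c: finite_measure circ by (rule finite_measure_circ)
  interpret p: pair_sigma_finite "usph n" circ ..
  have m: "(\<lambda>(v, \<theta>). F (pair_rot i j \<theta> v)) \<in> borel_measurable (usph n \<Otimes>\<^sub>M circ)"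
    using pair_rot_measurable_circ[OF i(1,2) F] by (simp cong: measurable_cong_sets sets_pair_measure_cong)
  have "(\<integral>\<^sup>+v. \<integral>\<^sup>+\<theta>. F (pair_rot i j \<theta> v) \<partial>circ \<partial>usph n) = (\<integral>\<^sup>+\<theta>. \<integral>\<^sup>+v. F (pair_rot i j \<theta> v) \<partial>usph n \<partial>circ)"
    using p.Fubini'[OF m] by simp
  also have "\<dots> = (\<integral>\<^sup>+\<theta>. (\<integral>\<^sup>+v. F v \<partial>usph n) \<partial>circ)"
  proof (rule nn_integral_cong_AE)
    show "AE \<theta> in circ. (\<integral>\<^sup>+v. F (pair_rot i j \<theta> v) \<partial>usph n) = (\<integral>\<^sup>+v. F v \<partial>usph n)"
      using AE_circ_sin
    proof eventually_elim
      case (elim \<theta>)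
      have "(\<integral>\<^sup>+v. F v \<partial>usph n) = (\<integral>\<^sup>+v. F v \<partial>distr (usph n) (PB n) (pair_rot i j \<theta>))"
        by (simp only: usph_rot[OF i elim])
      also have "\<dots> = (\<integral>\<^sup>+v. F (pair_rot i j \<theta> v) \<partial>usph n)"
        using i by (intro nn_integral_distr) (simp_all add: pair_rot_measurable1 cong: measurable_cong_sets)
      finally show ?case by simp
    qed
  qed
  also have "\<dots> = ennreal (2 * pi) * (\<integral>\<^sup>+v. F v \<partial>usph n)"
    by (simp add: measure_circ(2) space_restrict_space mult.commute)
  finally show ?thesis .
qed

text \<open>A single orbit of the rotation can be a null set, so it is not evident that
  \<open>pair_avg\<close> respects equality almost everywhere. It does for almost every v: by
  \<open>nn_integral_rot\<close> a null set meets almost every orbit in a null set of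
  angles.\<close>

lemma AE_rot:
  assumes i: "i \<in> {1..n}" "j \<in> {1..n}" "i \<noteq> j" and P: "AE v in usph n. P v"
  shows "AE v in usph n. AE \<theta> in circ. P (pair_rot i j \<theta> v)"
proof -
  interpret c: finite_measure circ by (rule finite_measure_circ)
  from P obtain N where N: "{v \<in> space (usph n). \<not> P v} \<subseteq> N" "emeasure (usph n) N = 0" "N \<in> sets (usph n)"
    by (rule AE_E)
  have [measurable]: "N \<in> sets (PB n)" using N by simp
  have mm: "(\<lambda>(v, \<theta>). indicator N (pair_rot i j \<theta> v) :: ennreal) \<in> borel_measurable (PB n \<Otimes>\<^sub>M circ)"
    by (rule pair_rot_measurable_circ[OF i(1,2)]) measurable
  have "(\<integral>\<^sup>+v. \<integral>\<^sup>+\<theta>. indicator N (pair_rot i j \<theta> v) \<partial>circ \<partial>usph n) = 0"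
    using nn_integral_rot[OF i, of "indicator N"] N by simp
  then have "AE v in usph n. (\<integral>\<^sup>+\<theta>. indicator N (pair_rot i j \<theta> v) \<partial>circ) = 0"
    using c.borel_measurable_nn_integral_fst[OF mm] by (subst (asm) nn_integral_0_iff_AE) (simp_all cong: measurable_cong_sets)
  then show ?thesis
    using AE_space
  proof eventually_elim
    case (elim v)
    have v: "v \<in> space (PB n)" using elim by (simp add: space_PB)
    have "(\<lambda>\<theta>. indicator N (pair_rot i j \<theta> v) :: ennreal) \<in> borel_measurable circ"
      using measurable_Pair2[OF mm v] by simp
    then have "AE \<theta> in circ. indicator N (pair_rot i j \<theta> v) = (0 :: ennreal)"
      using elim by (subst (asm) nn_integral_0_iff_AE) auto
    then show ?case
    proof eventually_elim
      case (elim \<theta>)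
      have "pair_rot i j \<theta> v \<in> space (usph n)"
        using measurable_space[OF pair_rot_measurable1[OF i(1,2)] v] by (simp add: space_PB)
      then show ?case using elim N(1) by (auto simp: indicator_def split: if_splits)
    qed
  qed
qed

text \<open>This guarantees that \<open>pair_avg\<close> is a true integral for almost every v and
  not the default value 0.\<close>

lemma AE_rot_L2f:
  assumes i: "i \<in> {1..n}" "j \<in> {1..n}" "i \<noteq> j" and f: "f \<in> L2f (usph n)"
  shows "AE v in usph n. (\<lambda>\<theta>. f (pair_rot i j \<theta> v)) \<in> L2f circ"
proof -
  interpret c: finite_measure circ by (rule finite_measure_circ)
  have fm[measurable]: "f \<in> borel_measurable (PB n)" by (rule L2f_usph_borel[OF f])
  have m1: "(\<lambda>(v, \<theta>). f (pair_rot i j \<theta> v)) \<in> borel_measurable (PB n \<Otimes>\<^sub>M circ)"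
    by (rule pair_rot_measurable_circ[OF i(1,2) fm])
  have m2: "(\<lambda>(v, \<theta>). ennreal ((f (pair_rot i j \<theta> v))\<^sup>2)) \<in> borel_measurable (PB n \<Otimes>\<^sub>M circ)"
    by (rule pair_rot_measurable_circ[OF i(1,2)]) measurable
  have "(\<integral>\<^sup>+v. \<integral>\<^sup>+\<theta>. ennreal ((f (pair_rot i j \<theta> v))\<^sup>2) \<partial>circ \<partial>usph n) = ennreal (2 * pi) * (\<integral>\<^sup>+v. ennreal ((f v)\<^sup>2) \<partial>usph n)"
    by (rule nn_integral_rot[OF i]) measurable
  also have "\<dots> < \<infinity>"
    using integrableD(2)[OF L2f_sq[OF f]] by (simp add: ennreal_mult_less_top top.not_eq_extremum)
  finally have "AE v in usph n. (\<integral>\<^sup>+\<theta>. ennreal ((f (pair_rot i j \<theta> v))\<^sup>2) \<partial>circ) \<noteq> \<infinity>"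
    using c.borel_measurable_nn_integral_fst[OF m2]
    by (intro nn_integral_PInf_AE) (simp_all cong: measurable_cong_sets)
  then show ?thesis
    using AE_space
  proof eventually_elim
    case (elim v)
    have v: "v \<in> space (PB n)" using elim by (simp add: space_PB)
    have "(\<lambda>\<theta>. f (pair_rot i j \<theta> v)) \<in> borel_measurable circ"
      using measurable_Pair2[OF m1 v] by simp
    moreover from this have "integrable circ (\<lambda>\<theta>. (f (pair_rot i j \<theta> v))\<^sup>2)"
      using elim(1) by (intro integrableI_bounded) (auto simp: top.not_eq_extremum)
    ultimately show ?case by (simp add: L2f_def)
  qed
qed

lemma pair_avg_measurable:
  assumes i: "i \<in> {1..n}" "j \<in> {1..n}" and f: "f \<in> borel_measurable (PB n)"
  shows "pair_avg i j f \<in> borel_measurable (PB n)"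
proof -
  interpret c: finite_measure circ by (rule finite_measure_circ)
  have "(\<lambda>v. (\<integral>\<theta>. f (pair_rot i j \<theta> v) \<partial>circ) / (2 * pi)) \<in> borel_measurable (PB n)"
    using c.borel_measurable_lebesgue_integral[OF pair_rot_measurable_circ[OF i f]] by measurable
  then show ?thesis by (simp add: pair_avg_circ[abs_def])
qed

lemma L2_circ_average:
  assumes f: "f \<in> L2f circ"
  shows "((\<integral>\<theta>. f \<theta> \<partial>circ) / (2 * pi))\<^sup>2 \<le> (\<integral>\<theta>. (f \<theta>)\<^sup>2 \<partial>circ) / (2 * pi)"
proof -
  have one: "(\<lambda>\<theta>. 1) \<in> L2f circ" by (rule L2f_const[OF finite_measure_circ])
  define m where "m = (\<integral>\<theta>. f \<theta> \<partial>circ) / (2 * pi)"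
  have i: "integrable circ f" "integrable circ (\<lambda>\<theta>. (f \<theta>)\<^sup>2)"
    using L2f_integrable[OF finite_measure_circ f] L2f_sq[OF f] .
  have c1: "(\<integral>\<theta>. c \<partial>circ) = 2 * pi * c" for c :: real by (simp add: measure_circ space_restrict_space)
  have ic: "integrable circ (\<lambda>\<theta>. c :: real)" for c by (simp add: finite_measure.integrable_const[OF finite_measure_circ])
  have "0 \<le> (\<integral>\<theta>. (f \<theta> - m)\<^sup>2 \<partial>circ)" by simp
  also have "\<dots> = (\<integral>\<theta>. (f \<theta>)\<^sup>2 - 2 * m * f \<theta> + m\<^sup>2 \<partial>circ)"
    by (intro Bochner_Integration.integral_cong) (auto simp: power2_eq_square algebra_simps)
  also have "\<dots> = (\<integral>\<theta>. (f \<theta>)\<^sup>2 \<partial>circ) - 2 * m * (\<integral>\<theta>. f \<theta> \<partial>circ) + 2 * pi * m\<^sup>2"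
    using i ic by (simp add: measure_circ space_restrict_space)
  also have "(\<integral>\<theta>. f \<theta> \<partial>circ) = 2 * pi * m" by (simp add: m_def)
  finally have "2 * pi * m\<^sup>2 \<le> (\<integral>\<theta>. (f \<theta>)\<^sup>2 \<partial>circ)" by (simp add: power2_eq_square algebra_simps)
  then have "m\<^sup>2 \<le> (\<integral>\<theta>. (f \<theta>)\<^sup>2 \<partial>circ) / (2 * pi)"
    by (simp add: pos_le_divide_eq mult.commute mult.left_commute)
  then show ?thesis by (simp only: m_def)
qed

text \<open>Jensen on each orbit, followed by rotational invariance.\<close>

lemma pair_avg_L2f:
  assumes i: "i \<in> {1..n}" "j \<in> {1..n}" "i \<noteq> j" and f: "f \<in> L2f (usph n)"
  shows "pair_avg i j f \<in> L2f (usph n)"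
proof -
  have fm[measurable]: "f \<in> borel_measurable (PB n)" by (rule L2f_usph_borel[OF f])
  note [measurable] = pair_avg_measurable[OF i(1,2) fm]
  have "(\<integral>\<^sup>+v. ennreal ((pair_avg i j f v)\<^sup>2) \<partial>usph n)
      \<le> (\<integral>\<^sup>+v. ennreal (1 / (2 * pi)) * (\<integral>\<^sup>+\<theta>. ennreal ((f (pair_rot i j \<theta> v))\<^sup>2) \<partial>circ) \<partial>usph n)"
  proof (rule nn_integral_mono_AE)
    show "AE v in usph n. ennreal ((pair_avg i j f v)\<^sup>2) \<le> ennreal (1 / (2 * pi)) * (\<integral>\<^sup>+\<theta>. ennreal ((f (pair_rot i j \<theta> v))\<^sup>2) \<partial>circ)"
      using AE_rot_L2f[OF i f]
    proof eventually_elim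
      case (elim v)
      have "ennreal ((pair_avg i j f v)\<^sup>2) \<le> ennreal ((\<integral>\<theta>. (f (pair_rot i j \<theta> v))\<^sup>2 \<partial>circ) / (2 * pi))"
        unfolding pair_avg_circ by (intro ennreal_leI L2_circ_average elim)
      also have "\<dots> = ennreal (1 / (2 * pi)) * ennreal (\<integral>\<theta>. (f (pair_rot i j \<theta> v))\<^sup>2 \<partial>circ)"
        by (subst ennreal_mult[symmetric]) auto
      also have "ennreal (\<integral>\<theta>. (f (pair_rot i j \<theta> v))\<^sup>2 \<partial>circ) = (\<integral>\<^sup>+\<theta>. ennreal ((f (pair_rot i j \<theta> v))\<^sup>2) \<partial>circ)"
        by (subst nn_integral_eq_integral[OF L2f_sq[OF elim]]) auto
      finally show ?case .
    qed
  qed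
  also have "\<dots> = ennreal (1 / (2 * pi)) * (\<integral>\<^sup>+v. \<integral>\<^sup>+\<theta>. ennreal ((f (pair_rot i j \<theta> v))\<^sup>2) \<partial>circ \<partial>usph n)"
  proof (rule nn_integral_cmult)
    interpret c: finite_measure circ by (rule finite_measure_circ)
    have m2: "(\<lambda>(v, \<theta>). ennreal ((f (pair_rot i j \<theta> v))\<^sup>2)) \<in> borel_measurable (PB n \<Otimes>\<^sub>M circ)"
      by (rule pair_rot_measurable_circ[OF i(1,2)]) measurable
    show "(\<lambda>v. \<integral>\<^sup>+\<theta>. ennreal ((f (pair_rot i j \<theta> v))\<^sup>2) \<partial>circ) \<in> borel_measurable (usph n)"
      using c.borel_measurable_nn_integral_fst[OF m2] by (simp cong: measurable_cong_sets)
  qed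
  also have "\<dots> = ennreal (1 / (2 * pi)) * (ennreal (2 * pi) * (\<integral>\<^sup>+v. ennreal ((f v)\<^sup>2) \<partial>usph n))"
    by (subst nn_integral_rot[OF i]) simp_all
  also have "\<dots> < \<infinity>"
    using integrableD(2)[OF L2f_sq[OF f]] by (simp add: ennreal_mult_less_top top.not_eq_extremum)
  finally have "integrable (usph n) (\<lambda>v. (pair_avg i j f v)\<^sup>2)"
    by (intro integrableI_bounded) auto
  then show ?thesis by (simp add: L2f_def)
qed

text \<open>\<open>defect \<phi> (v i) (v j)\<close> is the value of \<open>f - [f]\<^bsup>(i,j)\<^esup>\<close> at \<open>v\<close> for \<open>f = \<Sum>j. \<phi> (v j)\<close>.\<close>

definition defect :: "(real \<Rightarrow> real) \<Rightarrow> real \<Rightarrow> real \<Rightarrow> real" where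
  "defect \<phi> a b = \<phi> a + \<phi> b
     - (\<integral>\<theta>. \<phi> (a * cos \<theta> + b * sin \<theta>) + \<phi> (- a * sin \<theta> + b * cos \<theta>) \<partial>circ) / (2 * pi)"

text \<open>By exchangeability the pair (1, 2) stands for all pairs, and the Dirichlet form is n
  times this quantity. Written in terms of the summand, it can be evaluated directly for the
  rescaled summand of a slice.\<close>

definition energy :: "real \<Rightarrow> nat \<Rightarrow> (real \<Rightarrow> real) \<Rightarrow> real" where
  "energy \<gamma> n \<phi> = (\<integral>v. ((v 1)\<^sup>2 + (v 2)\<^sup>2) powr \<gamma> * (defect \<phi> (v 1) (v 2))\<^sup>2 \<partial>usph n)"

abbreviation coord_sum :: "nat \<Rightarrow> (real \<Rightarrow> real) \<Rightarrow> (nat \<Rightarrow> real) \<Rightarrow> real" where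
  "coord_sum n \<phi> \<equiv> (\<lambda>v. \<Sum>j=1..n. \<phi> (v j))"

lemma coord_sum_measurable:
  assumes [measurable]: "\<phi> \<in> borel_measurable borel"
  shows "coord_sum n \<phi> \<in> borel_measurable (PB n)"
  by measurable

lemma defect_measurable:
  assumes [measurable]: "\<phi> \<in> borel_measurable borel"
  shows "(\<lambda>z. defect \<phi> (fst z) (snd z)) \<in> borel_measurable (borel \<Otimes>\<^sub>M borel)"
proof -
  interpret c: finite_measure circ by (rule finite_measure_circ)
  have id: "(\<lambda>\<theta>. \<theta>) \<in> measurable circ borel" by (rule measurable_restrict_space1) simp
  have p: "(\<lambda>y. (fst y, snd y)) \<in> measurable ((borel \<Otimes>\<^sub>M borel) \<Otimes>\<^sub>M circ) ((borel \<Otimes>\<^sub>M borel) \<Otimes>\<^sub>M (borel :: real measure))"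
    by (intro measurable_Pair measurable_fst measurable_compose[OF measurable_snd id])
  have q: "(\<lambda>y. \<phi> (fst (fst y) * cos (snd y) + snd (fst y) * sin (snd y)) + \<phi> (- fst (fst y) * sin (snd y) + snd (fst y) * cos (snd y)))
      \<in> borel_measurable ((borel \<Otimes>\<^sub>M borel) \<Otimes>\<^sub>M (borel :: real measure))"
    by measurable
  from measurable_compose[OF p q] have "(\<lambda>(z, \<theta>). \<phi> (fst z * cos \<theta> + snd z * sin \<theta>) + \<phi> (- fst z * sin \<theta> + snd z * cos \<theta>))
      \<in> borel_measurable ((borel \<Otimes>\<^sub>M borel) \<Otimes>\<^sub>M circ)"
    by (simp add: split_beta)
  note [measurable] = c.borel_measurable_lebesgue_integral[OF this]
  show ?thesis unfolding defect_def by measurable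
qed

lemma coord_sum_pair:
  assumes i: "i \<in> {1..n}" "j \<in> {1..n}" "i \<noteq> j"
  shows "coord_sum n \<phi> (pair_rot i j \<theta> v)
    = \<phi> (v i * cos \<theta> + v j * sin \<theta>) + \<phi> (- v i * sin \<theta> + v j * cos \<theta>) + (coord_sum n \<phi> v - \<phi> (v i) - \<phi> (v j))"
proof -
  have sp: "(\<Sum>k\<in>{1..n}. \<phi> (z k)) = (\<phi> (z i) + \<phi> (z j)) + (\<Sum>k\<in>{1..n} - {i} - {j}. \<phi> (z k))" for z :: "nat \<Rightarrow> real"
    using i by (subst sum.remove[of _ i], simp, simp, subst sum.remove[of _ j]) auto
  have "(\<Sum>k\<in>{1..n} - {i} - {j}. \<phi> (pair_rot i j \<theta> v k)) = (\<Sum>k\<in>{1..n} - {i} - {j}. \<phi> (v k))"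
    by (intro sum.cong) (auto simp: pair_rot_def)
  then show ?thesis
    using i unfolding sp[of "pair_rot i j \<theta> v"] sp[of v] by (simp add: pair_rot_def)
qed

text \<open>Along an orbit only two summands vary, so integrability of the whole sum gives
  integrability of these two together. Separately they need not be integrable, and for this reason
  the integral in \<open>defect\<close> is never split.\<close>

lemma defect_eq:
  assumes i: "i \<in> {1..n}" "j \<in> {1..n}" "i \<noteq> j" and \<phi>: "\<phi> \<in> borel_measurable borel"
    and F: "coord_sum n \<phi> \<in> L2f (usph n)"
  shows "AE v in usph n. integrable circ (\<lambda>\<theta>. \<phi> (v i * cos \<theta> + v j * sin \<theta>) + \<phi> (- v i * sin \<theta> + v j * cos \<theta>))"
    "AE v in usph n. coord_sum n \<phi> v - pair_avg i j (coord_sum n \<phi>) v = defect \<phi> (v i) (v j)"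
proof -
  have *: "AE v in usph n. integrable circ (\<lambda>\<theta>. \<phi> (v i * cos \<theta> + v j * sin \<theta>) + \<phi> (- v i * sin \<theta> + v j * cos \<theta>))
      \<and> coord_sum n \<phi> v - pair_avg i j (coord_sum n \<phi>) v = defect \<phi> (v i) (v j)"
    using AE_rot_L2f[OF i F]
  proof eventually_elim
    case (elim v)
    define r where "r = coord_sum n \<phi> v - \<phi> (v i) - \<phi> (v j)"
    let ?g = "\<lambda>\<theta>. \<phi> (v i * cos \<theta> + v j * sin \<theta>) + \<phi> (- v i * sin \<theta> + v j * cos \<theta>)"
    have ic: "integrable circ (\<lambda>\<theta>. c :: real)" for c by (simp add: finite_measure.integrable_const[OF finite_measure_circ])
    have "integrable circ (\<lambda>\<theta>. ?g \<theta> + r)"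
      using L2f_integrable[OF finite_measure_circ elim] unfolding coord_sum_pair[OF i] r_def .
    from Bochner_Integration.integrable_diff[OF this ic[of r]] have ig: "integrable circ ?g" by simp
    have "pair_avg i j (coord_sum n \<phi>) v = (\<integral>\<theta>. ?g \<theta> + r \<partial>circ) / (2 * pi)"
      unfolding pair_avg_circ coord_sum_pair[OF i] r_def ..
    also have "(\<integral>\<theta>. ?g \<theta> + r \<partial>circ) = (\<integral>\<theta>. ?g \<theta> \<partial>circ) + 2 * pi * r"
      by (subst Bochner_Integration.integral_add[OF ig ic]) (simp add: measure_circ space_restrict_space)
    finally have "pair_avg i j (coord_sum n \<phi>) v = (\<integral>\<theta>. ?g \<theta> \<partial>circ) / (2 * pi) + r"
      by (simp add: add_divide_distrib)
    then show ?case using ig by (simp add: defect_def r_def)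
  qed
  show "AE v in usph n. integrable circ (\<lambda>\<theta>. \<phi> (v i * cos \<theta> + v j * sin \<theta>) + \<phi> (- v i * sin \<theta> + v j * cos \<theta>))"
    using * by eventually_elim simp
  show "AE v in usph n. coord_sum n \<phi> v - pair_avg i j (coord_sum n \<phi>) v = defect \<phi> (v i) (v j)"
    using * by eventually_elim simp
qed

lemma defect_L2f:
  assumes n: "n \<ge> 2" and \<phi>: "\<phi> \<in> borel_measurable borel" and F: "coord_sum n \<phi> \<in> L2f (usph n)"
  shows "(\<lambda>v. defect \<phi> (v 1) (v 2)) \<in> L2f (usph n)"
proof -
  have i: "1 \<in> {1..n}" "2 \<in> {1..n}" "(1::nat) \<noteq> 2" using n by auto
  have m: "(\<lambda>v. defect \<phi> (v 1) (v 2)) \<in> borel_measurable (usph n)"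
    using measurable_compose[OF measurable_Pair[OF nth_measurable_usph[OF i(1)] nth_measurable_usph[OF i(2)]] defect_measurable[OF \<phi>]] by simp
  show ?thesis
    by (rule L2f_dominated[OF L2f_diff[OF F pair_avg_L2f[OF i F]] m])
       (use defect_eq(2)[OF i \<phi> F] in \<open>eventually_elim, simp\<close>)
qed

lemma energy_integrable:
  assumes n: "n \<ge> 2" and \<phi>: "\<phi> \<in> borel_measurable borel" and F: "coord_sum n \<phi> \<in> L2f (usph n)" and \<gamma>: "\<gamma> \<ge> 0"
  shows "integrable (usph n) (\<lambda>v. ((v 1)\<^sup>2 + (v 2)\<^sup>2) powr \<gamma> * (defect \<phi> (v 1) (v 2))\<^sup>2)"
proof -
  have i: "1 \<in> {1..n}" "2 \<in> {1..n}" using n by auto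
  note D = defect_L2f[OF n \<phi> F]
  have [measurable]: "(\<lambda>v. defect \<phi> (v 1) (v 2)) \<in> borel_measurable (usph n)" by (rule L2f_measurable[OF D])
  show ?thesis
  proof (rule Bochner_Integration.integrable_bound)
    show "integrable (usph n) (\<lambda>v. real (2 * n) powr \<gamma> * (defect \<phi> (v 1) (v 2))\<^sup>2)"
      using L2f_sq[OF D] by simp
    show "AE v in usph n. norm (((v 1)\<^sup>2 + (v 2)\<^sup>2) powr \<gamma> * (defect \<phi> (v 1) (v 2))\<^sup>2) \<le> norm (real (2 * n) powr \<gamma> * (defect \<phi> (v 1) (v 2))\<^sup>2)"
      using AE_usph_bound[OF i(1)] AE_usph_bound[OF i(2)]
    proof eventually_elim
      case (elim v)
      have "((v 1)\<^sup>2 + (v 2)\<^sup>2) powr \<gamma> \<le> real (2 * n) powr \<gamma>"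
        using elim \<gamma> by (intro powr_mono2) auto
      then show ?case by (auto intro!: mult_right_mono)
    qed
  qed (use i in measurable)
qed

lemma energy_nonneg: "energy \<gamma> n \<phi> \<ge> 0"
  by (simp add: energy_def)

section \<open>Passage between the sphere and the ambient product space\<close>

lemma kac_sphere_sets: "kac_sphere n \<in> sets (PB n)"
proof -
  have "{v \<in> space (PB n). (\<Sum>j=1..n. (v j)\<^sup>2) = real n} \<in> sets (PB n)" by measurable
  then show ?thesis by (simp add: kac_sphere_def space_PB)
qed

lemma kac_sphere_rot:
  assumes i: "i \<in> {1..n}" "j \<in> {1..n}" "i \<noteq> j" and v: "v \<in> kac_sphere n"
  shows "pair_rot i j \<theta> v \<in> kac_sphere n"
proof -
  have "nrm n (pair_rot i j \<theta> v) = nrm n v"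
    using i by (intro nrm_cong_pair[of i n j] pair_rot_sq) (auto simp: pair_rot_def)
  moreover have "(nrm n z)\<^sup>2 = (\<Sum>j=1..n. (z j)\<^sup>2)" for z
    by (simp add: L2_set_def sum_nonneg)
  ultimately have "(\<Sum>k=1..n. (pair_rot i j \<theta> v k)\<^sup>2) = (\<Sum>k=1..n. (v k)\<^sup>2)" by metis
  moreover have "pair_rot i j \<theta> v \<in> {1..n} \<rightarrow>\<^sub>E UNIV"
    using i v by (auto simp: pair_rot_def kac_sphere_def PiE_iff extensional_def)
  ultimately show ?thesis using v by (simp add: kac_sphere_def)
qed

lemma integral_sphere_measure:
  fixes g :: "(nat \<Rightarrow> real) \<Rightarrow> real"
  shows "(\<integral>v. g v \<partial>sphere_measure n) = (\<integral>v. indicator (kac_sphere n) v * g v \<partial>usph n)"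
    "integrable (sphere_measure n) g \<longleftrightarrow> integrable (usph n) (\<lambda>v. indicator (kac_sphere n) v * g v)"
    "g \<in> borel_measurable (sphere_measure n) \<longleftrightarrow> (\<lambda>v. indicator (kac_sphere n) v * g v) \<in> borel_measurable (PB n)"
    "(AE v in sphere_measure n. P v) \<longleftrightarrow> (AE v in usph n. v \<in> kac_sphere n \<longrightarrow> P v)"
proof -
  have s: "kac_sphere n \<inter> space (usph n) \<in> sets (usph n)"
    using kac_sphere_sets[of n] by (simp add: kac_sphere_def Int_def conj_commute)
  show "(\<integral>v. g v \<partial>sphere_measure n) = (\<integral>v. indicator (kac_sphere n) v * g v \<partial>usph n)"
    unfolding sphere_measure_usph by (subst integral_restrict_space[OF s]) simp
  show "integrable (sphere_measure n) g \<longleftrightarrow> integrable (usph n) (\<lambda>v. indicator (kac_sphere n) v * g v)"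
    unfolding sphere_measure_usph by (subst integrable_restrict_space[OF s]) simp
  show "g \<in> borel_measurable (sphere_measure n) \<longleftrightarrow> (\<lambda>v. indicator (kac_sphere n) v * g v) \<in> borel_measurable (PB n)"
    unfolding sphere_measure_usph by (subst borel_measurable_restrict_space_iff[OF s]) (simp cong: measurable_cong_sets)
  show "(AE v in sphere_measure n. P v) \<longleftrightarrow> (AE v in usph n. v \<in> kac_sphere n \<longrightarrow> P v)"
    unfolding sphere_measure_usph by (rule AE_restrict_space_iff[OF s])
qed

lemma card_pairs: "card {(i, j). 1 \<le> i \<and> i < j \<and> j \<le> n} = n choose 2" (is "card (?P n) = _")
proof -
  have fin: "finite (?P n)" for n
    by (rule finite_subset[of _ "{1..n} \<times> {1..n}"]) auto
  show "card (?P n) = n choose 2"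
  proof (induction n)
    case 0
    have e: "?P 0 = {}" by auto
    show ?case unfolding e by simp
  next
    case (Suc n)
    have "?P (Suc n) = ?P n \<union> (\<lambda>i. (i, Suc n)) ` {1..n}" by auto
    moreover have "?P n \<inter> (\<lambda>i. (i, Suc n)) ` {1..n} = {}" by auto
    moreover have "card ((\<lambda>i. (i, Suc n)) ` {1..n}) = n" by (subst card_image) (auto simp: inj_on_def)
    ultimately have "card (?P (Suc n)) = (n choose 2) + n"
      using Suc fin[of n] by (simp add: card_Un_disjoint)
    then show ?case by (simp add: numeral_2_eq_2 One_nat_def)
  qed
qed

text \<open>The function f is arbitrary off the sphere, so it is replaced by its extension by zero,
  which is measurable on the product space. Rotations preserve the sphere, hence pair averages on it
  are unaffected; \<open>AE_rot\<close> then allows the replacement by the coordinate sum, and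
  \<open>defect_eq\<close> identifies the difference.\<close>

lemma kac_dirichlet_energy:
  assumes n: "n \<ge> 2" and \<phi>: "\<phi> \<in> borel_measurable borel" and F: "coord_sum n \<phi> \<in> L2f (usph n)"
    and f: "f \<in> borel_measurable (sphere_measure n)" and eq: "AE v in sphere_measure n. f v = coord_sum n \<phi> v"
  shows "kac_dirichlet \<gamma> n f = real n * energy \<gamma> n \<phi>"
proof -
  have n1: "n \<ge> 1" using n by simp
  define f' where "f' = (\<lambda>v. indicator (kac_sphere n) v * f v)"
  have f'[measurable]: "f' \<in> borel_measurable (PB n)" using f unfolding integral_sphere_measure(3) f'_def .
  have eq': "AE v in usph n. f' v = coord_sum n \<phi> v"
    using AE_usph_sphere[OF n1] eq[unfolded integral_sphere_measure(4)] by eventually_elim (simp add: f'_def)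
  have [measurable]: "coord_sum n \<phi> \<in> borel_measurable (PB n)" by (rule coord_sum_measurable[OF \<phi>])
  have pair: "(\<integral>v. ((v i)\<^sup>2 + (v j)\<^sup>2) powr \<gamma> * (f v - pair_avg i j f v)\<^sup>2 \<partial>sphere_measure n) = energy \<gamma> n \<phi>"
    if ij: "1 \<le> i" "i < j" "j \<le> n" for i j
  proof -
    have i: "i \<in> {1..n}" "j \<in> {1..n}" "i \<noteq> j" using ij by auto
    note [measurable] = pair_avg_measurable[OF i(1,2) f']
    have dm: "(\<lambda>z. ((fst z)\<^sup>2 + (snd z)\<^sup>2) powr \<gamma> * (defect \<phi> (fst z) (snd z))\<^sup>2) \<in> borel_measurable (borel \<Otimes>\<^sub>M borel)"
      using defect_measurable[OF \<phi>] by measurable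
    have dm2: "(\<lambda>v. ((v i)\<^sup>2 + (v j)\<^sup>2) powr \<gamma> * (defect \<phi> (v i) (v j))\<^sup>2) \<in> borel_measurable (usph n)"
      using measurable_compose[OF measurable_Pair[OF nth_measurable_usph[OF i(1)] nth_measurable_usph[OF i(2)]] dm] by simp
    have pa: "pair_avg i j f v = pair_avg i j f' v" if "v \<in> kac_sphere n" for v
      unfolding pair_avg_circ f'_def using kac_sphere_rot[OF i that] by simp
    have "(\<integral>v. ((v i)\<^sup>2 + (v j)\<^sup>2) powr \<gamma> * (f v - pair_avg i j f v)\<^sup>2 \<partial>sphere_measure n)
       = (\<integral>v. indicator (kac_sphere n) v * (((v i)\<^sup>2 + (v j)\<^sup>2) powr \<gamma> * (f' v - pair_avg i j f' v)\<^sup>2) \<partial>usph n)"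
      unfolding integral_sphere_measure(1)
      by (intro Bochner_Integration.integral_cong refl) (auto simp: indicator_def pa f'_def)
    also have "\<dots> = (\<integral>v. ((v i)\<^sup>2 + (v j)\<^sup>2) powr \<gamma> * (defect \<phi> (v i) (v j))\<^sup>2 \<partial>usph n)"
    proof (rule integral_cong_AE[OF _ dm2])
      have [measurable]: "kac_sphere n \<in> sets (PB n)" by (rule kac_sphere_sets)
      show "(\<lambda>v. indicator (kac_sphere n) v * (((v i)\<^sup>2 + (v j)\<^sup>2) powr \<gamma> * (f' v - pair_avg i j f' v)\<^sup>2)) \<in> borel_measurable (usph n)"
        using i by measurable
      have "AE v in usph n. pair_avg i j f' v = pair_avg i j (coord_sum n \<phi>) v"
        using AE_rot[OF i eq'] AE_space
      proof eventually_elim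
        case (elim v)
        have v: "v \<in> space (PB n)" using elim by (simp add: space_PB)
        have "(\<lambda>\<theta>. g (pair_rot i j \<theta> v)) \<in> borel_measurable circ" if "g \<in> borel_measurable (PB n)" for g :: "(nat \<Rightarrow> real) \<Rightarrow> real"
          using measurable_Pair2[OF pair_rot_measurable_circ[OF i(1,2) that] v] by simp
        then have "(\<integral>\<theta>. f' (pair_rot i j \<theta> v) \<partial>circ) = (\<integral>\<theta>. coord_sum n \<phi> (pair_rot i j \<theta> v) \<partial>circ)"
          using elim(1) by (intro integral_cong_AE) auto
        then show ?case by (simp add: pair_avg_circ)
      qed
      then show "AE v in usph n. indicator (kac_sphere n) v * (((v i)\<^sup>2 + (v j)\<^sup>2) powr \<gamma> * (f' v - pair_avg i j f' v)\<^sup>2)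
          = ((v i)\<^sup>2 + (v j)\<^sup>2) powr \<gamma> * (defect \<phi> (v i) (v j))\<^sup>2"
        using eq' defect_eq(2)[OF i \<phi> F] AE_usph_sphere[OF n1] by eventually_elim simp
    qed
    also have "\<dots> = energy \<gamma> n \<phi>"
      unfolding energy_def using n i dm by (intro usph_pair(1)) auto
    finally show ?thesis .
  qed
  have "(\<Sum>(i, j) \<in> {(i, j). 1 \<le> i \<and> i < j \<and> j \<le> n}.
        \<integral>v. ((v i)\<^sup>2 + (v j)\<^sup>2) powr \<gamma> * (f v - pair_avg i j f v)\<^sup>2 \<partial>sphere_measure n)
     = (\<Sum>(i, j) \<in> {(i, j). 1 \<le> i \<and> i < j \<and> j \<le> n}. energy \<gamma> n \<phi>)"
    by (intro sum.cong refl) (auto simp: pair)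
  also have "\<dots> = real (n choose 2) * energy \<gamma> n \<phi>"
    using card_pairs[of n] by (simp add: split_beta)
  finally have s: "(\<Sum>(i, j) \<in> {(i, j). 1 \<le> i \<and> i < j \<and> j \<le> n}.
        \<integral>v. ((v i)\<^sup>2 + (v j)\<^sup>2) powr \<gamma> * (f v - pair_avg i j f v)\<^sup>2 \<partial>sphere_measure n) = real (n choose 2) * energy \<gamma> n \<phi>" .
  have "n choose 2 > 0" using n by (intro zero_less_binomial)
  then show ?thesis unfolding kac_dirichlet_def s by simp
qed

text \<open>The competitors of the infimum, parametrised by their summand. Square integrability is
  required of the sum only, as in the definition of the gap, so the infimum does not change.\<close>

definition normalised :: "nat \<Rightarrow> (real \<Rightarrow> real) set" where
  "normalised n = {\<phi> \<in> borel_measurable borel. coord_sum n \<phi> \<in> L2f (usph n) \<and>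
     (\<integral>v. (coord_sum n \<phi> v)\<^sup>2 \<partial>usph n) = 1 \<and> (\<integral>v. coord_sum n \<phi> v \<partial>usph n) = 0}"

lemma restricted_gap_energy:
  assumes n: "n \<ge> 2"
  shows "restricted_gap \<gamma> n = Inf ((\<lambda>\<phi>. real n * energy \<gamma> n \<phi>) ` normalised n)"
proof -
  have n1: "n \<ge> 1" using n by simp
  have tr: "f \<in> L2_sphere n \<longleftrightarrow> coord_sum n \<phi> \<in> L2f (usph n)"
      "L2_norm n f = sqrt (\<integral>v. (coord_sum n \<phi> v)\<^sup>2 \<partial>usph n)" "L2_inner n f (\<lambda>_. 1) = (\<integral>v. coord_sum n \<phi> v \<partial>usph n)"
    if \<phi>: "\<phi> \<in> borel_measurable borel" and f: "f \<in> borel_measurable (sphere_measure n)"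
      and eq: "AE v in sphere_measure n. f v = coord_sum n \<phi> v" for f \<phi>
  proof -
    define f' where "f' = (\<lambda>v. indicator (kac_sphere n) v * f v)"
    have f'[measurable]: "f' \<in> borel_measurable (PB n)" using f unfolding integral_sphere_measure(3) f'_def .
    have [measurable]: "coord_sum n \<phi> \<in> borel_measurable (PB n)" by (rule coord_sum_measurable[OF \<phi>])
    have eq': "AE v in usph n. f' v = coord_sum n \<phi> v"
      using AE_usph_sphere[OF n1] eq[unfolded integral_sphere_measure(4)] by eventually_elim (simp add: f'_def)
    have sq: "indicator (kac_sphere n) v * (f v)\<^sup>2 = (f' v)\<^sup>2" for v by (simp add: f'_def indicator_def)
    have "integrable (usph n) (\<lambda>v. (f' v)\<^sup>2) \<longleftrightarrow> integrable (usph n) (\<lambda>v. (coord_sum n \<phi> v)\<^sup>2)"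
      using eq' by (intro integrable_cong_AE) auto
    then show "f \<in> L2_sphere n \<longleftrightarrow> coord_sum n \<phi> \<in> L2f (usph n)"
      using f unfolding L2_sphere_def L2f_def mem_Collect_eq integral_sphere_measure(2) sq by simp
    have "(\<integral>v. (f' v)\<^sup>2 \<partial>usph n) = (\<integral>v. (coord_sum n \<phi> v)\<^sup>2 \<partial>usph n)"
      using eq' by (intro integral_cong_AE) auto
    then show "L2_norm n f = sqrt (\<integral>v. (coord_sum n \<phi> v)\<^sup>2 \<partial>usph n)"
      unfolding L2_norm_def L2_inner_def integral_sphere_measure(1) power2_eq_square[symmetric] sq by simp
    have "(\<integral>v. f' v \<partial>usph n) = (\<integral>v. coord_sum n \<phi> v \<partial>usph n)"
      using eq' by (intro integral_cong_AE) auto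
    then show "L2_inner n f (\<lambda>_. 1) = (\<integral>v. coord_sum n \<phi> v \<partial>usph n)"
      unfolding L2_inner_def integral_sphere_measure(1) by (simp add: f'_def)
  qed
  have "{kac_dirichlet \<gamma> n f | f. L2_norm n f = 1 \<and> L2_inner n f (\<lambda>_. 1) = 0 \<and> f \<in> sum_space n}
      = (\<lambda>\<phi>. real n * energy \<gamma> n \<phi>) ` normalised n" (is "?A = ?B")
  proof
    show "?A \<subseteq> ?B"
    proof
      fix y assume "y \<in> ?A"
      then obtain f where f: "y = kac_dirichlet \<gamma> n f" "L2_norm n f = 1" "L2_inner n f (\<lambda>_. 1) = 0" "f \<in> L2_sphere n"
        and "\<exists>\<phi> \<in> borel_measurable borel. AE v in sphere_measure n. f v = (\<Sum>j=1..n. \<phi> (v j))"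
        by (auto simp: sum_space_def)
      then obtain \<phi> where \<phi>: "\<phi> \<in> borel_measurable borel" "AE v in sphere_measure n. f v = coord_sum n \<phi> v" by blast
      have fm: "f \<in> borel_measurable (sphere_measure n)" using f by (simp add: L2_sphere_def)
      note t = tr[OF \<phi>(1) fm \<phi>(2)]
      have "\<phi> \<in> normalised n" using f t \<phi>(1) by (simp add: normalised_def)
      moreover have "y = real n * energy \<gamma> n \<phi>"
        using kac_dirichlet_energy[OF n \<phi>(1) _ fm \<phi>(2)] f t by simp
      ultimately show "y \<in> ?B" by blast
    qed
    show "?B \<subseteq> ?A"
    proof
      fix y assume "y \<in> ?B"
      then obtain \<phi> where y: "y = real n * energy \<gamma> n \<phi>" and \<phi>: "\<phi> \<in> normalised n" by blast
      have \<phi>b: "\<phi> \<in> borel_measurable borel" and FL: "coord_sum n \<phi> \<in> L2f (usph n)"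
        using \<phi> by (auto simp: normalised_def)
      have fm: "coord_sum n \<phi> \<in> borel_measurable (sphere_measure n)"
      proof -
        have [measurable]: "kac_sphere n \<in> sets (PB n)" "coord_sum n \<phi> \<in> borel_measurable (PB n)"
          by (rule kac_sphere_sets, rule coord_sum_measurable[OF \<phi>b])
        show ?thesis unfolding integral_sphere_measure(3) by measurable
      qed
      note t = tr[OF \<phi>b fm] and e = kac_dirichlet_energy[OF n \<phi>b FL fm]
      show "y \<in> ?A"
        using t e \<phi> \<phi>b by (auto simp: y normalised_def sum_space_def intro!: exI[of _ "coord_sum n \<phi>"])
    qed
  qed
  then show ?thesis by (simp add: restricted_gap_def)
qed

section \<open>Recursion for the gap\<close>

lemma defect_scale: "defect \<phi> (s * a) (s * b) = defect (\<lambda>x. \<phi> (s * x)) a b"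
proof -
  have "s * a * c + s * b * d = s * (a * c + b * d)" "- (s * a) * d + s * b * c = s * (- a * d + b * c)" for c d
    by (simp_all add: algebra_simps)
  then show ?thesis unfolding defect_def by (simp only:)
qed

lemma defect_affine:
  assumes "integrable circ (\<lambda>\<theta>. \<phi> (a * cos \<theta> + b * sin \<theta>) + \<phi> (- a * sin \<theta> + b * cos \<theta>))"
  shows "defect (\<lambda>x. k * (\<phi> x - c)) a b = k * defect \<phi> a b"
proof -
  let ?g = "\<lambda>\<theta>. \<phi> (a * cos \<theta> + b * sin \<theta>) + \<phi> (- a * sin \<theta> + b * cos \<theta>)"
  have ic: "integrable circ (\<lambda>\<theta>. d :: real)" for d by (simp add: finite_measure.integrable_const[OF finite_measure_circ])
  have "(\<integral>\<theta>. k * (\<phi> (a * cos \<theta> + b * sin \<theta>) - c) + k * (\<phi> (- a * sin \<theta> + b * cos \<theta>) - c) \<partial>circ)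
     = (\<integral>\<theta>. k * (?g \<theta> - 2 * c) \<partial>circ)"
    by (intro Bochner_Integration.integral_cong) (auto simp: algebra_simps)
  also have "\<dots> = k * ((\<integral>\<theta>. ?g \<theta> \<partial>circ) - 2 * pi * (2 * c))"
    by (simp only: integral_mult_right_zero Bochner_Integration.integral_diff[OF assms ic])
       (simp add: measure_circ space_restrict_space)
  finally show ?thesis
    unfolding defect_def by (simp add: field_simps)
qed

lemma gap_bdd: "bdd_below ((\<lambda>\<phi>. real n * energy \<gamma> n \<phi>) ` normalised n)"
  by (intro bdd_belowI[of _ 0]) (auto simp: energy_nonneg)

lemma coord_sum_integrals:
  assumes n: "n \<ge> 1" and h: "h \<in> L2f (marg n)"
  shows "coord_sum n h \<in> L2f (usph n)" "(\<integral>v. coord_sum n h v \<partial>usph n) = real n * (\<integral>x. h x \<partial>marg n)"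
proof -
  show "coord_sum n h \<in> L2f (usph n)" by (intro L2f_sum L2f_coordinate h)
  have "(\<integral>v. coord_sum n h v \<partial>usph n) = (\<Sum>j=1..n. \<integral>v. h (v j) \<partial>usph n)"
    by (intro Bochner_Integration.integral_sum L2f_integrable[OF finite_measure_usph] L2f_coordinate h)
  also have "\<dots> = (\<Sum>j=1..n. \<integral>x. h x \<partial>marg n)"
    using L2f_coordinate(3)[OF _ h] by (intro sum.cong refl) simp
  finally show "(\<integral>v. coord_sum n h v \<partial>usph n) = real n * (\<integral>x. h x \<partial>marg n)" by simp
qed

text \<open>The normalised sum of the coordinates is a competitor: distinct coordinates are
  uncorrelated since the first moment on a slice vanishes. Without a competitor the real
  \<open>Inf\<close> would carry no information.\<close>

lemma normalised_nonempty:
  assumes n: "n \<ge> 2"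
  shows "normalised n \<noteq> {}"
proof -
  define k where "k = n - 1"
  have k: "n = Suc k" "k \<ge> 1" using n by (auto simp: k_def)
  have n1: "n \<ge> 1" using n by simp
  define h where "h = (\<lambda>x::real. x / sqrt (real n))"
  have hL: "h \<in> L2f (marg n)"
    unfolding h_def by (intro continuous_L2f_marg n1) (use n in \<open>auto intro!: continuous_intros\<close>)
  have "(\<integral>x. (h x)\<^sup>2 \<partial>marg n) = 1 / real n"
    using marg_moment2[OF n1] by (simp add: h_def power_divide)
  moreover have "corr n h h = 0"
  proof -
    have "corr n h (\<lambda>x. x ^ 1) = 0"
      using corr_monomial[OF k(2), of h 1] hL by (simp add: k corr_poly_def)
    moreover have "corr n h h = corr n h (\<lambda>x. x ^ 1) / sqrt (real n)"
      unfolding corr_def h_def by simp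
    ultimately show ?thesis by simp
  qed
  ultimately have "(\<integral>v. (coord_sum n h v)\<^sup>2 \<partial>usph n) = 1"
    using integral_sum_sq[OF n hL] n by simp
  moreover have "(\<integral>v. coord_sum n h v \<partial>usph n) = 0"
    using coord_sum_integrals(2)[OF n1 hL] marg_moment_odd[OF n1, of 1] by (simp add: h_def)
  ultimately have "h \<in> normalised n"
    using coord_sum_integrals(1)[OF n1 hL] L2f_marg_borel[OF hL] by (simp add: normalised_def)
  then show ?thesis by blast
qed

lemma gap_nonneg:
  assumes n: "n \<ge> 2"
  shows "restricted_gap \<gamma> n \<ge> 0"
  unfolding restricted_gap_energy[OF n]
  using normalised_nonempty[OF n] by (intro cInf_greatest) (auto simp: energy_nonneg)

lemma gap_greatest:
  assumes n: "n \<ge> 2" and "\<And>\<phi>. \<phi> \<in> normalised n \<Longrightarrow> c \<le> real n * energy \<gamma> n \<phi>"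
  shows "c \<le> restricted_gap \<gamma> n"
  unfolding restricted_gap_energy[OF n]
  using normalised_nonempty[OF n] assms(2) by (intro cInf_greatest) auto

text \<open>The Rayleigh quotient form of the gap: subtracting m/n from the summand and rescaling
  yields a competitor if the variance is positive, and otherwise the left side is zero. It is needed
  because the summands that arise on slices are neither centred nor normalised.\<close>

lemma gap_le_energy:
  assumes n: "n \<ge> 2" and \<phi>[measurable]: "\<phi> \<in> borel_measurable borel" and F: "coord_sum n \<phi> \<in> L2f (usph n)"
  shows "restricted_gap \<gamma> n * ((\<integral>v. (coord_sum n \<phi> v)\<^sup>2 \<partial>usph n) - (\<integral>v. coord_sum n \<phi> v \<partial>usph n)\<^sup>2) \<le> real n * energy \<gamma> n \<phi>"
proof -
  have i: "1 \<in> {1..n}" "2 \<in> {1..n}" "(1::nat) \<noteq> 2" using n by auto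
  interpret u: prob_space "usph n" by (rule prob_space_usph)
  define m where "m = (\<integral>v. coord_sum n \<phi> v \<partial>usph n)"
  define V where "V = (\<integral>v. (coord_sum n \<phi> v)\<^sup>2 \<partial>usph n) - m\<^sup>2"
  have Ve: "V = (\<integral>v. (coord_sum n \<phi> v - m)\<^sup>2 \<partial>usph n)"
    using square_mean_le(2)[OF F prob_space_usph] by (simp add: V_def m_def)
  have V0: "V \<ge> 0" unfolding Ve by simp
  show ?thesis
  proof (cases "V = 0")
    case True
    then show ?thesis using energy_nonneg[of \<gamma> n \<phi>] by (simp add: V_def[symmetric] m_def[symmetric])
  next
    case False
    then have V: "V > 0" using V0 by simp
    define k where "k = 1 / sqrt V"
    have k2: "k\<^sup>2 = 1 / V" using V by (simp add: k_def power_divide)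
    define \<psi> where "\<psi> = (\<lambda>x. k * (\<phi> x - m / real n))"
    have [measurable]: "\<psi> \<in> borel_measurable borel" unfolding \<psi>_def by measurable
    have cs: "coord_sum n \<psi> v = k * (coord_sum n \<phi> v - m)" for v
      using n by (simp add: \<psi>_def sum_subtractf flip: sum_distrib_left)
    have GL: "(\<lambda>v. coord_sum n \<phi> v - m) \<in> L2f (usph n)" by (intro L2f_diff F L2f_const finite_measure_usph)
    have "\<psi> \<in> normalised n"
      unfolding normalised_def mem_Collect_eq cs
    proof (intro conjI)
      show "\<psi> \<in> borel_measurable borel" by measurable
      show "(\<lambda>v. k * (coord_sum n \<phi> v - m)) \<in> L2f (usph n)" by (intro L2f_cmult GL)
      show "(\<integral>v. (k * (coord_sum n \<phi> v - m))\<^sup>2 \<partial>usph n) = 1"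
        using V by (simp add: power_mult_distrib k2 Ve[symmetric])
      have "(\<integral>v. coord_sum n \<phi> v - m \<partial>usph n) = 0"
        using L2f_integrable[OF finite_measure_usph F] by (simp add: m_def[symmetric] u.prob_space[simplified])
      then show "(\<integral>v. k * (coord_sum n \<phi> v - m) \<partial>usph n) = 0" by simp
    qed
    then have "restricted_gap \<gamma> n \<le> real n * energy \<gamma> n \<psi>"
      unfolding restricted_gap_energy[OF n] by (intro cInf_lower gap_bdd) blast
    also have "energy \<gamma> n \<psi> = energy \<gamma> n \<phi> / V"
    proof -
      have dm: "(\<lambda>v. ((v 1)\<^sup>2 + (v 2)\<^sup>2) powr \<gamma> * (defect \<xi> (v 1) (v 2))\<^sup>2) \<in> borel_measurable (usph n)"
        if "\<xi> \<in> borel_measurable borel" for \<xi>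
      proof -
        have "(\<lambda>z. ((fst z)\<^sup>2 + (snd z)\<^sup>2) powr \<gamma> * (defect \<xi> (fst z) (snd z))\<^sup>2) \<in> borel_measurable (borel \<Otimes>\<^sub>M borel)"
          using defect_measurable[OF that] by measurable
        from measurable_compose[OF measurable_Pair[OF nth_measurable_usph[OF i(1)] nth_measurable_usph[OF i(2)]] this]
        show ?thesis by simp
      qed
      have "energy \<gamma> n \<psi> = (\<integral>v. k\<^sup>2 * (((v 1)\<^sup>2 + (v 2)\<^sup>2) powr \<gamma> * (defect \<phi> (v 1) (v 2))\<^sup>2) \<partial>usph n)"
        unfolding energy_def
      proof (rule integral_cong_AE)
        show "AE v in usph n. ((v 1)\<^sup>2 + (v 2)\<^sup>2) powr \<gamma> * (defect \<psi> (v 1) (v 2))\<^sup>2 = k\<^sup>2 * (((v 1)\<^sup>2 + (v 2)\<^sup>2) powr \<gamma> * (defect \<phi> (v 1) (v 2))\<^sup>2)"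
          using defect_eq(1)[OF i \<phi> F]
          by eventually_elim (simp add: \<psi>_def defect_affine power_mult_distrib)
        show "(\<lambda>v. k\<^sup>2 * (((v 1)\<^sup>2 + (v 2)\<^sup>2) powr \<gamma> * (defect \<phi> (v 1) (v 2))\<^sup>2)) \<in> borel_measurable (usph n)"
          using dm[OF \<phi>] by measurable
      qed (rule dm, measurable)
      then show ?thesis by (simp add: energy_def k2)
    qed
    finally have "restricted_gap \<gamma> n * V \<le> real n * energy \<gamma> n \<phi>"
      using V by (simp add: pos_le_divide_eq)
    then show ?thesis by (simp add: V_def m_def)
  qed
qed

text \<open>The pair (1, 2) avoids the last coordinate, so rotations act within slices. On the slice
  at x the defect is that of the summand y -> \<phi>(s y), with s the slice factor, and the
  collision weight acquires the factor (s^2)^\<gamma>. Applying \<open>gap_le_energy\<close> slice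
  by slice and integrating gives the claim.\<close>

lemma energy_recursion:
  assumes n: "n \<ge> 2" and \<phi>[measurable]: "\<phi> \<in> borel_measurable borel" and F: "coord_sum (Suc n) \<phi> \<in> L2f (usph (Suc n))"
    and \<gamma>: "0 \<le> \<gamma>"
  shows "integrable (marg (Suc n)) (\<lambda>x. ((real (Suc n) - x\<^sup>2) / real n) powr \<gamma> * slice_var n (coord_sum (Suc n) \<phi>) x)" (is "integrable _ ?I")
    and "restricted_gap \<gamma> n * (real (Suc n) / real n * (\<integral>x. ((real (Suc n) - x\<^sup>2) / real n) powr \<gamma> * slice_var n (coord_sum (Suc n) \<phi>) x \<partial>marg (Suc n)))
      \<le> real (Suc n) * energy \<gamma> (Suc n) \<phi>"
proof -
  have n1: "n \<ge> 1" and N: "Suc n \<ge> 2" "Suc n \<ge> 1" and i: "1 \<in> {1..n}" "2 \<in> {1..n}" using n by auto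
  let ?M = "marg (Suc n)" and ?F = "coord_sum (Suc n) \<phi>"
  let ?q = "\<lambda>x. (real (Suc n) - x\<^sup>2) / real n"
  interpret u: prob_space "usph n" by (rule prob_space_usph)
  have q: "AE x in ?M. 0 \<le> ?q x \<and> ?q x \<le> real (Suc n) / real n"
    using AE_marg_bound[OF N(2)] by eventually_elim (auto intro!: divide_right_mono)
  have qm: "(\<lambda>x. ?q x powr \<gamma>) \<in> borel_measurable borel" by measurable
  have qb: "AE x in ?M. \<bar>?q x powr \<gamma>\<bar> \<le> (real (Suc n) / real n) powr \<gamma>"
    using q
  proof eventually_elim
    case (elim x)
    then have "?q x powr \<gamma> \<le> (real (Suc n) / real n) powr \<gamma>" using \<gamma> by (intro powr_mono2) auto
    then show ?case by simp
  qed
  show int: "integrable ?M ?I" by (rule slice_var_weighted(1)[OF n1 F qm qb])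
  have ie: "integrable (usph (Suc n)) (\<lambda>v. ((v 1)\<^sup>2 + (v 2)\<^sup>2) powr \<gamma> * (defect \<phi> (v 1) (v 2))\<^sup>2)"
    by (rule energy_integrable[OF N(1) \<phi> F \<gamma>])
  note sl = usph_slices[OF n1 ie]
  have "restricted_gap \<gamma> n * (\<integral>x. ?I x \<partial>?M) = (\<integral>x. restricted_gap \<gamma> n * ?I x \<partial>?M)" by simp
  also have "\<dots> \<le> (\<integral>x. real n * (\<integral>w. ((glue n x w 1)\<^sup>2 + (glue n x w 2)\<^sup>2) powr \<gamma> * (defect \<phi> (glue n x w 1) (glue n x w 2))\<^sup>2 \<partial>usph n) \<partial>?M)"
  proof (rule integral_mono_AE)
    show "integrable ?M (\<lambda>x. restricted_gap \<gamma> n * ?I x)" using int by simp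
    show "integrable ?M (\<lambda>x. real n * (\<integral>w. ((glue n x w 1)\<^sup>2 + (glue n x w 2)\<^sup>2) powr \<gamma> * (defect \<phi> (glue n x w 1) (glue n x w 2))\<^sup>2 \<partial>usph n))"
      using sl(2) by simp
    show "AE x in ?M. restricted_gap \<gamma> n * ?I x \<le> real n * (\<integral>w. ((glue n x w 1)\<^sup>2 + (glue n x w 2)\<^sup>2) powr \<gamma> * (defect \<phi> (glue n x w 1) (glue n x w 2))\<^sup>2 \<partial>usph n)"
      using q AE_slice_L2f[OF n1 F] AE_marg_bound[OF N(2)]
    proof eventually_elim
      case (elim x)
      define s where "s = slice_factor n x"
      have s2: "s\<^sup>2 = ?q x" using slice_factor_sq[OF n1 elim(3)] by (simp add: s_def)
      define \<psi> where "\<psi> = (\<lambda>y. \<phi> (s * y))"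
      have \<psi>[measurable]: "\<psi> \<in> borel_measurable borel" unfolding \<psi>_def by measurable
      have Fs: "?F (glue n x w) = \<phi> x + coord_sum n \<psi> w" for w
        unfolding slice_sum \<psi>_def s_def ..
      have "(\<lambda>w. ?F (glue n x w) - \<phi> x) \<in> L2f (usph n)"
        by (intro L2f_diff elim L2f_const finite_measure_usph)
      then have GL: "coord_sum n \<psi> \<in> L2f (usph n)" unfolding Fs by simp
      have iG: "integrable (usph n) (coord_sum n \<psi>)" by (rule L2f_integrable[OF finite_measure_usph GL])
      have mean: "(\<integral>w. \<phi> x + coord_sum n \<psi> w \<partial>usph n) = \<phi> x + (\<integral>w. coord_sum n \<psi> w \<partial>usph n)"
        using iG u.prob_space by simp
      have FL: "(\<lambda>w. \<phi> x + coord_sum n \<psi> w) \<in> L2f (usph n)" using elim(2) unfolding Fs .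
      have var: "slice_var n ?F x = (\<integral>w. (coord_sum n \<psi> w)\<^sup>2 \<partial>usph n) - (\<integral>w. coord_sum n \<psi> w \<partial>usph n)\<^sup>2"
        using square_mean_le(2)[OF FL prob_space_usph] square_mean_le(2)[OF GL prob_space_usph]
        unfolding slice_var_def slice_mean_def Fs mean by simp
      have e: "((glue n x w 1)\<^sup>2 + (glue n x w 2)\<^sup>2) powr \<gamma> * (defect \<phi> (glue n x w 1) (glue n x w 2))\<^sup>2
          = ?q x powr \<gamma> * (((w 1)\<^sup>2 + (w 2)\<^sup>2) powr \<gamma> * (defect \<psi> (w 1) (w 2))\<^sup>2)" for w
      proof -
        have "(glue n x w 1)\<^sup>2 + (glue n x w 2)\<^sup>2 = ?q x * ((w 1)\<^sup>2 + (w 2)\<^sup>2)"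
          using i unfolding s2[symmetric] by (simp add: glue_nth s_def[symmetric] power_mult_distrib distrib_left)
        then have "((glue n x w 1)\<^sup>2 + (glue n x w 2)\<^sup>2) powr \<gamma> = ?q x powr \<gamma> * ((w 1)\<^sup>2 + (w 2)\<^sup>2) powr \<gamma>"
          using elim(1) by (simp only: powr_mult)
        moreover have "defect \<phi> (glue n x w 1) (glue n x w 2) = defect \<psi> (w 1) (w 2)"
          using i by (simp add: glue_nth s_def[symmetric] defect_scale \<psi>_def)
        ultimately show ?thesis by simp
      qed
      have "restricted_gap \<gamma> n * ?I x = ?q x powr \<gamma> * (restricted_gap \<gamma> n * slice_var n ?F x)" by simp
      also have "\<dots> \<le> ?q x powr \<gamma> * (real n * energy \<gamma> n \<psi>)"
        unfolding var by (intro mult_left_mono gap_le_energy[OF n \<psi> GL]) simp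
      also have "\<dots> = real n * (\<integral>w. ((glue n x w 1)\<^sup>2 + (glue n x w 2)\<^sup>2) powr \<gamma> * (defect \<phi> (glue n x w 1) (glue n x w 2))\<^sup>2 \<partial>usph n)"
        unfolding e by (simp add: energy_def)
      finally show ?case .
    qed
  qed
  also have "\<dots> = real n * energy \<gamma> (Suc n) \<phi>"
    unfolding energy_def sl(3) by simp
  finally have "real (Suc n) / real n * (restricted_gap \<gamma> n * (\<integral>x. ?I x \<partial>?M)) \<le> real (Suc n) / real n * (real n * energy \<gamma> (Suc n) \<phi>)"
    by (intro mult_left_mono) auto
  then show "restricted_gap \<gamma> n * (real (Suc n) / real n * (\<integral>x. ?I x \<partial>?M)) \<le> real (Suc n) * energy \<gamma> (Suc n) \<phi>"
    using n by (simp only: mult.left_commute) simp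
qed

text \<open>For q > 0 it suffices to show q^(\<gamma> - 1) >= 1 + (1 - \<gamma>)(1 - q) and to
  multiply by q. The former follows from exp z >= 1 + z with z = (\<gamma> - 1) ln q, together with
  ln q <= q - 1. At q = 0 both sides vanish in the convention of \<open>powr\<close>.\<close>

lemma powr_lower_bound:
  fixes q :: real
  assumes q: "q \<ge> 0" and \<gamma>: "0 \<le> \<gamma>" "\<gamma> \<le> 1"
  shows "\<gamma> * q + (1 - \<gamma>) * (1 - (1 - q)\<^sup>2) \<le> q powr \<gamma>"
proof (cases "q = 0")
  case False
  then have q: "q > 0" using assms by simp
  have "1 + (1 - \<gamma>) * (1 - q) \<le> 1 - (1 - \<gamma>) * ln q"
  proof -
    have "(1 - \<gamma>) * ln q \<le> (1 - \<gamma>) * (q - 1)" using ln_le_minus_one[OF q] \<gamma> by (intro mult_left_mono) auto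
    then show ?thesis by (simp add: algebra_simps)
  qed
  also have "\<dots> \<le> exp ((\<gamma> - 1) * ln q)"
    using exp_ge_add_one_self[of "(\<gamma> - 1) * ln q"] by (simp add: algebra_simps)
  also have "\<dots> = q powr (\<gamma> - 1)" using q by (simp add: powr_def)
  finally have "q * (1 + (1 - \<gamma>) * (1 - q)) \<le> q * q powr (\<gamma> - 1)" using q by (intro mult_left_mono) auto
  also have "q * q powr (\<gamma> - 1) = q powr \<gamma>" using q by (simp add: powr_diff)
  finally show ?thesis by (simp add: algebra_simps power2_eq_square)
qed simp

text \<open>For \<gamma> = 1 the weight is W itself and \<open>slice_var_bound1\<close> suffices.
  Hence this step is already available for n = 2, unlike \<open>gap_step\<close>.\<close>

lemma gap_step_one:
  assumes n: "n \<ge> 2"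
  shows "(1 - (4 * real (Suc n) + 1) / ((real (Suc n) - 1)\<^sup>2 * (real (Suc n) + 1))) * restricted_gap 1 n \<le> restricted_gap 1 (Suc n)"
proof (rule gap_greatest)
  show "Suc n \<ge> 2" using n by simp
  have N1: "Suc n \<ge> 1" by simp
  fix \<phi> assume \<phi>n: "\<phi> \<in> normalised (Suc n)"
  let ?F = "coord_sum (Suc n) \<phi>" and ?M = "marg (Suc n)"
  have \<phi>[measurable]: "\<phi> \<in> borel_measurable borel" and F: "?F \<in> L2f (usph (Suc n))"
    and F2: "(\<integral>v. (?F v)\<^sup>2 \<partial>usph (Suc n)) = 1" and F0: "(\<integral>v. ?F v \<partial>usph (Suc n)) = 0"
    using \<phi>n by (auto simp: normalised_def)
  let ?q = "\<lambda>x. (real (Suc n) - x\<^sup>2) / real n"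
  have sm: "slice_var n ?F \<in> borel_measurable borel"
    by (rule slice_var_measurable[OF coord_sum_measurable[OF \<phi>]])
  have "(1 - (real n + 5) / (real n * (real n + 2))) \<le> (\<integral>x. ?q x * slice_var n ?F x \<partial>?M)"
    using slice_var_bound1[OF n F sym_fun_sum F0] F2 by simp
  also have "\<dots> = (\<integral>x. ?q x powr 1 * slice_var n ?F x \<partial>?M)"
  proof (rule integral_cong_AE)
    show "AE x in ?M. ?q x * slice_var n ?F x = ?q x powr 1 * slice_var n ?F x"
      using AE_marg_bound[OF N1] by eventually_elim auto
  qed (use sm in measurable)
  finally have b: "1 - (real n + 5) / (real n * (real n + 2)) \<le> (\<integral>x. ?q x powr 1 * slice_var n ?F x \<partial>?M)" .
  have "(1 - (4 * real (Suc n) + 1) / ((real (Suc n) - 1)\<^sup>2 * (real (Suc n) + 1)))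
      = real (Suc n) / real n * (1 - (real n + 5) / (real n * (real n + 2)))"
  proof -
    have "(1 - (4 * (r + 1) + 1) / (((r + 1) - 1)\<^sup>2 * ((r + 1) + 1))) = (r + 1) / r * (1 - (r + 5) / (r * (r + 2)))"
      if "r > 0" for r :: real
      using that by (simp add: divide_simps) (simp add: algebra_simps power2_eq_square)
    from this[of "real n"] show ?thesis using n by (simp add: add.commute)
  qed
  then have "(1 - (4 * real (Suc n) + 1) / ((real (Suc n) - 1)\<^sup>2 * (real (Suc n) + 1))) * restricted_gap 1 n
     = restricted_gap 1 n * (real (Suc n) / real n * (1 - (real n + 5) / (real n * (real n + 2))))" by simp
  also have "\<dots> \<le> restricted_gap 1 n * (real (Suc n) / real n * (\<integral>x. ?q x powr 1 * slice_var n ?F x \<partial>?M))"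
    by (intro mult_left_mono b gap_nonneg[OF n]) auto
  also have "\<dots> \<le> real (Suc n) * energy 1 (Suc n) \<phi>"
    by (rule energy_recursion(2)[OF n \<phi> F]) simp
  finally show "(1 - (4 * real (Suc n) + 1) / ((real (Suc n) - 1)\<^sup>2 * (real (Suc n) + 1))) * restricted_gap 1 n \<le> real (Suc n) * energy 1 (Suc n) \<phi>" .
qed

text \<open>The part of the variance lost in passing from dimension r + 1 to r. The coefficient of
  \<gamma> comes from \<open>slice_var_bound1\<close>; that of 1 - \<gamma> comes from
  \<open>slice_var_bound0\<close> and, as the price of u^2, from
  \<open>slice_var_quadratic\<close>.\<close>

definition loss :: "real \<Rightarrow> real \<Rightarrow> real" where
  "loss \<gamma> r = \<gamma> * ((r + 5) / (r * (r + 2)))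
     + (1 - \<gamma>) * ((r + 5) / ((r + 1) * (r + 2)) + (r + 4) * (2 * r\<^sup>2 + 2 * r - 1) / (r\<^sup>2 * (r + 1)\<^sup>2 * (r - 1)))"

text \<open>\<open>powr_lower_bound\<close> is integrated against the slice variance, which is
  nonnegative almost everywhere; the three resulting integrals are those estimated for
  \<open>loss\<close>.\<close>

lemma gap_step:
  assumes n: "n \<ge> 3" and \<gamma>: "0 \<le> \<gamma>" "\<gamma> \<le> 1"
  shows "real (Suc n) / real n * (1 - loss \<gamma> (real n)) * restricted_gap \<gamma> n \<le> restricted_gap \<gamma> (Suc n)"
proof (rule gap_greatest)
  have n2: "n \<ge> 2" and n1: "n \<ge> 1" and N1: "Suc n \<ge> 1" using n by auto
  show "Suc n \<ge> 2" using n by simp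
  fix \<phi> assume \<phi>n: "\<phi> \<in> normalised (Suc n)"
  let ?F = "coord_sum (Suc n) \<phi>" and ?M = "marg (Suc n)"
  let ?sv = "slice_var n ?F"
  have \<phi>[measurable]: "\<phi> \<in> borel_measurable borel" and F: "?F \<in> L2f (usph (Suc n))"
    and F2: "(\<integral>v. (?F v)\<^sup>2 \<partial>usph (Suc n)) = 1" and F0: "(\<integral>v. ?F v \<partial>usph (Suc n)) = 0"
    using \<phi>n by (auto simp: normalised_def)
  let ?q = "\<lambda>x. (real (Suc n) - x\<^sup>2) / real n" and ?u = "\<lambda>x. ((x\<^sup>2 - 1) / real n)\<^sup>2"
  have uq: "?u x = (1 - ?q x)\<^sup>2" for x
  proof -
    have "1 - ?q x = (x\<^sup>2 - 1) / real n" using n1 by (simp add: diff_divide_distrib add_divide_distrib)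
    then show ?thesis by simp
  qed
  have qb: "AE x in ?M. 0 \<le> ?q x \<and> ?q x \<le> 2"
    using AE_marg_bound[OF N1]
  proof eventually_elim
    case (elim x)
    have r1: "real n \<ge> 1" using n1 by simp
    have "real (Suc n) - x\<^sup>2 \<le> 2 * real n" using r1 zero_le_power2[of x] unfolding of_nat_Suc by linarith
    then have "?q x \<le> 2" using n1 by (simp add: pos_divide_le_eq)
    moreover have "0 \<le> ?q x" using elim by simp
    ultimately show ?case by blast
  qed
  have q1: "AE x in ?M. \<bar>?q x\<bar> \<le> 2"
    using qb by eventually_elim (simp only: abs_of_nonneg)
  have u1: "AE x in ?M. \<bar>?u x\<bar> \<le> 1" using qb
  proof eventually_elim
    case (elim x)
    then have "\<bar>1 - ?q x\<bar> \<le> 1" by linarith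
    then show ?case unfolding uq by (simp add: abs_square_le_1)
  qed
  have iq: "integrable ?M (\<lambda>x. ?q x * ?sv x)" by (rule slice_var_weighted(1)[OF n1 F _ q1]) measurable
  have iu: "integrable ?M (\<lambda>x. ?u x * ?sv x)" by (rule slice_var_weighted(1)[OF n1 F _ u1]) measurable
  have isv: "integrable ?M ?sv" using slice_var_weighted(1)[OF n1 F, of "\<lambda>x. 1" 1] by simp
  have \<phi>L: "\<phi> \<in> L2f ?M" by (rule sum_L2f_imp[OF n2 \<phi> F])
  define b where "b = (real n + 4) * (2 * (real n)\<^sup>2 + 2 * real n - 1) / ((real n)\<^sup>2 * (real n + 1)\<^sup>2 * (real n - 1))"
  have B1: "1 - (real n + 5) / (real n * (real n + 2)) \<le> (\<integral>x. ?q x * ?sv x \<partial>?M)"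
    using slice_var_bound1[OF n2 F sym_fun_sum F0] F2 by simp
  have B0: "1 - (real n + 5) / ((real n + 1) * (real n + 2)) \<le> (\<integral>x. ?sv x \<partial>?M)"
    using slice_var_bound0[OF n2 F sym_fun_sum F0] F2 by simp
  have Bu: "(\<integral>x. ?u x * ?sv x \<partial>?M) \<le> b"
    using slice_var_quadratic[OF n \<phi>L F0] F2 by (simp add: b_def)
  have lin: "(\<integral>x. a * f x + c * (g x - h x) \<partial>?M) = a * (\<integral>x. f x \<partial>?M) + c * ((\<integral>x. g x \<partial>?M) - (\<integral>x. h x \<partial>?M))"
      "integrable ?M (\<lambda>x. a * f x + c * (g x - h x))"
    if "integrable ?M f" "integrable ?M g" "integrable ?M h" for f g h :: "real \<Rightarrow> real" and a c :: real
    using that by simp_all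
  have "1 - loss \<gamma> (real n) = \<gamma> * (1 - (real n + 5) / (real n * (real n + 2))) + (1 - \<gamma>) * ((1 - (real n + 5) / ((real n + 1) * (real n + 2))) - b)"
    by (simp add: loss_def b_def algebra_simps)
  also have "\<dots> \<le> \<gamma> * (\<integral>x. ?q x * ?sv x \<partial>?M) + (1 - \<gamma>) * ((\<integral>x. ?sv x \<partial>?M) - (\<integral>x. ?u x * ?sv x \<partial>?M))"
    using \<gamma> B1 B0 Bu by (intro add_mono mult_left_mono) auto
  also have "\<dots> = (\<integral>x. \<gamma> * (?q x * ?sv x) + (1 - \<gamma>) * (?sv x - ?u x * ?sv x) \<partial>?M)"
    by (rule lin(1)[OF iq isv iu, symmetric])
  also have "\<dots> \<le> (\<integral>x. ?q x powr \<gamma> * ?sv x \<partial>?M)"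
  proof (rule integral_mono_AE)
    show "integrable ?M (\<lambda>x. \<gamma> * (?q x * ?sv x) + (1 - \<gamma>) * (?sv x - ?u x * ?sv x))"
      by (rule lin(2)[OF iq isv iu])
    show "integrable ?M (\<lambda>x. ?q x powr \<gamma> * ?sv x)"
      by (rule energy_recursion(1)[OF n2 \<phi> F \<gamma>(1)])
    show "AE x in ?M. \<gamma> * (?q x * ?sv x) + (1 - \<gamma>) * (?sv x - ?u x * ?sv x) \<le> ?q x powr \<gamma> * ?sv x"
      using qb slice_var_nonneg[OF n1 F]
    proof eventually_elim
      case (elim x)
      have "\<gamma> * (?q x * ?sv x) + (1 - \<gamma>) * (?sv x - ?u x * ?sv x) = (\<gamma> * ?q x + (1 - \<gamma>) * (1 - (1 - ?q x)\<^sup>2)) * ?sv x"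
        unfolding uq by (simp add: algebra_simps)
      also have "\<dots> \<le> ?q x powr \<gamma> * ?sv x"
        using elim \<gamma> by (intro mult_right_mono powr_lower_bound) auto
      finally show ?case .
    qed
  qed
  finally have c: "1 - loss \<gamma> (real n) \<le> (\<integral>x. ?q x powr \<gamma> * ?sv x \<partial>?M)" .
  have "real (Suc n) / real n * (1 - loss \<gamma> (real n)) * restricted_gap \<gamma> n = restricted_gap \<gamma> n * (real (Suc n) / real n * (1 - loss \<gamma> (real n)))"
    by simp
  also have "\<dots> \<le> restricted_gap \<gamma> n * (real (Suc n) / real n * (\<integral>x. ?q x powr \<gamma> * ?sv x \<partial>?M))"
    by (intro mult_left_mono c gap_nonneg[OF n2]) auto
  also have "\<dots> \<le> real (Suc n) * energy \<gamma> (Suc n) \<phi>"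
    by (rule energy_recursion(2)[OF n2 \<phi> F \<gamma>(1)])
  finally show "real (Suc n) / real n * (1 - loss \<gamma> (real n)) * restricted_gap \<gamma> n \<le> real (Suc n) * energy \<gamma> (Suc n) \<phi>" .
qed

text \<open>On the sphere r = v1^2 + v2^2 is at most n. Since \<gamma> - 1 <= 0, it follows that
  r^\<gamma> = r^(\<gamma> - 1) r >= n^(\<gamma> - 1) r for r > 0, which compares the energies
  pointwise.\<close>

lemma gap_powr_compare:
  assumes n: "n \<ge> 2" and \<gamma>: "0 \<le> \<gamma>" "\<gamma> \<le> 1"
  shows "real n powr (\<gamma> - 1) * restricted_gap 1 n \<le> restricted_gap \<gamma> n"
proof (rule gap_greatest[OF n])
  fix \<phi> assume \<phi>n: "\<phi> \<in> normalised n"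
  have n1: "n \<ge> 1" using n by simp
  have \<phi>[measurable]: "\<phi> \<in> borel_measurable borel" and F: "coord_sum n \<phi> \<in> L2f (usph n)"
    using \<phi>n by (auto simp: normalised_def)
  have "real n powr (\<gamma> - 1) * energy 1 n \<phi> \<le> energy \<gamma> n \<phi>"
    unfolding energy_def integral_mult_right_zero[symmetric]
  proof (rule integral_mono_AE)
    show "integrable (usph n) (\<lambda>v. real n powr (\<gamma> - 1) * (((v 1)\<^sup>2 + (v 2)\<^sup>2) powr 1 * (defect \<phi> (v 1) (v 2))\<^sup>2))"
      using energy_integrable[OF n \<phi> F, of 1] by simp
    show "integrable (usph n) (\<lambda>v. ((v 1)\<^sup>2 + (v 2)\<^sup>2) powr \<gamma> * (defect \<phi> (v 1) (v 2))\<^sup>2)"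
      by (rule energy_integrable[OF n \<phi> F \<gamma>(1)])
    show "AE v in usph n. real n powr (\<gamma> - 1) * (((v 1)\<^sup>2 + (v 2)\<^sup>2) powr 1 * (defect \<phi> (v 1) (v 2))\<^sup>2)
       \<le> ((v 1)\<^sup>2 + (v 2)\<^sup>2) powr \<gamma> * (defect \<phi> (v 1) (v 2))\<^sup>2"
      using AE_usph_sphere[OF n1]
    proof eventually_elim
      case (elim v)
      define r where "r = (v 1)\<^sup>2 + (v 2)\<^sup>2"
      have r0: "r \<ge> 0" by (simp add: r_def)
      have "r = (\<Sum>j\<in>{1,2}. (v j)\<^sup>2)" by (simp add: r_def)
      also have "\<dots> \<le> (\<Sum>j=1..n. (v j)\<^sup>2)" using n by (intro sum_mono2) auto
      finally have rn: "r \<le> real n" using elim by (simp add: kac_sphere_def)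
      have "real n powr (\<gamma> - 1) * r powr 1 \<le> r powr \<gamma>"
      proof (cases "r = 0")
        case False
        then have "r > 0" using r0 by simp
        then have "real n powr (\<gamma> - 1) \<le> r powr (\<gamma> - 1)"
          using rn \<gamma> by (intro powr_mono2') auto
        then have "real n powr (\<gamma> - 1) * r powr 1 \<le> r powr (\<gamma> - 1) * r powr 1" by (intro mult_right_mono) auto
        also have "\<dots> = r powr \<gamma>" by (subst powr_add[symmetric]) simp
        finally show ?thesis .
      qed simp
      from mult_right_mono[OF this, of "(defect \<phi> (v 1) (v 2))\<^sup>2"] show ?case by (simp add: r_def mult.assoc)
    qed
  qed
  then have "real n * (real n powr (\<gamma> - 1) * energy 1 n \<phi>) \<le> real n * energy \<gamma> n \<phi>" by (intro mult_left_mono) auto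
  moreover have "restricted_gap 1 n \<le> real n * energy 1 n \<phi>"
    unfolding restricted_gap_energy[OF n] using \<phi>n by (intro cInf_lower gap_bdd) auto
  then have "real n powr (\<gamma> - 1) * restricted_gap 1 n \<le> real n powr (\<gamma> - 1) * (real n * energy 1 n \<phi>)"
    by (intro mult_left_mono) auto
  ultimately show "real n powr (\<gamma> - 1) * restricted_gap 1 n \<le> real n * energy \<gamma> n \<phi>" by (simp add: mult.left_commute)
qed

section \<open>Dimension two: the sphere is a circle\<close>

lemma nn_integral_circle_shift:
  assumes [measurable]: "G \<in> borel_measurable borel" and per: "\<And>t. G (t + 2 * pi) = G t" and a: "0 \<le> a" "a \<le> 2 * pi"
  shows "(\<integral>\<^sup>+\<theta>. G (a - \<theta>) * indicator {-pi..pi} \<theta> \<partial>lborel) = (\<integral>\<^sup>+\<theta>. G \<theta> * indicator {-pi..pi} \<theta> \<partial>lborel)"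
proof -
  have "(\<integral>\<^sup>+\<theta>. G (a - \<theta>) * indicator {-pi..pi} \<theta> \<partial>lborel) = (\<integral>\<^sup>+\<theta>. G (a - \<theta>) * indicator {-pi..<pi} \<theta> \<partial>lborel)"
    using AE_lborel_singleton[of pi] by (intro nn_integral_cong_AE) (auto simp: indicator_def elim!: eventually_mono)
  also have "\<dots> = (\<integral>\<^sup>+\<theta>. G (a + (-1) * \<theta>) * indicator {a-pi<..a+pi} (a + (-1) * \<theta>) \<partial>lborel)"
    by (intro nn_integral_cong) (auto simp: indicator_def)
  also have "\<dots> = (\<integral>\<^sup>+t. G t * indicator {a-pi<..a+pi} t \<partial>lborel)"
    by (subst nn_integral_real_affine[of "\<lambda>t. G t * indicator {a-pi<..a+pi} t" "-1" a]) auto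
  \<comment> \<open>The reflected interval (a - pi, a + pi] overhangs pi; periodicity moves the
    overhang back to (-pi, a - pi].\<close>
  also have "\<dots> = (\<integral>\<^sup>+t. G t * indicator {a-pi<..pi} t + G t * indicator {pi<..a+pi} t \<partial>lborel)"
    using a by (intro nn_integral_cong) (auto simp: indicator_def)
  also have "\<dots> = (\<integral>\<^sup>+t. G t * indicator {a-pi<..pi} t \<partial>lborel) + (\<integral>\<^sup>+t. G t * indicator {pi<..a+pi} t \<partial>lborel)"
    by (intro nn_integral_add) auto
  also have "(\<integral>\<^sup>+t. G t * indicator {pi<..a+pi} t \<partial>lborel) = (\<integral>\<^sup>+t. G (2 * pi + 1 * t) * indicator {pi<..a+pi} (2 * pi + 1 * t) \<partial>lborel)"
    by (subst nn_integral_real_affine[of "\<lambda>t. G t * indicator {pi<..a+pi} t" 1 "2 * pi"]) auto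
  also have "\<dots> = (\<integral>\<^sup>+t. G t * indicator {-pi<..a-pi} t \<partial>lborel)"
    using per by (intro nn_integral_cong) (auto simp: indicator_def add.commute)
  also have "(\<integral>\<^sup>+t. G t * indicator {a-pi<..pi} t \<partial>lborel) + (\<integral>\<^sup>+t. G t * indicator {-pi<..a-pi} t \<partial>lborel)
      = (\<integral>\<^sup>+t. G t * indicator {a-pi<..pi} t + G t * indicator {-pi<..a-pi} t \<partial>lborel)"
    by (intro nn_integral_add[symmetric]) auto
  also have "\<dots> = (\<integral>\<^sup>+t. G t * indicator {-pi..pi} t \<partial>lborel)"
    using AE_lborel_singleton[of "-pi"] a
    by (intro nn_integral_cong_AE) (auto simp: indicator_def elim!: eventually_mono)
  finally show ?thesis .
qed

text \<open>Comparing the distributions of the two integrands, instead of the integrals, covers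
  integrable and non-integrable g alike.\<close>

lemma integral_circle_shift:
  fixes g :: "real \<Rightarrow> real"
  assumes g[measurable]: "g \<in> borel_measurable borel" and per: "\<And>t. g (t + 2 * pi) = g t" and a: "0 \<le> a" "a \<le> 2 * pi"
  shows "(\<integral>\<theta>. g (a - \<theta>) \<partial>circ) = (\<integral>\<theta>. g \<theta> \<partial>circ)"
proof -
  have m: "g \<in> measurable circ borel" "(\<lambda>\<theta>. g (a - \<theta>)) \<in> measurable circ borel"
    by (rule measurable_restrict_space1, measurable)+
  have "distr circ borel (\<lambda>\<theta>. g (a - \<theta>)) = distr circ borel g"
  proof (rule measure_eqI)
    fix A assume "A \<in> sets (distr circ borel (\<lambda>\<theta>. g (a - \<theta>)))"
    then have A[measurable]: "A \<in> sets borel" by simp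
    have d: "emeasure (distr circ borel h) A = (\<integral>\<^sup>+\<theta>. indicator A (h \<theta>) * indicator {-pi..pi} \<theta> \<partial>lborel)"
      if "h \<in> measurable circ borel" for h
    proof -
      have "emeasure (distr circ borel h) A = (\<integral>\<^sup>+y. indicator A y \<partial>distr circ borel h)" by simp
      also have "\<dots> = (\<integral>\<^sup>+\<theta>. indicator A (h \<theta>) \<partial>circ)" by (rule nn_integral_distr[OF that]) simp
      finally show ?thesis by (simp add: nn_integral_restrict_space)
    qed
    show "emeasure (distr circ borel (\<lambda>\<theta>. g (a - \<theta>))) A = emeasure (distr circ borel g) A"
      unfolding d[OF m(1)] d[OF m(2)]
      by (rule nn_integral_circle_shift[of "\<lambda>t. indicator A (g t)"]) (use per a in auto)
  qed simp
  then show ?thesis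
    using integral_distr[OF m(1), of "\<lambda>x. x"] integral_distr[OF m(2), of "\<lambda>x. x"] by simp
qed

text \<open>The rotations act transitively on the circle, so the pair average is a constant c and
  the weight is 2. Since the sum F has mean zero and norm one, subtracting any constant leaves a
  squared norm 1 + c^2 >= 1. The bound 1 is far from sharp but matches the normalisation of the
  product.\<close>

lemma gap_two: "1 \<le> restricted_gap 1 2"
proof (rule gap_greatest)
  fix \<phi> assume \<phi>n: "\<phi> \<in> normalised 2"
  let ?F = "coord_sum 2 \<phi>"
  interpret u: prob_space "usph 2" by (rule prob_space_usph)
  have \<phi>[measurable]: "\<phi> \<in> borel_measurable borel" and F: "?F \<in> L2f (usph 2)"
    and F2: "(\<integral>v. (?F v)\<^sup>2 \<partial>usph 2) = 1" and F0: "(\<integral>v. ?F v \<partial>usph 2) = 0"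
    using \<phi>n by (auto simp: normalised_def)
  have i: "1 \<in> {1..2::nat}" "2 \<in> {1..2::nat}" "(1::nat) \<noteq> 2" by auto
  have set2: "{1..2::nat} = {1, 2}" by auto
  define g where "g = (\<lambda>t. \<phi> (sqrt 2 * cos t) + \<phi> (sqrt 2 * sin t))"
  have gm: "g \<in> borel_measurable borel" unfolding g_def by measurable
  have gp: "g (t + 2 * pi) = g t" for t by (simp add: g_def)
  define c where "c = (\<integral>\<theta>. g \<theta> \<partial>circ) / (2 * pi)"
  have avg: "pair_avg 1 2 ?F v = c" if v: "v \<in> kac_sphere 2" for v
  proof -
    have "(v 1)\<^sup>2 + (v 2)\<^sup>2 = 2" using v by (simp add: kac_sphere_def set2)
    then have "(v 1 / sqrt 2)\<^sup>2 + (v 2 / sqrt 2)\<^sup>2 = 1" by (simp add: power_divide flip: add_divide_distrib)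
    then obtain a where a: "0 \<le> a" "a < 2 * pi" "v 1 / sqrt 2 = cos a" "v 2 / sqrt 2 = sin a"
      by (rule sincos_total_2pi)
    have v12: "v 1 = sqrt 2 * cos a" "v 2 = sqrt 2 * sin a" using a(3,4) by (simp_all add: field_simps)
    have "?F (pair_rot 1 2 \<theta> v) = g (a - \<theta>)" for \<theta>
      by (simp add: set2 pair_rot_def v12 g_def cos_diff sin_diff algebra_simps)
    then show ?thesis
      using integral_circle_shift[OF gm gp a(1)] a(2) by (simp add: pair_avg_circ c_def)
  qed
  have ie: "integrable (usph 2) (\<lambda>v. ((v 1)\<^sup>2 + (v 2)\<^sup>2) powr 1 * (defect \<phi> (v 1) (v 2))\<^sup>2)"
    by (rule energy_integrable[OF _ \<phi> F]) auto
  have "energy 1 2 \<phi> = (\<integral>v. 2 * (?F v - c)\<^sup>2 \<partial>usph 2)"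
    unfolding energy_def
  proof (rule integral_cong_AE)
    show "AE v in usph 2. ((v 1)\<^sup>2 + (v 2)\<^sup>2) powr 1 * (defect \<phi> (v 1) (v 2))\<^sup>2 = 2 * (?F v - c)\<^sup>2"
      using defect_eq(2)[OF i \<phi> F] AE_usph_sphere[of 2, OF one_le_numeral]
    proof eventually_elim
      case (elim v)
      then have "(v 1)\<^sup>2 + (v 2)\<^sup>2 = 2" by (simp add: kac_sphere_def set2)
      moreover have "defect \<phi> (v 1) (v 2) = ?F v - c" using elim avg by metis
      ultimately show ?case by simp
    qed
    show "(\<lambda>v. ((v 1)\<^sup>2 + (v 2)\<^sup>2) powr 1 * (defect \<phi> (v 1) (v 2))\<^sup>2) \<in> borel_measurable (usph 2)"
      by (rule borel_measurable_integrable[OF ie])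
  qed (use coord_sum_measurable[OF \<phi>, of 2] in measurable)
  also have "\<dots> = 2 * (\<integral>v. (?F v)\<^sup>2 - 2 * c * ?F v + c\<^sup>2 \<partial>usph 2)"
    unfolding integral_mult_right_zero
    by (intro arg_cong[where f="(*) 2"] Bochner_Integration.integral_cong refl) (simp add: power2_eq_square algebra_simps)
  also have "(\<integral>v. (?F v)\<^sup>2 - 2 * c * ?F v + c\<^sup>2 \<partial>usph 2) = 1 + c\<^sup>2"
    using L2f_sq[OF F] L2f_integrable[OF finite_measure_usph F] F2 F0
    by (simp add: u.prob_space[simplified])
  finally have "energy 1 2 \<phi> = 2 * (1 + c\<^sup>2)" .
  then show "1 \<le> real 2 * energy 1 2 \<phi>" using zero_le_power2[of c] by simp
qed simp

text \<open>Over the common denominator r(x) x^2, the exact losses at \<gamma> = 1 and \<gamma> = 0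
  have the left sides as numerators; they are dominated by p + q and p. After the shift y = x - 3
  both differences are polynomials with positive coefficients.\<close>

lemma coeff_numerators:
  fixes x :: real
  assumes "x \<ge> 3"
  shows "(4 * x + 1) * ((x + 6) * (x - 2)\<^sup>2 * (x - 1) * x\<^sup>2) \<le> coeff_p x + coeff_q x"
    and "(3 * x * (x - 2) * (x - 1)\<^sup>2 + (x + 3) * (2 * x\<^sup>2 - 2 * x - 1) * (x + 1)) * ((x + 6) * (x - 2) * x) \<le> coeff_p x"
    and "coeff_r x = (x + 6) * (x - 2)\<^sup>2 * (x - 1) ^ 3 * (x + 1)"
proof -
  define y where "y = x - 3"
  have x: "x = y + 3" and y: "y \<ge> 0" using assms by (auto simp: y_def)
  have "coeff_p x + coeff_q x - (4 * x + 1) * ((x + 6) * (x - 2)\<^sup>2 * (x - 1) * x\<^sup>2)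
     = 17010 * y ^ 0 + 45927 * y ^ 1 + 48843 * y ^ 2 + 27036 * y ^ 3 + 8496 * y ^ 4 + 1527 * y ^ 5 + 147 * y ^ 6 + 6 * y ^ 7"
    unfolding coeff_p_def coeff_q_def x by algebra
  moreover have "0 \<le> 17010 * y ^ 0 + 45927 * y ^ 1 + 48843 * y ^ 2 + 27036 * y ^ 3 + 8496 * y ^ 4 + 1527 * y ^ 5 + 147 * y ^ 6 + 6 * y ^ 7"
    using y by simp
  ultimately show "(4 * x + 1) * ((x + 6) * (x - 2)\<^sup>2 * (x - 1) * x\<^sup>2) \<le> coeff_p x + coeff_q x" by linarith
  have "coeff_p x - (3 * x * (x - 2) * (x - 1)\<^sup>2 + (x + 3) * (2 * x\<^sup>2 - 2 * x - 1) * (x + 1)) * ((x + 6) * (x - 2) * x)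
     = 45684 * y ^ 0 + 73818 * y ^ 1 + 49524 * y ^ 2 + 17801 * y ^ 3 + 3627 * y ^ 4 + 393 * y ^ 5 + 17 * y ^ 6"
    unfolding coeff_p_def x by algebra
  moreover have "0 \<le> 45684 * y ^ 0 + 73818 * y ^ 1 + 49524 * y ^ 2 + 17801 * y ^ 3 + 3627 * y ^ 4 + 393 * y ^ 5 + 17 * y ^ 6"
    using y by simp
  ultimately show "(3 * x * (x - 2) * (x - 1)\<^sup>2 + (x + 3) * (2 * x\<^sup>2 - 2 * x - 1) * (x + 1)) * ((x + 6) * (x - 2) * x) \<le> coeff_p x" by linarith
  show "coeff_r x = (x + 6) * (x - 2)\<^sup>2 * (x - 1) ^ 3 * (x + 1)"
    unfolding coeff_r_def by algebra
qed

section \<open>Explicit constants\<close>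

text \<open>The step factor of \<open>gap_step\<close> and 1 - A_N/N^2 are both affine in \<gamma>,
  so they need to be compared only at \<gamma> = 1 (fact \<open>a1\<close>) and \<gamma> = 0 (fact
  \<open>a0\<close>). The hypothesis N >= 4 is n >= 3 in \<open>gap_step\<close>.\<close>

lemma gap_step_coeff:
  assumes N: "N \<ge> 4" and \<gamma>: "0 \<le> \<gamma>" "\<gamma> \<le> 1"
  shows "(1 - coeff_A \<gamma> N / (real N)\<^sup>2) * restricted_gap \<gamma> (N - 1) \<le> restricted_gap \<gamma> N"
proof -
  define n where "n = N - 1"
  have n: "n \<ge> 3" "N = Suc n" using N by (auto simp: n_def)
  define x where "x = real N"
  have x: "x \<ge> 4" and r: "real n = x - 1" using N n by (auto simp: x_def)
  have p: "x > 0" "x - 1 > 0" "x - 2 > 0" "x + 1 > 0" "x + 6 > 0" using x by auto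
  have cr: "coeff_r x = (x + 6) * (x - 2)\<^sup>2 * (x - 1) ^ 3 * (x + 1)" using coeff_numerators(3) x by simp
  have r0: "coeff_r x * x\<^sup>2 > 0" unfolding cr using p by simp
  define E where "E = 3 * x * (x - 2) * (x - 1)\<^sup>2 + (x + 3) * (2 * x\<^sup>2 - 2 * x - 1) * (x + 1)"
  have a1: "x / (x - 1) * (1 - (x - 1 + 5) / ((x - 1) * (x - 1 + 2)))
      = 1 - (4 * x + 1) * ((x + 6) * (x - 2)\<^sup>2 * (x - 1) * x\<^sup>2) / (coeff_r x * x\<^sup>2)"
  proof -
    have "(4 * x + 1) * ((x + 6) * (x - 2)\<^sup>2 * (x - 1) * x\<^sup>2) / (coeff_r x * x\<^sup>2) = (4 * x + 1) / ((x - 1)\<^sup>2 * (x + 1))"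
      unfolding cr using p by (simp add: divide_simps power2_eq_square power3_eq_cube)
    moreover have "x / (x - 1) * (1 - (x - 1 + 5) / ((x - 1) * (x - 1 + 2))) = 1 - (4 * x + 1) / ((x - 1)\<^sup>2 * (x + 1))"
      using p by (simp add: divide_simps) algebra
    ultimately show ?thesis by simp
  qed
  have a0: "x / (x - 1) * (1 - ((x - 1 + 5) / ((x - 1 + 1) * (x - 1 + 2)) + (x - 1 + 4) * (2 * (x - 1)\<^sup>2 + 2 * (x - 1) - 1) / ((x - 1)\<^sup>2 * (x - 1 + 1)\<^sup>2 * (x - 1 - 1))))
      = 1 - E * ((x + 6) * (x - 2) * x) / (coeff_r x * x\<^sup>2)"
  proof -
    have "E * ((x + 6) * (x - 2) * x) / (coeff_r x * x\<^sup>2) = E / (x * (x - 2) * (x - 1) ^ 3 * (x + 1))"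
      unfolding cr using p by (simp add: divide_simps power2_eq_square power3_eq_cube)
    moreover have "x / (x - 1) * (1 - ((x + 4) / (x * (x + 1)) + (x + 3) * (2 * x\<^sup>2 - 2 * x - 1) / ((x - 1)\<^sup>2 * x\<^sup>2 * (x - 2))))
       = 1 - E / (x * (x - 2) * (x - 1) ^ 3 * (x + 1))"
      unfolding E_def using p by (simp add: divide_simps) algebra
    moreover have "2 * (x - 1)\<^sup>2 + 2 * (x - 1) - 1 = 2 * x\<^sup>2 - 2 * x - 1" by algebra
    moreover have "x - 1 + 5 = x + 4" "x - 1 + 1 = x" "x - 1 + 2 = x + 1" "x - 1 + 4 = x + 3" "x - 1 - 1 = x - 2"
      by simp_all
    ultimately show ?thesis by (simp only:)
  qed
  have "1 - coeff_A \<gamma> N / x\<^sup>2 = \<gamma> * (1 - (coeff_p x + coeff_q x) / (coeff_r x * x\<^sup>2)) + (1 - \<gamma>) * (1 - coeff_p x / (coeff_r x * x\<^sup>2))"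
    unfolding coeff_A_def x_def[symmetric] by (simp add: algebra_simps add_divide_distrib diff_divide_distrib)
  also have "\<dots> \<le> \<gamma> * (1 - (4 * x + 1) * ((x + 6) * (x - 2)\<^sup>2 * (x - 1) * x\<^sup>2) / (coeff_r x * x\<^sup>2))
      + (1 - \<gamma>) * (1 - E * ((x + 6) * (x - 2) * x) / (coeff_r x * x\<^sup>2))"
    using \<gamma> x r0 coeff_numerators(1,2)[of x] unfolding E_def
    by (intro add_mono mult_left_mono diff_left_mono divide_right_mono) auto
  also have "\<dots> = x / (x - 1) * (1 - loss \<gamma> (x - 1))"
  proof -
    have "\<gamma> * (K * (1 - A)) + (1 - \<gamma>) * (K * (1 - B)) = K * (1 - (\<gamma> * A + (1 - \<gamma>) * B))" for K A B :: real
      by algebra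
    then show ?thesis unfolding a1[symmetric] a0[symmetric] loss_def .
  qed
  also have "\<dots> = real (Suc n) / real n * (1 - loss \<gamma> (real n))"
    unfolding r by (simp add: x_def n)
  finally have c: "1 - coeff_A \<gamma> N / (real N)\<^sup>2 \<le> real (Suc n) / real n * (1 - loss \<gamma> (real n))"
    by (simp only: x_def)
  have "(1 - coeff_A \<gamma> N / (real N)\<^sup>2) * restricted_gap \<gamma> n \<le> real (Suc n) / real n * (1 - loss \<gamma> (real n)) * restricted_gap \<gamma> n"
    using n by (intro mult_right_mono c gap_nonneg) auto
  also have "\<dots> \<le> restricted_gap \<gamma> (Suc n)" by (rule gap_step[OF n(1) \<gamma>])
  finally show ?thesis by (simp add: n)
qed

text \<open>A_3/9 lies between 7 and 21, so the left side is nonpositive.\<close>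

lemma gap_step_three:
  assumes \<gamma>: "0 \<le> \<gamma>" "\<gamma> \<le> 1"
  shows "(1 - coeff_A \<gamma> 3 / (real 3)\<^sup>2) * restricted_gap \<gamma> (3 - 1) \<le> restricted_gap \<gamma> 3"
proof -
  have "coeff_A \<gamma> 3 / (real 3)\<^sup>2 = (53784 - 34668 * \<gamma>) / 2592"
    by (simp add: coeff_A_def coeff_p_def coeff_q_def coeff_r_def)
  then have "1 - coeff_A \<gamma> 3 / (real 3)\<^sup>2 \<le> 0" using \<gamma> by simp
  then have "(1 - coeff_A \<gamma> 3 / (real 3)\<^sup>2) * restricted_gap \<gamma> 2 \<le> 0"
    using gap_nonneg[of 2 \<gamma>] by (intro mult_nonpos_nonneg) auto
  also have "0 \<le> restricted_gap \<gamma> 3" by (rule gap_nonneg) simp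
  finally show ?thesis by simp
qed

lemma gap_recursion:
  assumes N: "N \<ge> 3" and \<gamma>: "0 \<le> \<gamma>" "\<gamma> \<le> 1"
  shows "(1 - coeff_A \<gamma> N / (real N)\<^sup>2) * restricted_gap \<gamma> (N - 1) \<le> restricted_gap \<gamma> N"
proof (cases "N = 3")
  case True
  then show ?thesis using gap_step_three[OF \<gamma>] by simp
next
  case False
  then show ?thesis using gap_step_coeff[of N \<gamma>] N \<gamma> by simp
qed

section \<open>The product bound and the limit inferior\<close>

definition base_factor :: "nat \<Rightarrow> real" where
  "base_factor j = 1 - (4 * real j + 1) / ((real j - 1)\<^sup>2 * (real j + 1))"

lemma base_factor_bounds:
  assumes "j \<ge> 3"
  shows "0 < base_factor j" "base_factor j \<le> 1"
proof -
  define x where "x = real j"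
  have x: "x \<ge> 3" using assms by (simp add: x_def)
  have d: "(x - 1)\<^sup>2 * (x + 1) > 0" using x by simp
  have "0 < x * ((x - 3) * (x + 2) + 1)" using x by (intro mult_pos_pos add_nonneg_pos mult_nonneg_nonneg) auto
  also have "\<dots> = (x - 1)\<^sup>2 * (x + 1) - (4 * x + 1)" by algebra
  finally show "0 < base_factor j" using d by (simp add: base_factor_def x_def[symmetric])
  show "base_factor j \<le> 1" using x d by (simp add: base_factor_def x_def[symmetric])
qed

lemma gap_one_lower: "n \<ge> 2 \<Longrightarrow> (\<Prod>j=3..n. base_factor j) \<le> restricted_gap 1 n"
proof (induction n rule: nat_induct_at_least)
  case base
  show ?case using gap_two by simp
next
  case (Suc n)
  have "(\<Prod>j=3..Suc n. base_factor j) = base_factor (Suc n) * (\<Prod>j=3..n. base_factor j)"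
    using Suc.hyps by (simp add: prod.nat_ivl_Suc')
  also have "\<dots> \<le> base_factor (Suc n) * restricted_gap 1 n"
    using base_factor_bounds(1)[of "Suc n"] Suc by (intro mult_left_mono) auto
  also have "\<dots> \<le> restricted_gap 1 (Suc n)"
    using gap_step_one[OF Suc.hyps] by (simp only: base_factor_def)
  finally show ?case .
qed

text \<open>The recursion factor with index N0 is applied to the gap in dimension N0 - 1, while the
  stated constant refers to N0. Both discrepancies are favourable: the additional base factor is at
  most 1, and N0^(\<gamma> - 1) is at most (N0 - 1)^(\<gamma> - 1).\<close>

lemma gap_base:
  assumes N0: "N0 \<ge> 3" and \<gamma>: "0 \<le> \<gamma>" "\<gamma> \<le> 1"
  shows "real N0 powr (\<gamma> - 1) * (\<Prod>j=3..N0. base_factor j) \<le> restricted_gap \<gamma> (N0 - 1)"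
proof -
  define n where "n = N0 - 1"
  have n: "n \<ge> 2" "N0 = Suc n" using N0 by (auto simp: n_def)
  have pos: "(\<Prod>j=3..n. base_factor j) \<ge> 0"
    using base_factor_bounds(1) by (intro prod_nonneg) (auto intro: less_imp_le)
  have "(\<Prod>j=3..N0. base_factor j) = base_factor (Suc n) * (\<Prod>j=3..n. base_factor j)"
    using n by (simp add: prod.nat_ivl_Suc')
  also have "\<dots> \<le> 1 * (\<Prod>j=3..n. base_factor j)"
    using base_factor_bounds(2)[of "Suc n"] n pos by (intro mult_right_mono) auto
  also have "\<dots> \<le> restricted_gap 1 n" using gap_one_lower[OF n(1)] by simp
  finally have "real N0 powr (\<gamma> - 1) * (\<Prod>j=3..N0. base_factor j) \<le> real N0 powr (\<gamma> - 1) * restricted_gap 1 n"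
    by (intro mult_left_mono) auto
  also have "\<dots> \<le> real n powr (\<gamma> - 1) * restricted_gap 1 n"
    using n \<gamma> by (intro mult_right_mono gap_nonneg powr_mono2') auto
  also have "\<dots> \<le> restricted_gap \<gamma> n" by (rule gap_powr_compare[OF n(1) \<gamma>])
  finally show ?thesis by (simp add: n_def)
qed

text \<open>Positivity of the factors from N0 on is what permits multiplying the inequalities of
  successive steps.\<close>

lemma gap_product:
  assumes N0: "N0 \<ge> 3" and \<gamma>: "0 \<le> \<gamma>" "\<gamma> \<le> 1"
    and lt: "\<And>k. k \<ge> N0 \<Longrightarrow> coeff_A \<gamma> k / (real k)\<^sup>2 < 1" and N: "N \<ge> N0"
  shows "real N0 powr (\<gamma> - 1) * (\<Prod>j=3..N0. base_factor j) * (\<Prod>k=N0..N. 1 - coeff_A \<gamma> k / (real k)\<^sup>2)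
    \<le> restricted_gap \<gamma> N"
  using N
proof (induction N rule: nat_induct_at_least)
  case base
  have "real N0 powr (\<gamma> - 1) * (\<Prod>j=3..N0. base_factor j) * (1 - coeff_A \<gamma> N0 / (real N0)\<^sup>2)
     \<le> restricted_gap \<gamma> (N0 - 1) * (1 - coeff_A \<gamma> N0 / (real N0)\<^sup>2)"
    using lt[of N0] by (intro mult_right_mono gap_base N0 \<gamma>) auto
  also have "\<dots> \<le> restricted_gap \<gamma> N0" using gap_recursion[OF N0 \<gamma>] by (simp add: mult.commute)
  finally show ?case by simp
next
  case (Suc N)
  let ?c = "real N0 powr (\<gamma> - 1) * (\<Prod>j=3..N0. base_factor j)" and ?a = "\<lambda>k. 1 - coeff_A \<gamma> k / (real k)\<^sup>2"
  have "(\<Prod>k=N0..Suc N. ?a k) = ?a (Suc N) * (\<Prod>k=N0..N. ?a k)"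
    using Suc.hyps by (simp only: prod.nat_ivl_Suc' le_SucI)
  then have "?c * (\<Prod>k=N0..Suc N. ?a k) = ?a (Suc N) * (?c * (\<Prod>k=N0..N. ?a k))" by (simp only: mult.left_commute)
  also have "\<dots> \<le> ?a (Suc N) * restricted_gap \<gamma> N"
    using lt[of "Suc N"] Suc by (intro mult_left_mono Suc.IH) auto
  also have "\<dots> \<le> restricted_gap \<gamma> (Suc N)"
    using gap_recursion[OF _ \<gamma>, of "Suc N"] Suc.hyps N0 by simp
  finally show ?case .
qed

text \<open>The numbers 540 and 550 are the sums of the absolute coefficients of p and q. For x >= 4
  both x - 1 and x - 2 are at least x/2, so r(x) >= x^7/32; the bound is 1090 times 32.\<close>

lemma coeff_A_bound:
  assumes k: "k \<ge> 4" and \<gamma>: "0 \<le> \<gamma>" "\<gamma> \<le> 1"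
  shows "\<bar>coeff_A \<gamma> k\<bar> \<le> 34880"
proof -
  define x where "x = real k"
  have x: "x \<ge> 4" using k by (simp add: x_def)
  have pw: "0 \<le> x ^ i" "x ^ i \<le> x ^ 7" if "i \<le> 7" for i using x that by (auto intro!: power_increasing)
  have p: "\<bar>coeff_p x\<bar> \<le> 540 * x ^ 7"
    unfolding coeff_p_def using pw[of 2] pw[of 3] pw[of 4] pw[of 5] pw[of 6] pw[of 7] by (intro abs_leI) linarith+
  have q: "\<bar>coeff_q x\<bar> \<le> 550 * x ^ 7"
    unfolding coeff_q_def using pw[of 2] pw[of 3] pw[of 4] pw[of 5] pw[of 6] pw[of 7] by (intro abs_leI) linarith+
  have "\<bar>coeff_p x + \<gamma> * coeff_q x\<bar> \<le> \<bar>coeff_p x\<bar> + \<gamma> * \<bar>coeff_q x\<bar>"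
    using \<gamma> abs_triangle_ineq[of "coeff_p x" "\<gamma> * coeff_q x"] by (simp add: abs_mult)
  also have "\<dots> \<le> \<bar>coeff_p x\<bar> + 1 * \<bar>coeff_q x\<bar>" using \<gamma> by (intro add_left_mono mult_right_mono) auto
  also have "\<dots> \<le> 1090 * x ^ 7" using p q by simp
  finally have num: "\<bar>coeff_p x + \<gamma> * coeff_q x\<bar> \<le> 1090 * x ^ 7" .
  have "x ^ 7 / 32 = x * (x / 2)\<^sup>2 * (x / 2) ^ 3 * x"
  proof -
    have "(2 * h) ^ 7 = 32 * (2 * h * h\<^sup>2 * h ^ 3 * (2 * h))" for h :: real by algebra
    from this[of "x / 2"] show ?thesis by simp
  qed
  also have "\<dots> \<le> (x + 6) * (x - 2)\<^sup>2 * (x - 1) ^ 3 * (x + 1)"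
    using x by (intro mult_mono power_mono) auto
  also have "\<dots> = coeff_r x" using coeff_numerators(3)[of x] x by simp
  finally have den: "x ^ 7 / 32 \<le> coeff_r x" .
  have x7: "x ^ 7 > 0" using x by simp
  then have r0: "coeff_r x > 0" using den by linarith
  have "1090 * x ^ 7 \<le> 34880 * coeff_r x" using den by linarith
  then have "\<bar>coeff_p x + \<gamma> * coeff_q x\<bar> / coeff_r x \<le> 34880"
    using num r0 by (simp add: pos_divide_le_eq)
  then show ?thesis using r0 by (simp add: coeff_A_def x_def[symmetric])
qed

lemma coeff_A_summable:
  assumes \<gamma>: "0 \<le> \<gamma>" "\<gamma> \<le> 1"
  shows "summable (\<lambda>k. \<bar>coeff_A \<gamma> k / (real k)\<^sup>2\<bar>)"
proof (rule summable_comparison_test_ev)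
  show "summable (\<lambda>k. 34880 * inverse (real k ^ 2))"
    by (intro summable_mult inverse_power_summable) simp
  show "\<forall>\<^sub>F k in sequentially. norm \<bar>coeff_A \<gamma> k / (real k)\<^sup>2\<bar> \<le> 34880 * inverse (real k ^ 2)"
    using eventually_ge_at_top[of 4]
  proof eventually_elim
    case (elim k)
    have "\<bar>coeff_A \<gamma> k\<bar> / (real k)\<^sup>2 \<le> 34880 / (real k)\<^sup>2"
      by (intro divide_right_mono coeff_A_bound elim \<gamma>) simp
    then show ?case by (simp add: divide_inverse abs_mult)
  qed
qed

lemma coeff_A_eventually:
  assumes \<gamma>: "0 \<le> \<gamma>" "\<gamma> \<le> 1"
  shows "\<forall>\<^sub>F N0 in sequentially. \<forall>N\<ge>N0. coeff_A \<gamma> N / (real N)\<^sup>2 < 1"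
proof (rule eventually_all_ge_at_top)
  have "(\<lambda>k. \<bar>coeff_A \<gamma> k / (real k)\<^sup>2\<bar>) \<longlonglongrightarrow> 0"
    by (rule summable_LIMSEQ_zero[OF coeff_A_summable[OF \<gamma>]])
  then have "\<forall>\<^sub>F k in sequentially. \<bar>coeff_A \<gamma> k / (real k)\<^sup>2\<bar> < 1"
    by (intro order_tendstoD) auto
  then show "\<forall>\<^sub>F N in sequentially. coeff_A \<gamma> N / (real N)\<^sup>2 < 1"
    by eventually_elim (rule le_less_trans[OF abs_ge_self])
qed

text \<open>A_k is bounded, so A_k/k^2 is absolutely summable and the infinite product converges; as
  all its factors are positive, its value is positive. The index is shifted by N0 because
  \<open>prodinf\<close> starts at 0.\<close>

lemma gap_liminf:
  assumes N0: "N0 \<ge> 3" and \<gamma>: "0 \<le> \<gamma>" "\<gamma> \<le> 1"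
    and lt: "\<And>k. k \<ge> N0 \<Longrightarrow> coeff_A \<gamma> k / (real k)\<^sup>2 < 1"
  defines "a \<equiv> \<lambda>k. 1 - coeff_A \<gamma> (N0 + k) / (real (N0 + k))\<^sup>2"
    and "c \<equiv> real N0 powr (\<gamma> - 1) * (\<Prod>j=3..N0. base_factor j)"
  shows "convergent_prod a" "0 < c * prodinf a"
    "ereal (c * prodinf a) \<le> liminf (\<lambda>N. ereal (restricted_gap \<gamma> N))"
proof -
  have a0: "a k > 0" for k using lt[of "N0 + k"] by (simp add: a_def)
  have "summable (\<lambda>k. norm (a k - 1))"
  proof -
    have "summable (\<lambda>k. \<bar>coeff_A \<gamma> (k + N0) / (real (k + N0))\<^sup>2\<bar>)"
      by (rule summable_ignore_initial_segment[OF coeff_A_summable[OF \<gamma>]])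
    then show ?thesis by (simp add: a_def add.commute)
  qed
  then show conv: "convergent_prod a"
    by (intro abs_convergent_prod_imp_convergent_prod) (simp only: abs_convergent_prod_conv_summable)
  have lim: "(\<lambda>m. \<Prod>i\<le>m. a i) \<longlonglongrightarrow> prodinf a" by (rule convergent_prod_LIMSEQ[OF conv])
  have "prodinf a \<noteq> 0" using a0 by (intro prodinf_nonzero[OF conv]) (auto simp: less_imp_neq[symmetric])
  moreover have "prodinf a \<ge> 0"
    by (rule LIMSEQ_le_const[OF lim]) (auto intro!: prod_nonneg less_imp_le[OF a0])
  ultimately have pa: "prodinf a > 0" by simp
  have c0: "c > 0"
    unfolding c_def using N0 base_factor_bounds(1) by (intro mult_pos_pos prod_pos) auto
  show "0 < c * prodinf a" using c0 pa by simp
  let ?f = "\<lambda>N. c * (\<Prod>k=N0..N. 1 - coeff_A \<gamma> k / (real k)\<^sup>2)"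
  have "(\<lambda>m. ?f (m + N0)) \<longlonglongrightarrow> c * prodinf a"
  proof -
    have "(\<Prod>k=N0..m + N0. 1 - coeff_A \<gamma> k / (real k)\<^sup>2) = (\<Prod>i\<le>m. a i)" for m
      unfolding a_def by (rule prod.reindex_bij_witness[of _ "\<lambda>i. N0 + i" "\<lambda>k. k - N0"]) auto
    then show ?thesis using tendsto_mult_left[OF lim, of c] by simp
  qed
  then have "?f \<longlonglongrightarrow> c * prodinf a" by (rule LIMSEQ_offset)
  then have "liminf (\<lambda>N. ereal (?f N)) = ereal (c * prodinf a)"
    by (intro lim_imp_Liminf) auto
  moreover have "liminf (\<lambda>N. ereal (?f N)) \<le> liminf (\<lambda>N. ereal (restricted_gap \<gamma> N))"
  proof (rule Liminf_mono)
    show "\<forall>\<^sub>F N in sequentially. ereal (?f N) \<le> ereal (restricted_gap \<gamma> N)"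
      using eventually_ge_at_top[of N0]
    proof eventually_elim
      case (elim N)
      show ?case unfolding c_def using gap_product[OF N0 \<gamma> lt elim] by simp
    qed
  qed
  ultimately show "ereal (c * prodinf a) \<le> liminf (\<lambda>N. ereal (restricted_gap \<gamma> N))" by simp
qed

text \<open>The last conjunct expresses the computable lower bound: for each admissible N0 it gives
  an explicit positive number below the limit inferior. That some N0 is admissible is the third
  conjunct.\<close>

theorem theorem1p2:
  fixes \<gamma> :: real
  assumes "0 \<le> \<gamma>" and "\<gamma> \<le> 1"
  shows "(\<forall>N\<ge>3. restricted_gap \<gamma> N
            \<ge> (1 - coeff_A \<gamma> N / (real N)\<^sup>2) * restricted_gap \<gamma> (N - 1))
    \<and> (\<forall>N0\<ge>3. (\<forall>N\<ge>N0. coeff_A \<gamma> N / (real N)\<^sup>2 < 1) \<longrightarrow>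
         (\<forall>N\<ge>N0. restricted_gap \<gamma> N
            \<ge> real N0 powr (\<gamma> - 1)
              * (\<Prod>j=3..N0. 1 - (4 * real j + 1) / ((real j - 1)\<^sup>2 * (real j + 1)))
              * (\<Prod>k=N0..N. 1 - coeff_A \<gamma> k / (real k)\<^sup>2)))
    \<and> (\<forall>\<^sub>F N0 in sequentially. \<forall>N\<ge>N0. coeff_A \<gamma> N / (real N)\<^sup>2 < 1)
    \<and> liminf (\<lambda>N. ereal (restricted_gap \<gamma> N)) > 0
    \<and> (\<forall>N0\<ge>3. (\<forall>N\<ge>N0. coeff_A \<gamma> N / (real N)\<^sup>2 < 1) \<longrightarrow>
         convergent_prod (\<lambda>k. 1 - coeff_A \<gamma> (N0 + k) / (real (N0 + k))\<^sup>2)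
         \<and> (let b = real N0 powr (\<gamma> - 1)
              * (\<Prod>j=3..N0. 1 - (4 * real j + 1) / ((real j - 1)\<^sup>2 * (real j + 1)))
              * (\<Prod>k. 1 - coeff_A \<gamma> (N0 + k) / (real (N0 + k))\<^sup>2)
            in 0 < b \<and> ereal b \<le> liminf (\<lambda>N. ereal (restricted_gap \<gamma> N))))"
  unfolding base_factor_def[symmetric] Let_def
proof (intro conjI allI impI)
  show "restricted_gap \<gamma> N \<ge> (1 - coeff_A \<gamma> N / (real N)\<^sup>2) * restricted_gap \<gamma> (N - 1)" if "N \<ge> 3" for N
    by (rule gap_recursion[OF that assms])
  show "\<forall>\<^sub>F N0 in sequentially. \<forall>N\<ge>N0. coeff_A \<gamma> N / (real N)\<^sup>2 < 1"
    by (rule coeff_A_eventually[OF assms])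
  show "liminf (\<lambda>N. ereal (restricted_gap \<gamma> N)) > 0"
  proof -
    have "\<forall>\<^sub>F N0 in sequentially. N0 \<ge> 3 \<and> (\<forall>N\<ge>N0. coeff_A \<gamma> N / (real N)\<^sup>2 < 1)"
      using coeff_A_eventually[OF assms] eventually_ge_at_top[of 3] by eventually_elim auto
    then obtain N0 where N0: "N0 \<ge> 3" "\<And>N. N \<ge> N0 \<Longrightarrow> coeff_A \<gamma> N / (real N)\<^sup>2 < 1"
      by (auto dest!: eventually_happens)
    from gap_liminf(2,3)[OF N0(1) assms N0(2)] show ?thesis
      by (meson ereal_less(2) less_le_trans)
  qed
  fix N0 :: nat assume N0: "N0 \<ge> 3" and "\<forall>N\<ge>N0. coeff_A \<gamma> N / (real N)\<^sup>2 < 1"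
  then have lt: "\<And>N. N \<ge> N0 \<Longrightarrow> coeff_A \<gamma> N / (real N)\<^sup>2 < 1" by blast
  show "restricted_gap \<gamma> N \<ge> real N0 powr (\<gamma> - 1) * (\<Prod>j=3..N0. base_factor j)
      * (\<Prod>k=N0..N. 1 - coeff_A \<gamma> k / (real k)\<^sup>2)" if "N \<ge> N0" for N
    by (rule gap_product[OF N0 assms lt that])
  show "convergent_prod (\<lambda>k. 1 - coeff_A \<gamma> (N0 + k) / (real (N0 + k))\<^sup>2)"
    by (rule gap_liminf(1)[OF N0 assms lt])
  show "0 < real N0 powr (\<gamma> - 1) * (\<Prod>j=3..N0. base_factor j) * (\<Prod>k. 1 - coeff_A \<gamma> (N0 + k) / (real (N0 + k))\<^sup>2)"
    by (rule gap_liminf(2)[OF N0 assms lt])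
  show "ereal (real N0 powr (\<gamma> - 1) * (\<Prod>j=3..N0. base_factor j) * (\<Prod>k. 1 - coeff_A \<gamma> (N0 + k) / (real (N0 + k))\<^sup>2))
     \<le> liminf (\<lambda>N. ereal (restricted_gap \<gamma> N))"
    by (rule gap_liminf(3)[OF N0 assms lt])
qed

end
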